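(* (a) Let $\varphi\in\mathcal O(\mathbb D^3,\mathbb D)$ extend to a $\mathcal C^3$-smooth function on $\overline{\mathbb D^3}$. Assume there is $\xi\in\mathbb T^3$ with $\varphi(\xi)\in\mathbb T$ such that $\varphi$ is truly at least two-dimensional at $\xi$ of order $2$. Then there exist a neighbourhood $\mathcal U$ of $\xi$ and $C>0$ such that for all $\beta\in(-1,0]$, $\eta\in\mathbb T$, $\delta>0$: $$V_\beta\big(\{z\in\mathbb D^3\cap\mathcal U:\ |\varphi(z)-\eta|<\delta\}\big)\le C\delta^{2+\beta+\frac12}.$$ (b) Let $\varphi=(\varphi_1,\varphi_2)\in\mathcal O(\mathbb D^3,\mathbb D^2)$ extend to a $\mathcal C^2$-smooth map on $\overline{\mathbb D^3}$. Assume there is $\xi\in\mathbb T^3$ with $\varphi(\xi)\in\mathbb T^2$ such that $\varphi$ is truly three-dimensional at $\xi$ of order $2$. Then there exist a neighbourhood $\mathcal U$ of $\xi$ and $C>0$ such that for all $\beta\in(-1,0]$, $\eta\in\mathbb T^2$, $\overline\delta\in(0,2]^2$: $$V_\beta\big(\{z\in\mathbb D^3\cap\mathcal U:\ |\varphi_j(z)-\eta_j|<\delta_j,\ j=1,2\}\big)\le C\delta_1^{2+\beta}\delta_2^{2+\beta}\big(\min(\delta_1,\delta_2)\big)^{1/2}.$$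
   Context: $dA$ is the normalized area measure on $\mathbb D$; $dA_\beta(z)=(\beta+1)(1-|z|^2)^\beta dA(z)$; $dV_\beta=dA_\beta(z_1)dA_\beta(z_2)dA_\beta(z_3)$. For $\xi=(e^{i\alpha_1},e^{i\alpha_2},e^{i\alpha_3})\in\mathbb T^3$ and $\theta\in\mathbb R^3$ write $\xi e^{i\theta}=(e^{i(\alpha_k+\theta_k)})_{k=1}^3$. For $\varphi\in\mathcal O(\mathbb D^3,\mathbb D)$ with $\varphi(\xi)\in\mathbb T$, set $\psi(\theta)=\overline{\varphi(\xi)}\varphi(\xi e^{i\theta})$; $\varphi$ is truly at least two-dimensional at $\xi$ of order $2$ if, writing $\mathrm{Re}\,\psi(\theta)=1-Q(\theta)+o(|\theta|^2)$ with $Q$ a real quadratic form, the signature of $Q$ is $(2,0)$ or $(3,0)$. For $\varphi=(\varphi_1,\varphi_2)\in\mathcal O(\mathbb D^3,\mathbb D^2)$ with $\varphi(\xi)\in\mathbb T^2$, set $\psi_j(\theta)=\overline{\varphi_j(\xi)}\varphi_j(\xi e^{i\theta})$; $\varphi$ is truly three-dimensional at $\xi$ of order $2$ if the complex gradients $\nabla\varphi_1(\xi),\nabla\varphi_2(\xi)\in\mathbb C^3$ are linearly independent and, writing $\mathrm{Re}\,\psi_j(\theta)=1-Q_j(\theta)+o(|\theta|^2)$ with $Q_j$ real quadratic forms, both $Q_1$ and $Q_2$ have signature $(3,0)$. *)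

theory Defs
  imports "HOL-Analysis.Analysis" "HOL-Library.Landau_Symbols"
begin

type_synonym c3 = "complex ^ 3"

definition polydisc :: "c3 set" where
  "polydisc = {z. \<forall>k. norm (z $ k) < 1}"

definition closed_polydisc :: "c3 set" where
  "closed_polydisc = {z. \<forall>k. norm (z $ k) \<le> 1}"

definition torus3 :: "c3 set" where
  "torus3 = {z. \<forall>k. norm (z $ k) = 1}"

definition holo_on :: "c3 set \<Rightarrow> (c3 \<Rightarrow> complex) \<Rightarrow> bool" where
  "holo_on S f \<longleftrightarrow> open S \<and> (\<forall>z\<in>S. \<exists>L. (f has_derivative L) (at z) \<and>
       (\<forall>(c::complex) v. L (c *s v) = c * L v))"

fun Ck_on :: "nat \<Rightarrow> 'a::euclidean_space set \<Rightarrow> ('a \<Rightarrow> 'b::real_normed_vector) \<Rightarrow> bool" where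
  "Ck_on 0 U f \<longleftrightarrow> open U \<and> continuous_on U f"
| "Ck_on (Suc k) U f \<longleftrightarrow> open U \<and> f differentiable_on U \<and>
       (\<forall>v. Ck_on k U (\<lambda>x. frechet_derivative f (at x) v))"

definition Ck_extension :: "nat \<Rightarrow> (c3 \<Rightarrow> complex) \<Rightarrow> (c3 \<Rightarrow> complex) \<Rightarrow> bool" where
  "Ck_extension k \<phi> g \<longleftrightarrow> (\<exists>U. open U \<and> closed_polydisc \<subseteq> U \<and> Ck_on k U g) \<and>
       (\<forall>z\<in>closed_polydisc. g z = \<phi> z)"

text \<open>Complex (Wirtinger) gradient  (d g / d z_k)_k at a point.\<close>
definition cgrad :: "(c3 \<Rightarrow> complex) \<Rightarrow> c3 \<Rightarrow> c3" where
  "cgrad g p = (\<chi> k. (frechet_derivative g (at p) (axis k 1)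
                      - \<i> * frechet_derivative g (at p) (axis k \<i>)) / 2)"

definition rot :: "c3 \<Rightarrow> real ^ 3 \<Rightarrow> c3" where
  "rot \<xi> \<theta> = (\<chi> k. \<xi> $ k * exp (\<i> * of_real (\<theta> $ k)))"

definition psi :: "(c3 \<Rightarrow> complex) \<Rightarrow> c3 \<Rightarrow> real ^ 3 \<Rightarrow> complex" where
  "psi \<phi> \<xi> \<theta> = cnj (\<phi> \<xi>) * \<phi> (rot \<xi> \<theta>)"

definition quadform :: "real ^ 3 ^ 3 \<Rightarrow> real ^ 3 \<Rightarrow> real" where
  "quadform A x = x \<bullet> (A *v x)"

definition pos_index :: "real ^ 3 ^ 3 \<Rightarrow> nat" where
  "pos_index A = Max {dim V | V. subspace V \<and> (\<forall>x\<in>V. x \<noteq> 0 \<longrightarrow> quadform A x > 0)}"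

definition neg_index :: "real ^ 3 ^ 3 \<Rightarrow> nat" where
  "neg_index A = Max {dim V | V. subspace V \<and> (\<forall>x\<in>V. x \<noteq> 0 \<longrightarrow> quadform A x < 0)}"

definition signature :: "real ^ 3 ^ 3 \<Rightarrow> nat \<times> nat" where
  "signature A = (pos_index A, neg_index A)"

definition second_order_form :: "(c3 \<Rightarrow> complex) \<Rightarrow> c3 \<Rightarrow> real ^ 3 ^ 3 \<Rightarrow> bool" where
  "second_order_form \<phi> \<xi> A \<longleftrightarrow> transpose A = A \<and>
     (\<lambda>\<theta>. Re (psi \<phi> \<xi> \<theta>) - (1 - quadform A \<theta>)) \<in> o[at 0](\<lambda>\<theta>. norm \<theta> ^ 2)"

definition truly_2dim_order2 :: "(c3 \<Rightarrow> complex) \<Rightarrow> c3 \<Rightarrow> bool" where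
  "truly_2dim_order2 \<phi> \<xi> \<longleftrightarrow> (\<exists>A. second_order_form \<phi> \<xi> A \<and>
       (signature A = (2, 0) \<or> signature A = (3, 0)))"

text \<open>Truly three-dimensional of order 2 (g1, g2 are the smooth extensions used
  to compute the complex gradients at the boundary point).\<close>
definition truly_3dim_order2 ::
  "(c3 \<Rightarrow> complex) \<Rightarrow> (c3 \<Rightarrow> complex) \<Rightarrow> (c3 \<Rightarrow> complex) \<Rightarrow> (c3 \<Rightarrow> complex) \<Rightarrow> c3 \<Rightarrow> bool" where
  "truly_3dim_order2 \<phi>1 \<phi>2 g1 g2 \<xi> \<longleftrightarrow>
     (\<forall>c1 c2 :: complex. c1 *s cgrad g1 \<xi> + c2 *s cgrad g2 \<xi> = 0 \<longrightarrow> c1 = 0 \<and> c2 = 0) \<and>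
     (\<exists>A1. second_order_form \<phi>1 \<xi> A1 \<and> signature A1 = (3, 0)) \<and>
     (\<exists>A2. second_order_form \<phi>2 \<xi> A2 \<and> signature A2 = (3, 0))"

text \<open>Weight of dV_beta with respect to Lebesgue measure on C^3 = R^6
  (dA = dx dy / pi normalized area measure).\<close>
definition Vweight :: "real \<Rightarrow> c3 \<Rightarrow> real" where
  "Vweight \<beta> z = (if z \<in> polydisc then
      (\<Prod>k\<in>UNIV. (\<beta> + 1) * (1 - norm (z $ k) ^ 2) powr \<beta> / pi) else 0)"

definition Vbeta :: "real \<Rightarrow> c3 set \<Rightarrow> ennreal" where
  "Vbeta \<beta> S = (\<integral>\<^sup>+ z. ennreal (Vweight \<beta> z) * indicator S z \<partial>lborel)"

end

theory Submission
  imports Defs "HOL-Complex_Analysis.Conformal_Mappings"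
begin

text \<open>Near \<open>\<xi>\<close> write \<open>z\<^sub>k = \<xi>\<^sub>k (exp (\<i> \<theta>\<^sub>k) - t\<^sub>k)\<close>; the weighted volume is then dominated by
  \<open>\<Prod>\<^sub>k (\<beta> + 1) t\<^sub>k powr \<beta> dt d\<theta>\<close>. Put \<open>G = cnj (\<phi> \<xi>) \<phi>\<close> and \<open>F = 1 - |G|\<^sup>2 \<ge> 0\<close>. The derivative of \<open>G\<close> at \<open>\<xi>\<close> is
  given by a real vector \<open>a \<ge> 0\<close>, which is nonzero by the Schwarz-Pick lemma on the diagonal disc.
  On \<open>{|\<phi> - \<eta>| < \<delta>}\<close> one has \<open>F < 2 \<delta>\<close> and \<open>Im G\<close> lies in an interval of length \<open>2 \<delta>\<close>. Since \<open>F\<close> grows at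
  least like \<open>a\<^sub>i t\<^sub>i\<close>, the first condition forces \<open>t\<^sub>i \<le> 2 \<delta> / a\<^sub>i\<close>, which contributes
  \<open>\<delta> powr (\<beta> + 1)\<close>. For fixed \<open>t\<close>, the inequality \<open>|f'|\<^sup>2 \<le> 2 M f\<close> for nonnegative functions with \<open>f'' \<le> M\<close>
  confines the directional derivative \<open>D\<^sub>v F\<close> to an interval of length \<open>O(sqrt \<delta>)\<close>. The signature hypothesis
  yields \<open>v\<close> orthogonal to \<open>a\<close> with \<open>D\<^sub>v D\<^sub>v F > 0\<close>, so \<open>Im G\<close> and \<open>D\<^sub>v F\<close> are part of a local
  coordinate system in \<open>\<theta>\<close>, and a change of variables bounds the fibre by \<open>\<delta> sqrt \<delta>\<close>. For two functions
  one takes \<open>v\<close> orthogonal to both gradients and the coordinates \<open>Im G\<^sub>1\<close>, \<open>Im G\<^sub>2\<close>, \<open>D\<^sub>v F\<^sub>j\<close>, where \<open>j\<close> is the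
  index of the smaller \<open>\<delta>\<^sub>j\<close>.\<close>

section \<open>Calculus of C^k maps\<close>

text \<open>Uniformity as \<beta> tends to -1 shapes the bookkeeping: the normalising factor
  \<open>\<beta> + 1\<close> cancels against the integral of \<open>s powr \<beta>\<close>, so a
  variable \<open>t\<close> confined to [0, \<tau>] costs exactly
  \<open>\<tau> powr (\<beta> + 1)\<close>, and this exponent stays in (0, 1], where constants are
  bounded independently of \<beta>. Points are displaced parallel to a fixed radius because the
  imaginary part of exp(i \<theta>) - t is then sin \<theta> alone, and the Jacobian is a mere
  cosine. Nonnegativity of \<open>F\<close> is known only for small \<open>t \<ge> 0\<close>. Lines
  that rotate with \<open>t\<close> frozen stay in that region, so the inequality |f'|^2 \<le> 2 M f
  is applied along them and the whole estimate is organised by the fibres t = const. If Re G = 1 - Q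
  up to o(|\<theta>|^2) on the torus, then F = 2 Q(\<theta>) - (a . \<theta>)^2 to second order. The
  subtracted square is the reason for taking \<open>v\<close> orthogonal to \<open>a\<close>: there
  the positivity of Q passes to \<open>F\<close> undiminished.\<close>

lemma Ck_on_open: "Ck_on k U f \<Longrightarrow> open U"
  by (cases k) auto

text \<open>\<open>frechet_derivative\<close> is a choice among the derivatives at the point, so it
  suffices that both functions have the same derivatives there. It carries information from \<phi>
  to its extension inside the polydisc.\<close>

lemma frechet_derivative_cong_open:
  assumes "open U" "x \<in> U" "\<And>y. y \<in> U \<Longrightarrow> f y = g y"
  shows "frechet_derivative f (at x) = frechet_derivative g (at x)"
proof -
  have "(f has_derivative D) (at x) \<longleftrightarrow> (g has_derivative D) (at x)" for D
    using assms has_derivative_transform_within_open[of f D x UNIV U g]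
      has_derivative_transform_within_open[of g D x UNIV U f] by auto
  then show ?thesis by (simp add: frechet_derivative_def)
qed

lemma Ck_on_cong:
  assumes "\<And>x. x \<in> U \<Longrightarrow> f x = g x" "Ck_on k U f"
  shows "Ck_on k U g"
  using assms
proof (induction k arbitrary: f g)
  case 0
  then show ?case by (auto cong: continuous_on_cong)
next
  case (Suc k)
  then have U: "open U" by simp
  have "g differentiable_on U"
    using Suc.prems differentiable_on_def differentiable_transform_within[OF _ zero_less_one]
    by (metis Ck_on.simps(2))
  moreover have "Ck_on k U (\<lambda>x. frechet_derivative g (at x) v)" for v
    by (rule Suc.IH[of "\<lambda>x. frechet_derivative f (at x) v"])
      (use Suc.prems U frechet_derivative_cong_open[of U _ f g] in auto)
  ultimately show ?case using U by simp
qed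

lemma Ck_on_mono:
  assumes "Ck_on k U f" "open V" "V \<subseteq> U"
  shows "Ck_on k V f"
  using assms
  by (induction k arbitrary: f)
    (auto intro: continuous_on_subset differentiable_on_subset)

lemma Ck_on_SucD: "Ck_on (Suc k) U f \<Longrightarrow> Ck_on k U f"
proof (induction k arbitrary: f)
  case 0
  then show ?case by (simp add: differentiable_imp_continuous_on)
next
  case (Suc k)
  then show ?case by (metis Ck_on.simps(2))
qed

lemma Ck_on_has_derivative:
  assumes "Ck_on (Suc k) U f" "x \<in> U"
  shows "(f has_derivative frechet_derivative f (at x)) (at x)"
proof -
  have "f differentiable (at x within U)" "open U"
    using assms by (auto simp: differentiable_on_def)
  then have "f differentiable (at x)" using assms(2) by (metis at_within_open)
  then show ?thesis using frechet_derivative_works by blast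
qed

lemma Ck_on_directional: "Ck_on (Suc k) U f \<Longrightarrow> Ck_on k U (\<lambda>x. frechet_derivative f (at x) v)"
  by simp

text \<open>Lets the derivative be given by any explicit formula in place of the chosen
  \<open>frechet_derivative\<close>; the inductive closure proofs rest on this form.\<close>

lemma Ck_on_SucI:
  assumes "open U" "\<And>x. x \<in> U \<Longrightarrow> (f has_derivative f' x) (at x)"
    and "\<And>v. Ck_on k U (\<lambda>x. f' x v)"
  shows "Ck_on (Suc k) U f"
proof -
  have "f differentiable_on U"
    using assms(1,2) by (auto simp: differentiable_on_def differentiable_def intro: has_derivative_at_withinI)
  moreover have "Ck_on k U (\<lambda>x. frechet_derivative f (at x) v)" for v
    by (rule Ck_on_cong[OF _ assms(3)[of v]]) (metis assms(2) frechet_derivative_at)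
  ultimately show ?thesis using assms(1) by simp
qed

lemma Ck_on_const: "open U \<Longrightarrow> Ck_on k U (\<lambda>_. c)"
proof (induction k arbitrary: c)
  case (Suc k)
  show ?case
    by (rule Ck_on_SucI[of _ _ "\<lambda>_ _. 0"]) (use Suc in auto)
qed simp

lemma Ck_on_bounded_linear:
  assumes "bounded_linear h" "open U"
  shows "Ck_on k U h"
proof (cases k)
  case 0
  then show ?thesis using assms by (simp add: linear_continuous_on)
next
  case (Suc j)
  show ?thesis unfolding Suc
    by (rule Ck_on_SucI[of _ _ "\<lambda>_. h"])
      (use assms in \<open>auto intro: Ck_on_const bounded_linear_imp_has_derivative\<close>)
qed

lemma Ck_on_linear_compose:
  assumes "bounded_linear h" "Ck_on k U f"
  shows "Ck_on k U (\<lambda>x. h (f x))"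
  using assms
proof (induction k arbitrary: f)
  case 0
  then show ?case by (auto intro: bounded_linear.continuous_on)
next
  case (Suc k)
  show ?case
    by (rule Ck_on_SucI[of _ _ "\<lambda>x v. h (frechet_derivative f (at x) v)"])
      (use Suc in \<open>auto intro!: bounded_linear.has_derivative[OF Suc.prems(1)]
        Ck_on_has_derivative[OF Suc.prems(2)] simp del: Ck_on.simps intro: Ck_on_directional Ck_on_open\<close>)
qed

lemma Ck_on_add:
  assumes "Ck_on k U f" "Ck_on k U g"
  shows "Ck_on k U (\<lambda>x. f x + g x)"
  using assms
proof (induction k arbitrary: f g)
  case 0
  then show ?case by (auto intro: continuous_intros)
next
  case (Suc k)
  show ?case
    by (rule Ck_on_SucI[of _ _ "\<lambda>x v. frechet_derivative f (at x) v + frechet_derivative g (at x) v"])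
      (use Suc in \<open>auto intro!: has_derivative_add Ck_on_has_derivative[OF Suc.prems(1)]
        Ck_on_has_derivative[OF Suc.prems(2)] simp del: Ck_on.simps intro: Ck_on_directional Ck_on_open\<close>)
qed

lemma Ck_on_sum:
  assumes "open U" "\<And>i. i \<in> I \<Longrightarrow> Ck_on k U (f i)"
  shows "Ck_on k U (\<lambda>x. \<Sum>i\<in>I. f i x)"
  using assms(2)
proof (induction I rule: infinite_finite_induct)
  case (insert i I)
  then show ?case by (auto intro!: Ck_on_add)
qed (auto simp: Ck_on_const assms)

text \<open>The product rule expresses the derivative through the same bilinear map applied to
  functions that are one order less smooth, so induction on \<open>k\<close> closes. Scalar
  multiplication and inner products are both instances.\<close>

lemma Ck_on_bilinear:
  assumes "bounded_bilinear h" "Ck_on k U f" "Ck_on k U g"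
  shows "Ck_on k U (\<lambda>x. h (f x) (g x))"
  using assms(2,3)
proof (induction k arbitrary: f g)
  case 0
  then show ?case using bounded_bilinear.continuous_on[OF assms(1)] by auto
next
  case (Suc k)
  show ?case
  proof (rule Ck_on_SucI[of _ _ "\<lambda>x v. h (f x) (frechet_derivative g (at x) v) + h (frechet_derivative f (at x) v) (g x)"])
    show "open U" using Suc.prems by simp
    show "((\<lambda>x. h (f x) (g x)) has_derivative
           (\<lambda>v. h (f x) (frechet_derivative g (at x) v) + h (frechet_derivative f (at x) v) (g x))) (at x)"
      if "x \<in> U" for x
      using bounded_bilinear.FDERIV[OF assms(1) Ck_on_has_derivative[OF Suc.prems(1) that]
          Ck_on_has_derivative[OF Suc.prems(2) that]] .
    show "Ck_on k U (\<lambda>x. h (f x) (frechet_derivative g (at x) v) + h (frechet_derivative f (at x) v) (g x))" for v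
      by (intro Ck_on_add Suc.IH) (use Suc.prems Ck_on_SucD Ck_on_directional in blast)+
  qed
qed

text \<open>\<open>Ck_on\<close> speaks of derivatives in fixed directions, whereas the chain rule
  applies the derivative of \<open>f\<close> to the moving vector DT(x) v. Expanding that vector in
  the basis of the intermediate space leaves products of scalar coefficients with fixed directional
  derivatives composed with \<open>T\<close>, to which the induction hypothesis applies.\<close>

lemma Ck_on_compose:
  fixes T :: "'a::euclidean_space \<Rightarrow> 'b::euclidean_space"
  assumes "Ck_on k V f" "Ck_on k U T" "T ` U \<subseteq> V"
  shows "Ck_on k U (\<lambda>x. f (T x))"
  using assms(1,2)
proof (induction k arbitrary: f)
  case 0
  then show ?case using assms(3) by (auto intro: continuous_on_compose2)
next
  case (Suc k)
  let ?D = "\<lambda>x v. \<Sum>b\<in>Basis. (frechet_derivative T (at x) v \<bullet> b) *\<^sub>R frechet_derivative f (at (T x)) b"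
  show ?case
  proof (rule Ck_on_SucI[of _ _ ?D])
    show "open U" using Suc.prems by simp
    fix x assume x: "x \<in> U"
    then have f: "(f has_derivative frechet_derivative f (at (T x))) (at (T x))"
      using Ck_on_has_derivative[OF Suc.prems(1)] assms(3) by blast
    have *: "frechet_derivative f (at (T x)) w = (\<Sum>b\<in>Basis. (w \<bullet> b) *\<^sub>R frechet_derivative f (at (T x)) b)" for w
      using linear_sum[OF has_derivative_linear[OF f], of "\<lambda>b. (w \<bullet> b) *\<^sub>R b" Basis]
      by (simp add: euclidean_representation linear_scale[OF has_derivative_linear[OF f]])
    have "((\<lambda>x. f (T x)) has_derivative
         (\<lambda>v. frechet_derivative f (at (T x)) (frechet_derivative T (at x) v))) (at x)"
      using has_derivative_compose[OF Ck_on_has_derivative[OF Suc.prems(2) x] f] .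
    then show "((\<lambda>x. f (T x)) has_derivative ?D x) (at x)" by (rule has_derivative_eq_rhs) (rule ext, rule *)
  next
    fix v
    show "Ck_on k U (\<lambda>x. ?D x v)"
    proof (intro Ck_on_sum Ck_on_bilinear[OF bounded_bilinear_scaleR])
      show "open U" using Suc.prems by simp
      fix b :: 'b assume "b \<in> Basis"
      show "Ck_on k U (\<lambda>x. frechet_derivative T (at x) v \<bullet> b)"
        by (rule Ck_on_linear_compose[OF bounded_linear_inner_left]) (use Suc.prems in simp)
      show "Ck_on k U (\<lambda>x. frechet_derivative f (at (T x)) b)"
        by (rule Suc.IH[OF Ck_on_directional[OF Suc.prems(1)] Ck_on_SucD[OF Suc.prems(2)]])
    qed
  qed
qed

lemma Ck_on_exp_ii: "Ck_on k UNIV (\<lambda>x::real. c * exp (\<i> * of_real x))"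
proof (induction k arbitrary: c)
  case 0
  then show ?case by (auto intro!: continuous_intros)
next
  case (Suc k)
  show ?case
  proof (rule Ck_on_SucI)
    have 1: "((\<lambda>x::real. \<i> * of_real x) has_derivative (\<lambda>v. \<i> * complex_of_real v)) (at x)" for x
      by (intro bounded_linear_imp_has_derivative bounded_linear_mult_right
        bounded_linear_compose[OF bounded_linear_mult_right] bounded_linear_of_real)
    show "((\<lambda>x::real. c * exp (\<i> * of_real x)) has_derivative
       (\<lambda>v. (of_real v * c * \<i>) * exp (\<i> * of_real x))) (at x)" for x
      by (rule has_derivative_eq_rhs[OF has_derivative_mult_right[OF has_derivative_compose[OF 1 DERIV_exp[unfolded has_field_derivative_def]]]])
        (simp add: fun_eq_iff algebra_simps)
  qed (use Suc in \<open>simp_all del: Ck_on.simps\<close>)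
qed

text \<open>Coordinates near a torus point: \<open>t\<close> moves each component inwards, parallel to the radius
  through \<open>\<xi>\<close>, and \<open>\<theta>\<close> rotates.\<close>
definition tcoord :: "c3 \<Rightarrow> (real^3) \<times> (real^3) \<Rightarrow> c3" where
  "tcoord \<xi> p = (\<chi> k. \<xi> $ k * (exp (\<i> * of_real (snd p $ k)) - of_real (fst p $ k)))"

lemma Ck_on_tcoord: "Ck_on k UNIV (tcoord \<xi>)"
proof -
  let ?h = "\<lambda>k c. axis k (\<xi> $ k * c) :: c3"
  have lin: "bounded_linear (?h k)" for k
    by (rule linear_conv_bounded_linear[THEN iffD1])
      (auto intro!: linearI simp: vec_eq_iff axis_def algebra_simps)
  have e: "Ck_on k UNIV (\<lambda>p::(real^3) \<times> (real^3). 1 * exp (\<i> * of_real (snd p $ j)))" for j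
    by (rule Ck_on_compose[OF Ck_on_exp_ii])
      (intro Ck_on_bounded_linear bounded_linear_compose[OF bounded_linear_vec_nth]
        bounded_linear_snd open_UNIV subset_UNIV)+
  have f: "Ck_on k UNIV (\<lambda>p::(real^3) \<times> (real^3). - complex_of_real (fst p $ j))" for j
    by (intro Ck_on_bounded_linear bounded_linear_minus bounded_linear_compose[OF bounded_linear_of_real]
       bounded_linear_compose[OF bounded_linear_vec_nth] bounded_linear_fst open_UNIV)
  have "Ck_on k UNIV (\<lambda>p::(real^3) \<times> (real^3).
      \<Sum>j\<in>UNIV. ?h j (1 * exp (\<i> * of_real (snd p $ j)) + - of_real (fst p $ j)))"
    by (intro Ck_on_sum Ck_on_linear_compose[OF lin] Ck_on_add e f open_UNIV)
  moreover have "(\<Sum>j\<in>UNIV. ?h j (1 * exp (\<i> * of_real (snd p $ j)) + - of_real (fst p $ j))) = tcoord \<xi> p" for p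
    by (simp add: tcoord_def vec_eq_iff axis_def sum.delta' if_distrib cong: if_cong)
  ultimately show ?thesis by simp
qed

lemma has_derivative_vec_lambda:
  fixes f :: "'n::finite \<Rightarrow> 'a::real_normed_vector \<Rightarrow> 'b::euclidean_space"
  assumes "\<And>k. (f k has_derivative f' k) F"
  shows "((\<lambda>x. \<chi> k. f k x) has_derivative (\<lambda>h. \<chi> k. f' k h)) F"
proof -
  have lin: "bounded_linear (axis k :: 'b \<Rightarrow> 'b^'n)" for k
    by (rule linear_conv_bounded_linear[THEN iffD1])
      (auto intro!: linearI simp: vec_eq_iff axis_def)
  have eq: "(\<chi> k. g k) = (\<Sum>k\<in>UNIV. axis k (g k))" for g :: "'n \<Rightarrow> 'b"
    by (simp add: vec_eq_iff axis_def sum.delta' cong: if_cong)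
  show ?thesis
    unfolding eq by (intro has_derivative_sum bounded_linear.has_derivative[OF lin] assms)
qed

lemma tcoord_has_derivative:
  "(tcoord \<xi> has_derivative (\<lambda>q. \<chi> k. \<xi> $ k * (\<i> * of_real (snd q $ k) * exp (\<i> * of_real (snd p $ k))
     - of_real (fst q $ k)))) (at p)"
  unfolding tcoord_def
proof (rule has_derivative_vec_lambda)
  fix k
  have 1: "((\<lambda>q::(real^3)\<times>(real^3). \<i> * of_real (snd q $ k)) has_derivative (\<lambda>q. \<i> * of_real (snd q $ k))) (at p)"
    by (intro bounded_linear_imp_has_derivative bounded_linear_compose[OF bounded_linear_mult_right]
       bounded_linear_compose[OF bounded_linear_of_real]
       bounded_linear_compose[OF bounded_linear_vec_nth] bounded_linear_snd)
  have 2: "((\<lambda>q::(real^3)\<times>(real^3). complex_of_real (fst q $ k)) has_derivative (\<lambda>q. of_real (fst q $ k))) (at p)"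
    by (intro bounded_linear_imp_has_derivative
       bounded_linear_compose[OF bounded_linear_of_real]
       bounded_linear_compose[OF bounded_linear_vec_nth] bounded_linear_fst)
  show "((\<lambda>q. \<xi> $ k * (exp (\<i> * of_real (snd q $ k)) - of_real (fst q $ k))) has_derivative
     (\<lambda>q. \<xi> $ k * (\<i> * of_real (snd q $ k) * exp (\<i> * of_real (snd p $ k)) - of_real (fst q $ k)))) (at p)"
    by (rule has_derivative_eq_rhs[OF has_derivative_mult_right[OF has_derivative_diff[OF
          has_derivative_compose[OF 1 DERIV_exp[unfolded has_field_derivative_def]] 2]]])
      (simp add: fun_eq_iff algebra_simps)
qed

section \<open>Iterated Lebesgue integrals\<close>

text \<open>A linear map that carries one standard basis onto the other only relabels coordinates,
  so preimages of boxes are boxes with the same side lengths, and boxes determine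
  \<open>lborel\<close>. All regroupings of real and complex coordinates below are
  instances.\<close>

lemma lborel_distr_basis:
  fixes h :: "'a::euclidean_space \<Rightarrow> 'b::euclidean_space"
  assumes lin: "linear h" and Bas: "h ` Basis = Basis" and dim: "DIM('a) = DIM('b)"
  shows "distr lborel borel h = (lborel :: 'b measure)"
proof -
  have inj: "inj_on h Basis"
    by (rule eq_card_imp_inj_on) (auto simp: Bas dim)
  have inner: "h x \<bullet> h b = x \<bullet> b" if "b \<in> Basis" for x b
  proof -
    have hx: "h x = (\<Sum>c\<in>Basis. (x \<bullet> c) *\<^sub>R h c)"
      using linear_sum[OF lin, of "\<lambda>c. (x \<bullet> c) *\<^sub>R c" Basis]
      by (simp add: euclidean_representation linear_scale[OF lin])
    have hc: "h c \<bullet> h b = (if c = b then 1 else 0)" if "c \<in> Basis" for c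
    proof -
      have "h c \<in> Basis" "h b \<in> Basis" using that \<open>b \<in> Basis\<close> Bas by blast+
      then show ?thesis using that \<open>b \<in> Basis\<close> inj by (simp add: inner_Basis inj_on_eq_iff)
    qed
    have "h x \<bullet> h b = (\<Sum>c\<in>Basis. if c = b then x \<bullet> c else 0)"
      unfolding hx inner_sum_left by (intro sum.cong) (auto simp: hc)
    then show ?thesis using that by simp
  qed
  have meas: "h \<in> borel_measurable borel"
    using lin linear_continuous_on linear_conv_bounded_linear borel_measurable_continuous_onI by blast
  show ?thesis
  proof (rule lborel_eqI[symmetric])
    fix l u :: 'b
    assume lu: "\<And>b. b \<in> Basis \<Longrightarrow> l \<bullet> b \<le> u \<bullet> b"
    define l' u' where "l' = (\<Sum>b\<in>Basis. (l \<bullet> h b) *\<^sub>R b)" and "u' = (\<Sum>b\<in>Basis. (u \<bullet> h b) *\<^sub>R b)"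
    have l'u': "l' \<bullet> b = l \<bullet> h b" "u' \<bullet> b = u \<bullet> h b" if "b \<in> Basis" for b
      using that by (auto simp: l'_def u'_def inner_sum_left inner_Basis if_distrib cong: if_cong)
    have hB: "h b \<in> Basis" if "b \<in> Basis" for b using Bas that by blast
    have "h -` box l u = box l' u'"
      unfolding box_def Bas[symmetric] by (auto simp: inner l'u')
    then have "emeasure (distr lborel borel h) (box l u) = emeasure lborel (box l' u')"
      using meas by (subst emeasure_distr) auto
    also have "\<dots> = (\<Prod>b\<in>Basis. (u' - l') \<bullet> b)"
      by (rule emeasure_lborel_box) (auto simp: l'u' lu hB)
    also have "(\<Prod>b\<in>Basis. (u' - l') \<bullet> b) = (\<Prod>b\<in>Basis. (u - l) \<bullet> h b)"
      by (intro prod.cong) (auto simp: inner_diff_left l'u')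
    also have "\<dots> = (\<Prod>b\<in>Basis. (u - l) \<bullet> b)"
      using prod.reindex[OF inj, of "\<lambda>b. (u - l) \<bullet> b"] by (simp add: Bas)
    finally show "emeasure (distr lborel borel h) (box l u) = ennreal (\<Prod>b\<in>Basis. (u - l) \<bullet> b)" .
  qed simp
qed

lemma nn_integral_lborel_basis:
  fixes h :: "'a::euclidean_space \<Rightarrow> 'b::euclidean_space"
  assumes "linear h" "h ` Basis = Basis" "DIM('a) = DIM('b)" "f \<in> borel_measurable borel"
  shows "(\<integral>\<^sup>+x. f x \<partial>lborel) = (\<integral>\<^sup>+x. f (h x) \<partial>lborel)"
proof -
  have "h \<in> borel_measurable borel"
    using assms(1) linear_continuous_on linear_conv_bounded_linear borel_measurable_continuous_onI by blast
  then show ?thesis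
    using assms(4) by (subst lborel_distr_basis[OF assms(1-3), symmetric]) (subst nn_integral_distr; simp)
qed

section \<open>Fubini for pairs, triples and the complex plane\<close>

lemma nn_integral_lborel_Pair:
  fixes f :: "'a::euclidean_space \<times> 'b::euclidean_space \<Rightarrow> ennreal"
  assumes "f \<in> borel_measurable borel"
  shows "(\<integral>\<^sup>+p. f p \<partial>lborel) = (\<integral>\<^sup>+x. \<integral>\<^sup>+y. f (x, y) \<partial>lborel \<partial>lborel)"
    and "(\<integral>\<^sup>+p. f p \<partial>lborel) = (\<integral>\<^sup>+y. \<integral>\<^sup>+x. f (x, y) \<partial>lborel \<partial>lborel)"
proof -
  have *: "f \<in> borel_measurable (lborel \<Otimes>\<^sub>M lborel)"
    using assms by (simp add: lborel_prod)
  show "(\<integral>\<^sup>+p. f p \<partial>lborel) = (\<integral>\<^sup>+x. \<integral>\<^sup>+y. f (x, y) \<partial>lborel \<partial>lborel)"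
    using lborel.nn_integral_fst[OF *] by (simp add: lborel_prod)
  then show "(\<integral>\<^sup>+p. f p \<partial>lborel) = (\<integral>\<^sup>+y. \<integral>\<^sup>+x. f (x, y) \<partial>lborel \<partial>lborel)"
    using lborel_pair.Fubini'[of "\<lambda>x y. f (x,y)"] * by simp
qed

lemma Basis_vec3: "(Basis :: ('a::euclidean_space^3) set) = axis 1 ` Basis \<union> axis 2 ` Basis \<union> axis 3 ` Basis"
  unfolding Basis_vec_def UNIV_3 by auto

lemma axis_0: "axis k 0 = 0"
  by (simp add: vec_eq_iff axis_def)

lemma vector3_eq_sum: "(vector [x, y, z] :: 'a::real_vector^3) = axis 1 x + axis 2 y + axis 3 z"
  by (simp add: vec_eq_iff forall_3 axis_def)

lemma nn_integral_lborel_vec3: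
  fixes f :: "'a::euclidean_space^3 \<Rightarrow> ennreal"
  assumes f: "f \<in> borel_measurable borel"
  shows "(\<integral>\<^sup>+v. f v \<partial>lborel) = (\<integral>\<^sup>+x. \<integral>\<^sup>+y. \<integral>\<^sup>+z. f (vector [x, y, z]) \<partial>lborel \<partial>lborel \<partial>lborel)"
proof -
  let ?h = "\<lambda>p. vector [fst p, fst (snd p), snd (snd p)] :: 'a^3"
  have lin: "linear ?h"
    by (auto intro!: linearI simp: vec_eq_iff forall_3)
  then have meas: "?h \<in> borel_measurable borel"
    using linear_continuous_on linear_conv_bounded_linear borel_measurable_continuous_onI by blast
  have "?h ` Basis = Basis"
    unfolding Basis_prod_def Basis_vec3
    by (simp add: vector3_eq_sum image_Un image_image axis_0 Un_assoc)
  then have "(\<integral>\<^sup>+v. f v \<partial>lborel) = (\<integral>\<^sup>+p. f (?h p) \<partial>lborel)"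
    by (intro nn_integral_lborel_basis lin f) auto
  also have "\<dots> = (\<integral>\<^sup>+x. \<integral>\<^sup>+p. f (?h (x, p)) \<partial>lborel \<partial>lborel)"
    by (rule nn_integral_lborel_Pair(1)) (rule measurable_compose[OF meas f])
  also have "\<dots> = (\<integral>\<^sup>+x. \<integral>\<^sup>+y. \<integral>\<^sup>+z. f (?h (x, y, z)) \<partial>lborel \<partial>lborel \<partial>lborel)"
  proof (intro nn_integral_cong nn_integral_lborel_Pair(1))
    fix x :: 'a
    have "Pair x \<in> borel \<rightarrow>\<^sub>M (borel :: ('a \<times> 'a \<times> 'a) measure)"
      by (intro borel_measurable_continuous_onI continuous_intros)
    then show "(\<lambda>p. f (?h (x, p))) \<in> borel_measurable borel"
      using measurable_compose[OF _ measurable_compose[OF meas f]] by blast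
  qed
  finally show ?thesis by simp
qed

lemma nn_integral_lborel_complex:
  fixes f :: "complex \<Rightarrow> ennreal"
  assumes f: "f \<in> borel_measurable borel"
  shows "(\<integral>\<^sup>+z. f z \<partial>lborel) = (\<integral>\<^sup>+y. \<integral>\<^sup>+x. f (Complex x y) \<partial>lborel \<partial>lborel)"
proof -
  let ?h = "\<lambda>p. Complex (fst p) (snd p)"
  have lin: "linear ?h"
    by (auto intro!: linearI simp: complex_eq_iff)
  then have meas: "?h \<in> borel_measurable borel"
    using linear_continuous_on linear_conv_bounded_linear borel_measurable_continuous_onI by blast
  have "?h ` Basis = Basis"
    unfolding Basis_prod_def Basis_complex_def
    by (auto simp: complex_eq_iff image_Un)
  then have "(\<integral>\<^sup>+z. f z \<partial>lborel) = (\<integral>\<^sup>+p. f (?h p) \<partial>lborel)"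
    by (intro nn_integral_lborel_basis lin f) auto
  also have "\<dots> = (\<integral>\<^sup>+y. \<integral>\<^sup>+x. f (?h (x, y)) \<partial>lborel \<partial>lborel)"
    by (rule nn_integral_lborel_Pair(2)) (rule measurable_compose[OF meas f])
  finally show ?thesis by simp
qed

text \<open>Passes between a pair of vectors (t, \<theta>) and a vector of pairs: the chart is built
  factor by factor in the second form, while the fibre estimates need the first.\<close>

lemma nn_integral_lborel_swap3:
  fixes f :: "(real^3) \<times> (real^3) \<Rightarrow> ennreal"
  assumes f: "f \<in> borel_measurable borel"
  shows "(\<integral>\<^sup>+q. f q \<partial>lborel) = (\<integral>\<^sup>+P. f (\<chi> k. fst (P $ k), \<chi> k. snd (P $ k)) \<partial>(lborel :: ((real \<times> real)^3) measure))"
proof (rule nn_integral_lborel_basis[OF _ _ _ f])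
  let ?h = "\<lambda>P :: (real \<times> real)^3. (\<chi> k. fst (P $ k), \<chi> k. snd (P $ k))"
  show lin: "linear ?h"
    by (auto intro!: linearI simp: vec_eq_iff)
  have 1: "?h (axis k (1, 0)) = (axis k 1, 0)" "?h (axis k (0, 1)) = (0, axis k 1)" for k
    by (auto simp: vec_eq_iff axis_def)
  show "?h ` Basis = Basis"
    unfolding Basis_prod_def Basis_vec3 image_Un image_image
    using 1 by auto
qed auto

text \<open>Multiplication by a unimodular number is an orthogonal map; it is transported to
  \<open>real^2\<close>, where orthogonal images preserve measure. The preimage of a box is treated
  as the image under the inverse rotation \<open>R (cnj \<xi>)\<close>.\<close>

lemma nn_integral_lborel_rotate:
  fixes f :: "complex \<Rightarrow> ennreal"
  assumes f: "f \<in> borel_measurable borel" and \<xi>: "norm \<xi> = 1"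
  shows "(\<integral>\<^sup>+z. f z \<partial>lborel) = (\<integral>\<^sup>+z. f (\<xi> * z) \<partial>lborel)"
proof -
  let ?h = "\<lambda>v :: real^2. Complex (v $ 1) (v $ 2)"
  define R where "R = (\<lambda>c (v :: real^2). (\<chi> i. if i = 1 then Re (c * ?h v) else Im (c * ?h v)) :: real^2)"
  have hR: "?h (R c v) = c * ?h v" for c v
    by (simp add: R_def complex_eq_iff)
  have hinj: "v = w" if "?h v = ?h w" for v w
    using that by (simp add: vec_eq_iff forall_2)
  have RR: "R c (R d v) = R (c * d) v" for c d v
    by (rule hinj) (simp only: hR mult.assoc)
  have R1: "R 1 v = v" for v
    by (rule hinj) (simp only: hR mult_1)
  have linR: "linear (R c)" for c
    by (auto intro!: linearI simp: R_def vec_eq_iff algebra_simps)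
  have normh: "norm (?h v) = norm v" for v
    by (simp add: norm_vec_def L2_set_def UNIV_2 cmod_def)
  have ort: "orthogonal_transformation (R c)" if "norm c = 1" for c
    using that linR hR normh by (metis orthogonal_transformation norm_mult mult_1)
  have c: "norm (cnj \<xi>) = 1" "\<xi> * cnj \<xi> = 1" "cnj \<xi> * \<xi> = 1"
    using \<xi> complex_norm_square[of \<xi>] by (auto simp: mult.commute)
  have measR: "R \<xi> \<in> borel_measurable borel"
    using linR linear_continuous_on linear_conv_bounded_linear borel_measurable_continuous_onI by blast
  have R: "distr lborel borel (R \<xi>) = lborel"
  proof (rule lborel_eqI[symmetric])
    fix l u :: "real^2" assume lu: "\<And>b. b \<in> Basis \<Longrightarrow> l \<bullet> b \<le> u \<bullet> b"
    have vim: "R \<xi> -` box l u = R (cnj \<xi>) ` box l u"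
    proof -
      have "v \<in> R (cnj \<xi>) ` box l u" if "R \<xi> v \<in> box l u" for v
        using that RR[of "cnj \<xi>" \<xi> v] R1 c by (metis image_eqI)
      then show ?thesis using RR R1 c by auto
    qed
    have B: "box l u \<in> lmeasurable" by simp
    have "emeasure (distr lborel borel (R \<xi>)) (box l u) = emeasure lborel (R \<xi> -` box l u)"
      using measR by (subst emeasure_distr) auto
    also have "\<dots> = emeasure lebesgue (R \<xi> -` box l u)"
      using measurable_sets[OF measR, of "box l u"] by simp
    also have "\<dots> = ennreal (measure lebesgue (R (cnj \<xi>) ` box l u))"
      unfolding vim by (rule emeasure_eq_measure2) (rule measurable_orthogonal_image[OF ort[OF c(1)] B])
    also have "\<dots> = ennreal (measure lebesgue (box l u))"
      by (simp add: measure_orthogonal_image[OF ort[OF c(1)] B])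
    also have "\<dots> = emeasure lborel (box l u)"
      using emeasure_eq_measure2[OF B] by simp
    finally show "emeasure (distr lborel borel (R \<xi>)) (box l u) = ennreal (\<Prod>b\<in>Basis. (u - l) \<bullet> b)"
      using lu by simp
  qed simp
  have linh: "linear ?h"
    by (auto intro!: linearI simp: complex_eq_iff)
  have Bh: "?h ` Basis = Basis"
    by (auto simp: Basis_vec_def UNIV_2 Basis_complex_def axis_def complex_eq_iff)
  have meash: "?h \<in> borel_measurable borel"
    using linh linear_continuous_on linear_conv_bounded_linear borel_measurable_continuous_onI by blast
  have fh: "(\<lambda>v. f (?h v)) \<in> borel_measurable borel" and f\<xi>: "(\<lambda>z. f (\<xi> * z)) \<in> borel_measurable borel"
    using measurable_compose[OF meash f] measurable_compose[OF _ f, of "\<lambda>z. \<xi> * z" borel] by auto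
  have "(\<integral>\<^sup>+z. f z \<partial>lborel) = (\<integral>\<^sup>+v. f (?h v) \<partial>lborel)"
    by (rule nn_integral_lborel_basis[OF linh Bh _ f]) simp
  also have "\<dots> = (\<integral>\<^sup>+v. f (?h (R \<xi> v)) \<partial>lborel)"
    using fh measR by (subst R[symmetric]) (subst nn_integral_distr; simp)
  also have "\<dots> = (\<integral>\<^sup>+v. f (\<xi> * ?h v) \<partial>lborel)"
    by (simp only: hR)
  also have "\<dots> = (\<integral>\<^sup>+z. f (\<xi> * z) \<partial>lborel)"
    by (rule nn_integral_lborel_basis[OF linh Bh _ f\<xi>, symmetric]) simp
  finally show ?thesis .
qed

text \<open>After rotating \<xi> to 1 the chart reads x = cos \<theta> - t, y = sin \<theta>. For
  fixed \<theta> it is a reflected translation in \<open>t\<close>, and the only genuine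
  substitution is y = sin \<theta>. Its Jacobian cos \<theta> \<le> 1 is discarded, hence an
  inequality. The bound \<rho> \<le> 1 < pi/2 keeps sin injective and cos nonnegative.\<close>

lemma nn_integral_circle_chart:
  fixes f :: "complex \<Rightarrow> ennreal"
  assumes f: "f \<in> borel_measurable borel" and \<xi>: "norm \<xi> = 1" and \<rho>: "0 < \<rho>" "\<rho> \<le> 1"
    and supp: "\<And>z. f z \<noteq> 0 \<Longrightarrow> \<exists>t \<theta>. 0 < t \<and> t < \<rho> \<and> \<bar>\<theta>\<bar> < \<rho> \<and> z = \<xi> * (exp (\<i> * of_real \<theta>) - of_real t)"
  shows "(\<integral>\<^sup>+z. f z \<partial>lborel) \<le> (\<integral>\<^sup>+p. f (\<xi> * (exp (\<i> * of_real (snd p)) - of_real (fst p)))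
            * indicator {p. 0 < fst p \<and> fst p < \<rho> \<and> \<bar>snd p\<bar> < \<rho>} p \<partial>(lborel :: (real \<times> real) measure))"
proof -
  have pi: "\<rho> < pi / 2" using \<rho>(2) pi_gt3 by linarith
  have e: "exp (\<i> * of_real \<theta>) - of_real t = Complex (cos \<theta> - t) (sin \<theta>)" for \<theta> t
    by (simp add: complex_eq_iff cis_conv_exp[symmetric])
  let ?g = "\<lambda>x y. f (\<xi> * Complex x y)"
  have measg: "(\<lambda>p. ?g (fst p) (snd p)) \<in> borel_measurable borel"
    by (rule measurable_compose[OF _ f], rule borel_measurable_continuous_onI)
      (auto intro!: continuous_intros simp: Complex_eq)
  have measg': "(\<lambda>(x, y). ?g x y) \<in> borel_measurable (borel \<Otimes>\<^sub>M borel)"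
    using measg by (simp add: borel_prod case_prod_beta)
  have sinj: "\<theta> = \<theta>'" if "sin \<theta> = sin \<theta>'" "\<bar>\<theta>\<bar> \<le> \<rho>" "\<bar>\<theta>'\<bar> \<le> \<rho>" for \<theta> \<theta>'
  proof -
    have "arcsin (sin \<theta>) = \<theta>" "arcsin (sin \<theta>') = \<theta>'"
      using that(2,3) pi by (intro arcsin_sin; linarith)+
    then show ?thesis using that(1) by metis
  qed
  have chart: "\<exists>\<theta>. 0 < cos \<theta> - x \<and> cos \<theta> - x < \<rho> \<and> \<bar>\<theta>\<bar> < \<rho> \<and> y = sin \<theta>" if "?g x y \<noteq> 0" for x y
  proof -
    obtain t \<theta> where t: "0 < t" "t < \<rho>" "\<bar>\<theta>\<bar> < \<rho>" "\<xi> * Complex x y = \<xi> * Complex (cos \<theta> - t) (sin \<theta>)"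
      using supp[OF \<open>?g x y \<noteq> 0\<close>] unfolding e by blast
    moreover have "\<xi> \<noteq> 0" using \<xi> by auto
    ultimately have "x = cos \<theta> - t" "y = sin \<theta>" by (auto dest: mult_left_cancel[THEN iffD1, rotated])
    then show ?thesis using t(1-3) by (intro exI[of _ \<theta>]) simp
  qed
  define H where "H y = (\<integral>\<^sup>+x. ?g x y \<partial>lborel)" for y
  have measH: "H \<in> borel_measurable borel"
    unfolding H_def using measg' by measurable
  have H0: "H y = 0" if "y \<notin> {sin (-\<rho>)..sin \<rho>}" for y
  proof -
    have "?g x y = 0" for x
    proof (rule ccontr)
      assume "?g x y \<noteq> 0"
      then obtain \<theta> where "\<bar>\<theta>\<bar> < \<rho>" "y = sin \<theta>" using chart by blast
      then have "y \<in> {sin (-\<rho>)..sin \<rho>}"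
        using pi sin_monotone_2pi_le[of "-\<rho>" \<theta>] sin_monotone_2pi_le[of \<theta> \<rho>] by simp
      then show False using that by simp
    qed
    then show ?thesis by (simp add: H_def)
  qed
  have meas_sc: "(\<lambda>p. Complex (cos (snd p) - fst p) (sin (snd p))) \<in> borel_measurable borel"
    by (rule borel_measurable_continuous_onI) (auto intro!: continuous_intros simp: Complex_eq)
  \<comment> \<open>The indicator on the right costs nothing: a nonzero value forces the point to
    come from the chart with some angle \<theta>', and injectivity of sin gives \<theta>' =
    \<theta>.\<close>
  have le: "H (sin \<theta>) * ennreal (cos \<theta>) * indicator {-\<rho>..\<rho>} \<theta>
     \<le> (\<integral>\<^sup>+t. ?g (cos \<theta> - t) (sin \<theta>) * indicator {p. 0 < fst p \<and> fst p < \<rho> \<and> \<bar>snd p\<bar> < \<rho>} (t, \<theta>) \<partial>lborel)" for \<theta>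
  proof (cases "\<theta> \<in> {-\<rho>..\<rho>}")
    case True
    have "H (sin \<theta>) = (\<integral>\<^sup>+t. ?g (cos \<theta> + (-1) * t) (sin \<theta>) \<partial>lborel)"
      unfolding H_def using nn_integral_real_affine[of "\<lambda>x. ?g x (sin \<theta>)" "-1" "cos \<theta>"] measg' by simp
    also have "\<dots> = (\<integral>\<^sup>+t. ?g (cos \<theta> - t) (sin \<theta>) * indicator {p. 0 < fst p \<and> fst p < \<rho> \<and> \<bar>snd p\<bar> < \<rho>} (t, \<theta>) \<partial>lborel)"
    proof (intro nn_integral_cong)
      fix t
      show "?g (cos \<theta> + - 1 * t) (sin \<theta>) = ?g (cos \<theta> - t) (sin \<theta>) *
         indicator {p. 0 < fst p \<and> fst p < \<rho> \<and> \<bar>snd p\<bar> < \<rho>} (t, \<theta>)"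
      proof (cases "?g (cos \<theta> - t) (sin \<theta>) = 0")
        case False
        then obtain \<theta>' where 1: "0 < cos \<theta>' - (cos \<theta> - t)" "cos \<theta>' - (cos \<theta> - t) < \<rho>" "\<bar>\<theta>'\<bar> < \<rho>" "sin \<theta> = sin \<theta>'"
          using chart by blast
        then have "\<theta>' = \<theta>" using sinj True by auto
        then show ?thesis using 1 by auto
      qed simp
    qed
    finally show ?thesis
      using True mult_left_mono[of "ennreal (cos \<theta>)" 1 "H (sin \<theta>)"] by (simp add: ennreal_le_1)
  qed simp
  have "(\<integral>\<^sup>+z. f z \<partial>lborel) = (\<integral>\<^sup>+z. f (\<xi> * z) \<partial>lborel)"
    by (rule nn_integral_lborel_rotate[OF f \<xi>])
  also have "\<dots> = (\<integral>\<^sup>+y. H y \<partial>lborel)"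
    unfolding H_def by (rule nn_integral_lborel_complex) (rule measurable_compose[OF _ f], simp)
  also have "\<dots> = (\<integral>\<^sup>+y. H y * indicator {sin (-\<rho>)..sin \<rho>} y \<partial>lborel)"
    using H0 by (intro nn_integral_cong) (auto simp: indicator_def)
  also have "\<dots> = (\<integral>\<^sup>+\<theta>. H (sin \<theta>) * ennreal (cos \<theta>) * indicator {-\<rho>..\<rho>} \<theta> \<partial>lborel)"
    by (rule nn_integral_substitution_aux)
       (use \<rho> pi in \<open>auto intro!: measH derivative_eq_intros continuous_intros cos_ge_zero\<close>)
  also have "\<dots> \<le> (\<integral>\<^sup>+\<theta>. \<integral>\<^sup>+t. ?g (cos \<theta> - t) (sin \<theta>) *
        indicator {p. 0 < fst p \<and> fst p < \<rho> \<and> \<bar>snd p\<bar> < \<rho>} (t, \<theta>) \<partial>lborel \<partial>lborel)"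
    by (intro nn_integral_mono le)
  also have "\<dots> = (\<integral>\<^sup>+p. f (\<xi> * Complex (cos (snd p) - fst p) (sin (snd p)))
            * indicator {p. 0 < fst p \<and> fst p < \<rho> \<and> \<bar>snd p\<bar> < \<rho>} p \<partial>lborel)"
  proof (subst nn_integral_lborel_Pair(2))
    have "{p :: real \<times> real. 0 < fst p \<and> fst p < \<rho> \<and> \<bar>snd p\<bar> < \<rho>} \<in> sets borel"
      by (intro borel_open open_Collect_conj open_Collect_less continuous_intros)
    moreover have "(\<lambda>p. f (\<xi> * Complex (cos (snd p) - fst p) (sin (snd p)))) \<in> borel_measurable borel"
      by (rule measurable_compose[OF _ f]) (use meas_sc in simp)
    ultimately show "(\<lambda>p. f (\<xi> * Complex (cos (snd p) - fst p) (sin (snd p)))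
       * indicator {p. 0 < fst p \<and> fst p < \<rho> \<and> \<bar>snd p\<bar> < \<rho>} p) \<in> borel_measurable borel"
      by simp
  qed simp
  finally show ?thesis unfolding e .
qed

section \<open>The chart of the polydisc at a torus point\<close>

definition chart_dom :: "real \<Rightarrow> ((real^3) \<times> (real^3)) set" where
  "chart_dom \<rho> = {q. \<forall>k. 0 < fst q $ k \<and> fst q $ k < \<rho> \<and> \<bar>snd q $ k\<bar> < \<rho>}"

lemma open_chart_dom: "open (chart_dom \<rho>)"
proof -
  have "chart_dom \<rho> = (\<Inter>k. {q. 0 < fst q $ k \<and> fst q $ k < \<rho> \<and> \<bar>snd q $ k\<bar> < \<rho>})"
    by (auto simp: chart_dom_def)
  moreover have "open {q :: (real^3) \<times> (real^3). 0 < fst q $ k \<and> fst q $ k < \<rho> \<and> \<bar>snd q $ k\<bar> < \<rho>}" for k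
    by (intro open_Collect_conj open_Collect_less continuous_intros)
  ultimately show ?thesis by (simp add: open_INT)
qed

lemma borel_measurable_tcoord: "tcoord \<xi> \<in> borel_measurable borel"
  using Ck_on_tcoord[of 0 \<xi>] by (simp add: borel_measurable_continuous_onI)

text \<open>The one-factor chart is applied to the innermost integral, then to the middle and the
  outer one. At each stage the partial integral must vanish off the image of the next factor; this
  follows because the support of \<open>f\<close> lies in a product of images.\<close>

lemma nn_integral_torus_chart:
  fixes f :: "c3 \<Rightarrow> ennreal"
  assumes f: "f \<in> borel_measurable borel" and \<xi>: "\<xi> \<in> torus3" and \<rho>: "0 < \<rho>" "\<rho> \<le> 1"
    and supp: "\<And>z. f z \<noteq> 0 \<Longrightarrow> z \<in> tcoord \<xi> ` chart_dom \<rho>"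
  shows "(\<integral>\<^sup>+z. f z \<partial>lborel) \<le> (\<integral>\<^sup>+q. f (tcoord \<xi> q) * indicator (chart_dom \<rho>) q \<partial>lborel)"
proof -
  define c where "c k p = \<xi> $ k * (exp (\<i> * of_real (snd p)) - complex_of_real (fst p))" for k and p :: "real \<times> real"
  define D where "D = {p :: real \<times> real. 0 < fst p \<and> fst p < \<rho> \<and> \<bar>snd p\<bar> < \<rho>}"
  have c[measurable]: "c k \<in> borel_measurable borel" for k
    unfolding c_def by (intro borel_measurable_continuous_onI continuous_intros)
  have D[measurable]: "D \<in> sets borel"
    unfolding D_def by (intro borel_open open_Collect_conj open_Collect_less continuous_intros)
  have norm\<xi>: "norm (\<xi> $ k) = 1" for k
    using \<xi> by (simp add: torus3_def)
  have chart: "(\<integral>\<^sup>+z. g z \<partial>lborel) \<le> (\<integral>\<^sup>+p. g (c k p) * indicator D p \<partial>lborel)"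
    if "g \<in> borel_measurable borel" "\<And>z. g z \<noteq> 0 \<Longrightarrow> z \<in> c k ` D" for g k
  proof -
    have "\<exists>t \<theta>. 0 < t \<and> t < \<rho> \<and> \<bar>\<theta>\<bar> < \<rho> \<and> z = \<xi> $ k * (exp (\<i> * of_real \<theta>) - of_real t)" if "g z \<noteq> 0" for z
      using \<open>\<And>z. g z \<noteq> 0 \<Longrightarrow> z \<in> c k ` D\<close>[OF that] by (auto simp: c_def D_def)
    then show ?thesis
      unfolding c_def D_def by (rule nn_integral_circle_chart[OF that(1) norm\<xi> \<rho>])
  qed
  have vec[measurable (raw)]: "(\<lambda>p. f (vector [a p, b p, d p])) \<in> borel_measurable M"
    if [measurable]: "a \<in> borel_measurable M" "b \<in> borel_measurable M" "d \<in> borel_measurable M" for a b d M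
  proof (rule measurable_compose[OF _ f])
    have "linear (\<lambda>w. vector [fst w, fst (snd w), snd (snd w)] :: c3)"
      by (auto intro!: linearI simp: vec_eq_iff forall_3)
    then have "(\<lambda>w. vector [fst w, fst (snd w), snd (snd w)] :: c3) \<in> borel_measurable borel"
      using linear_continuous_on linear_conv_bounded_linear borel_measurable_continuous_onI by blast
    from measurable_compose[OF _ this, of "\<lambda>p. (a p, b p, d p)" M]
    show "(\<lambda>p. vector [a p, b p, d p] :: c3) \<in> borel_measurable M"
      by (simp add: borel_prod[symmetric])
  qed
  have supp': "x \<in> c 1 ` D \<and> y \<in> c 2 ` D \<and> z \<in> c 3 ` D" if "f (vector [x, y, z]) \<noteq> 0" for x y z
  proof -
    obtain q where q: "q \<in> chart_dom \<rho>" "vector [x, y, z] = tcoord \<xi> q"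
      using supp[OF \<open>f (vector [x, y, z]) \<noteq> 0\<close>] by auto
    have "(vector [x, y, z] :: c3) $ k = c k (fst q $ k, snd q $ k)" for k
      by (simp add: q(2) tcoord_def c_def)
    moreover have "(fst q $ k, snd q $ k) \<in> D" for k
      using q(1) by (simp add: D_def chart_dom_def)
    ultimately have "(vector [x, y, z] :: c3) $ k \<in> c k ` D" for k
      by blast
    from this[of 1] this[of 2] this[of 3] show ?thesis by simp
  qed
  let ?f = "\<lambda>P. f (\<chi> k. c k (P $ k)) * indicator {P. \<forall>k. P $ k \<in> D} P"
  have f_eq: "f (vector [c 1 p1, c 2 p2, c 3 p3]) * indicator D p3 * indicator D p2 * indicator D p1
      = ?f (vector [p1, p2, p3])" for p1 p2 p3
  proof -
    have "(vector [c 1 p1, c 2 p2, c 3 p3] :: c3) = (\<chi> k. c k (vector [p1, p2, p3] $ k))"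
      by (simp add: vec_eq_iff forall_3)
    then show ?thesis by (auto simp: indicator_def forall_3)
  qed
  have meas_tc: "(\<lambda>q. f (tcoord \<xi> q) * indicator (chart_dom \<rho>) q) \<in> borel_measurable borel"
    using measurable_compose[OF borel_measurable_tcoord f] open_chart_dom by simp
  have "(\<lambda>P :: (real \<times> real)^3. (\<chi> k. fst (P $ k), \<chi> k. snd (P $ k)) :: (real^3) \<times> (real^3)) \<in> borel_measurable borel"
    by (intro borel_measurable_continuous_onI continuous_intros)
  note meas_tc' = measurable_compose[OF this meas_tc]
  have tc_eq: "f (tcoord \<xi> (\<chi> k. fst (P $ k), \<chi> k. snd (P $ k))) * indicator (chart_dom \<rho>) (\<chi> k. fst (P $ k), \<chi> k. snd (P $ k)) = ?f P" for P
    by (simp add: tcoord_def c_def chart_dom_def D_def indicator_def)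
  have "(\<integral>\<^sup>+z. f z \<partial>lborel) = (\<integral>\<^sup>+x. \<integral>\<^sup>+y. \<integral>\<^sup>+z. f (vector [x, y, z]) \<partial>lborel \<partial>lborel \<partial>lborel)"
    by (rule nn_integral_lborel_vec3[OF f])
  also have "\<dots> \<le> (\<integral>\<^sup>+x. \<integral>\<^sup>+y. \<integral>\<^sup>+p3. f (vector [x, y, c 3 p3]) * indicator D p3 \<partial>lborel \<partial>lborel \<partial>lborel)"
  proof (intro nn_integral_mono chart)
    fix x y z
    assume "f (vector [x, y, z]) \<noteq> 0"
    then show "z \<in> c 3 ` D" using supp' by blast
  qed measurable
  also have "\<dots> \<le> (\<integral>\<^sup>+x. \<integral>\<^sup>+p2. (\<integral>\<^sup>+p3. f (vector [x, c 2 p2, c 3 p3]) * indicator D p3 \<partial>lborel) * indicator D p2 \<partial>lborel \<partial>lborel)"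
  proof (intro nn_integral_mono chart)
    fix x y
    assume *: "(\<integral>\<^sup>+p3. f (vector [x, y, c 3 p3]) * indicator D p3 \<partial>lborel) \<noteq> 0"
    show "y \<in> c 2 ` D"
    proof (rule ccontr)
      assume "y \<notin> c 2 ` D"
      then have "f (vector [x, y, z]) = 0" for z using supp' by blast
      then show False using * by simp
    qed
  qed measurable
  also have "\<dots> \<le> (\<integral>\<^sup>+p1. (\<integral>\<^sup>+p2. (\<integral>\<^sup>+p3. f (vector [c 1 p1, c 2 p2, c 3 p3]) * indicator D p3 \<partial>lborel) * indicator D p2 \<partial>lborel) * indicator D p1 \<partial>lborel)"
  proof (intro chart)
    fix x
    assume *: "(\<integral>\<^sup>+p2. (\<integral>\<^sup>+p3. f (vector [x, c 2 p2, c 3 p3]) * indicator D p3 \<partial>lborel) * indicator D p2 \<partial>lborel) \<noteq> 0"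
    show "x \<in> c 1 ` D"
    proof (rule ccontr)
      assume "x \<notin> c 1 ` D"
      then have "f (vector [x, y, z]) = 0" for y z using supp' by blast
      then show False using * by simp
    qed
  qed measurable
  also have "\<dots> = (\<integral>\<^sup>+p1. \<integral>\<^sup>+p2. \<integral>\<^sup>+p3. ?f (vector [p1, p2, p3]) \<partial>lborel \<partial>lborel \<partial>lborel)"
  proof (intro nn_integral_cong)
    fix p1
    have m3: "(\<lambda>p3. f (vector [c 1 p1, c 2 p2, c 3 p3]) * indicator D p3) \<in> borel_measurable lborel" for p2
      by measurable
    have m2: "(\<lambda>p2. (\<integral>\<^sup>+p3. f (vector [c 1 p1, c 2 p2, c 3 p3]) * indicator D p3 \<partial>lborel) * indicator D p2)
        \<in> borel_measurable lborel"
      by measurable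
    have "(\<lambda>p3. f (vector [c 1 p1, c 2 p2, c 3 p3]) * indicator D p3 * indicator D p2) \<in> borel_measurable lborel" for p2
      by measurable
    from nn_integral_multc[OF this] nn_integral_multc[OF m3]
    have "(\<integral>\<^sup>+p3. ?f (vector [p1, p2, p3]) \<partial>lborel) =
      (\<integral>\<^sup>+p3. f (vector [c 1 p1, c 2 p2, c 3 p3]) * indicator D p3 \<partial>lborel) * indicator D p2 * indicator D p1" for p2
      unfolding f_eq[symmetric] by metis
    then show "(\<integral>\<^sup>+p2. (\<integral>\<^sup>+p3. f (vector [c 1 p1, c 2 p2, c 3 p3]) * indicator D p3 \<partial>lborel) * indicator D p2 \<partial>lborel) * indicator D p1
       = (\<integral>\<^sup>+p2. \<integral>\<^sup>+p3. ?f (vector [p1, p2, p3]) \<partial>lborel \<partial>lborel)"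
      by (simp only: nn_integral_multc[OF m2])
  qed
  also have "\<dots> = (\<integral>\<^sup>+P. ?f P \<partial>lborel)"
    by (rule nn_integral_lborel_vec3[symmetric]) (use meas_tc' in \<open>simp only: tc_eq\<close>)
  also have "\<dots> = (\<integral>\<^sup>+q. f (tcoord \<xi> q) * indicator (chart_dom \<rho>) q \<partial>lborel)"
    using nn_integral_lborel_swap3[OF meas_tc] by (simp only: tc_eq)
  finally show ?thesis .
qed

section \<open>Fibrewise bounds for the weighted volume\<close>

lemma tcoord_nbhd:
  assumes \<xi>: "\<xi> \<in> torus3" and \<rho>: "0 < \<rho>" "\<rho> \<le> 1"
  shows "\<exists>U. open U \<and> \<xi> \<in> U \<and> polydisc \<inter> U \<subseteq> tcoord \<xi> ` chart_dom \<rho>"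
proof -
  have pi: "\<rho> < pi / 2" using \<rho>(2) pi_gt3 by linarith
  \<comment> \<open>Closeness \<rho> to 1 bounds the displacement \<open>t\<close>; closeness sin
    \<rho> bounds the angle through arcsin. The minimum serves both.\<close>
  define r where "r = min \<rho> (sin \<rho>)"
  have "0 < sin \<rho>" using \<rho> pi by (intro sin_gt_zero) linarith+
  then have r: "0 < r" "r \<le> \<rho>" "r \<le> sin \<rho>" using \<rho> by (auto simp: r_def)
  define U where "U = (\<Inter>k. {z :: c3. norm (z $ k - \<xi> $ k) < r})"
  have "open U"
    unfolding U_def by (intro open_INT ballI open_Collect_less continuous_intros) auto
  moreover have "\<xi> \<in> U" using r by (simp add: U_def)
  moreover have "polydisc \<inter> U \<subseteq> tcoord \<xi> ` chart_dom \<rho>"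
  proof
    fix z assume z: "z \<in> polydisc \<inter> U"
    define w where "w k = cnj (\<xi> $ k) * z $ k" for k
    have norm\<xi>: "norm (\<xi> $ k) = 1" for k using \<xi> by (simp add: torus3_def)
    have cc: "\<xi> $ k * cnj (\<xi> $ k) = 1" for k
      using complex_norm_square[of "\<xi> $ k"] norm\<xi> by simp
    have w1: "norm (w k) < 1" for k
      using z norm\<xi> by (auto simp: w_def norm_mult polydisc_def)
    have "w k - 1 = cnj (\<xi> $ k) * (z $ k - \<xi> $ k)" for k
      using cc[of k] by (simp add: w_def algebra_simps)
    then have w2: "norm (w k - 1) < r" for k
      using z norm\<xi> by (auto simp: norm_mult U_def)
    \<comment> \<open>The chart is inverted explicitly: Im w = sin \<theta> determines the angle and
      t = cos \<theta> - Re w the displacement. That t > 0 is a restatement of |w| < 1.\<close>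
    define th where "th k = arcsin (Im (w k))" for k
    have im: "\<bar>Im (w k)\<bar> < sin \<rho>" "\<bar>Im (w k)\<bar> < 1" "Re (w k) > 1 - \<rho>" for k
      using abs_Im_le_cmod[of "w k - 1"] abs_Im_le_cmod[of "w k"] abs_Re_le_cmod[of "w k - 1"]
        w1[of k] w2[of k] r by (auto simp: abs_le_iff abs_less_iff)
    have sin_th: "sin (th k) = Im (w k)" for k
      using im[of k] by (simp add: th_def abs_le_iff)
    have cos_th: "cos (th k) = sqrt (1 - (Im (w k))\<^sup>2)" for k
      using im[of k] by (simp add: th_def cos_arcsin)
    have th: "\<bar>th k\<bar> < \<rho>" for k
    proof -
      have "arcsin (Im (w k)) < arcsin (sin \<rho>)" "arcsin (sin (-\<rho>)) < arcsin (Im (w k))"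
        using im[of k] by (auto intro!: arcsin_less_arcsin simp: abs_less_iff)
      moreover have "arcsin (sin \<rho>) = \<rho>" "arcsin (sin (-\<rho>)) = -\<rho>"
        using pi \<rho> by (intro arcsin_sin; linarith)+
      ultimately show ?thesis by (simp add: th_def abs_less_iff)
    qed
    have "(Re (w k))\<^sup>2 < 1 - (Im (w k))\<^sup>2" for k
    proof -
      have "(norm (w k))\<^sup>2 < 1" using w1[of k] by (simp add: abs_square_less_1)
      then show ?thesis by (simp add: cmod_power2)
    qed
    then have t0: "Re (w k) < cos (th k)" for k
      unfolding cos_th by (intro real_less_rsqrt)
    have t1: "cos (th k) - Re (w k) < \<rho>" for k
      using im(3)[of k] cos_le_one[of "th k"] by linarith
    let ?q = "(\<chi> k. cos (th k) - Re (w k), \<chi> k. th k)"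
    have "tcoord \<xi> ?q $ k = z $ k" for k
    proof -
      have "exp (\<i> * of_real (th k)) - of_real (cos (th k) - Re (w k)) = w k"
        by (simp add: cis_conv_exp[symmetric] complex_eq_iff sin_th)
      then have "tcoord \<xi> ?q $ k = \<xi> $ k * w k" by (simp add: tcoord_def)
      also have "\<dots> = z $ k" using cc[of k] by (simp add: w_def mult.assoc[symmetric])
      finally show ?thesis .
    qed
    then have "tcoord \<xi> ?q = z" by (simp add: vec_eq_iff)
    moreover have "?q \<in> chart_dom \<rho>" using t0 t1 th by (simp add: chart_dom_def)
    ultimately show "z \<in> tcoord \<xi> ` chart_dom \<rho>" by blast
  qed
  ultimately show ?thesis by blast
qed

lemma norm_tcoord:
  assumes "\<xi> \<in> torus3"
  shows "1 - (norm (tcoord \<xi> q $ k))\<^sup>2 = fst q $ k * (2 * cos (snd q $ k) - fst q $ k)"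
proof -
  have "norm (\<xi> $ k) = 1" using assms by (simp add: torus3_def)
  then have "(norm (tcoord \<xi> q $ k))\<^sup>2 = (norm (cis (snd q $ k) - of_real (fst q $ k)))\<^sup>2"
    by (simp add: tcoord_def norm_mult cis_conv_exp[symmetric])
  also have "\<dots> = (cos (snd q $ k) - fst q $ k)\<^sup>2 + (sin (snd q $ k))\<^sup>2"
    by (simp add: cmod_power2)
  also have "\<dots> = 1 - fst q $ k * (2 * cos (snd q $ k) - fst q $ k)"
    using sin_cos_squared_add2[of "snd q $ k"] by (simp add: power2_eq_square algebra_simps)
  finally show ?thesis by simp
qed

lemma cos_ge_3_4: "\<bar>x\<bar> \<le> 1/2 \<Longrightarrow> cos x \<ge> 3/4" for x :: real
proof -
  assume "\<bar>x\<bar> \<le> 1/2"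
  then have "\<bar>sin (x / 2)\<bar> \<le> 1/4" using abs_sin_x_le_abs_x[of "x / 2"] by linarith
  then have "(sin (x / 2))\<^sup>2 \<le> (1/4)\<^sup>2" by (intro abs_le_square_iff[THEN iffD1]) simp
  then show ?thesis using cos_double_sin[of "x / 2"] by (simp add: power2_eq_square)
qed

text \<open>On this range 2 cos \<theta> - t \<ge> 3/2 - 1/2 = 1. The inequality turns the weight in
  1 - |z_k|^2 into a weight in t_k.\<close>

lemma norm_tcoord_ge:
  assumes "\<xi> \<in> torus3" "0 \<le> fst q $ k" "fst q $ k \<le> 1/2" "\<bar>snd q $ k\<bar> \<le> 1/2"
  shows "fst q $ k \<le> 1 - (norm (tcoord \<xi> q $ k))\<^sup>2"
proof -
  have "1 \<le> 2 * cos (snd q $ k) - fst q $ k"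
    using assms cos_ge_3_4[OF assms(4)] by linarith
  then show ?thesis
    using mult_left_mono[of 1 _ "fst q $ k"] assms by (simp add: norm_tcoord)
qed

text \<open>The factor \<open>\<beta> + 1\<close> of the normalised measure cancels the denominator
  of the integral of \<open>s powr \<beta>\<close>, so no constant blows up as \<beta> approaches
  -1.\<close>

lemma nn_integral_powr_interval:
  assumes "-1 < \<beta>" "0 < \<tau>"
  shows "(\<integral>\<^sup>+s. ennreal ((\<beta> + 1) * s powr \<beta>) * indicator {0..\<tau>} s \<partial>lborel) = ennreal (\<tau> powr (\<beta> + 1))"
proof -
  have "((\<lambda>s. (\<beta> + 1) * s powr \<beta>) has_integral (\<beta> + 1) * (\<tau> powr (\<beta> + 1) / (\<beta> + 1))) {0..\<tau>}"
    using assms by (intro has_integral_mult_right has_integral_powr_from_0) auto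
  then show ?thesis
    using assms by (subst nn_integral_has_integral_lebesgue') auto
qed

lemma open_polydisc: "open polydisc"
proof -
  have "polydisc = (\<Inter>k. {z. norm (z $ k) < 1})" by (auto simp: polydisc_def)
  moreover have "open (\<Inter>k. {z :: c3. norm (z $ k) < 1})"
    by (intro open_INT ballI open_Collect_less continuous_intros) auto
  ultimately show ?thesis by simp
qed

lemma nn_integral_prod3:
  assumes [measurable]: "f \<in> borel_measurable M" "g \<in> borel_measurable M" "h \<in> borel_measurable M"
  shows "(\<integral>\<^sup>+x. \<integral>\<^sup>+y. \<integral>\<^sup>+z. f x * (g y * h z) \<partial>M \<partial>M \<partial>M)
    = (\<integral>\<^sup>+x. f x \<partial>M) * ((\<integral>\<^sup>+y. g y \<partial>M) * (\<integral>\<^sup>+z. h z \<partial>M))"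
  by (simp add: nn_integral_cmult nn_integral_multc)

lemma borel_fibre:
  assumes "open S"
  shows "{\<theta>. (t, \<theta>) \<in> chart_dom \<rho> \<and> tcoord \<xi> (t, \<theta>) \<in> S} \<in> sets borel"
proof -
  have "open (Pair t -` (chart_dom \<rho> \<inter> tcoord \<xi> -` S))"
  proof (intro open_vimage continuous_intros open_Int open_chart_dom assms)
    show "continuous_on UNIV (tcoord \<xi>)" using Ck_on_tcoord[of 0] by simp
  qed
  then show ?thesis by (simp add: vimage_def Collect_conj_eq)
qed

text \<open>In the chart the weight is dominated by a product of functions of the t_k alone, so
  Fubini separates the estimate: each fibre contributes its unweighted volume, bounded by
  \<open>B\<close> uniformly in \<open>t\<close>, and the remaining weight integrates to one power
  of \<open>\<tau> k\<close> per coordinate.\<close>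

lemma Vbeta_le_fibre_bound:
  assumes \<xi>: "\<xi> \<in> torus3" and \<rho>: "0 < \<rho>" "\<rho> \<le> 1/2" and \<beta>: "-1 < \<beta>" "\<beta> \<le> 0"
    and S: "open S" "S \<subseteq> polydisc" "S \<subseteq> tcoord \<xi> ` chart_dom \<rho>"
    and \<tau>: "\<And>k. 0 < \<tau> k"
    and fib: "\<And>t. emeasure lborel {\<theta>. (t, \<theta>) \<in> chart_dom \<rho> \<and> tcoord \<xi> (t, \<theta>) \<in> S}
                \<le> (if \<forall>k. 0 \<le> t $ k \<and> t $ k \<le> \<tau> k then B else 0)"
  shows "Vbeta \<beta> S \<le> B * ennreal (\<Prod>k\<in>UNIV. \<tau> k powr (\<beta> + 1))"
proof -
  let ?w = "\<lambda>k s. ennreal ((\<beta> + 1) * s powr \<beta>) * indicator {0..\<tau> k} s"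
  let ?A = "\<lambda>t. {\<theta>. (t, \<theta>) \<in> chart_dom \<rho> \<and> tcoord \<xi> (t, \<theta>) \<in> S}"
  define w where "w t = ennreal (\<Prod>k\<in>UNIV. (\<beta> + 1) * (t $ k) powr \<beta>)" for t :: "real^3"
  have polydisc: "open polydisc"
    by (rule open_polydisc)
  have measV: "(\<lambda>z. ennreal (Vweight \<beta> z)) \<in> borel_measurable borel"
  proof -
    have [measurable]: "polydisc \<in> sets borel" using polydisc by (rule borel_open)
    have [measurable]: "(\<lambda>z::c3. z $ k) \<in> borel_measurable borel" for k
      by (intro borel_measurable_continuous_onI continuous_intros)
    show ?thesis unfolding Vweight_def by measurable
  qed
  have measf: "(\<lambda>z. ennreal (Vweight \<beta> z) * indicator S z) \<in> borel_measurable borel"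
    using measV S(1) by simp
  have measw: "w \<in> borel_measurable borel"
  proof -
    have [measurable]: "(\<lambda>z::real^3. z $ k) \<in> borel_measurable borel" for k
      by (intro borel_measurable_continuous_onI continuous_intros)
    show ?thesis unfolding w_def by measurable
  qed
  have measq: "(\<lambda>q. ennreal (Vweight \<beta> (tcoord \<xi> q)) * indicator S (tcoord \<xi> q) * indicator (chart_dom \<rho>) q) \<in> borel_measurable borel"
    using measurable_compose[OF borel_measurable_tcoord measf] open_chart_dom by simp
  have le_w: "ennreal (Vweight \<beta> (tcoord \<xi> (t, \<theta>))) \<le> w t" if "(t, \<theta>) \<in> chart_dom \<rho>" for t \<theta>
  proof -
    \<comment> \<open>Since \<beta> \<le> 0 the power is nonincreasing, so the lower bound on 1 -
      |z_k|^2 gives an upper bound on the weight; the factor 1/pi < 1 is dropped.\<close>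
    have "(1 - norm (tcoord \<xi> (t, \<theta>) $ k) ^ 2) powr \<beta> / pi \<le> (t $ k) powr \<beta>" for k
    proof -
      have tk: "0 < t $ k" "t $ k < \<rho>" "\<bar>\<theta> $ k\<bar> < \<rho>" using that by (auto simp: chart_dom_def)
      then have "t $ k \<le> 1 - norm (tcoord \<xi> (t, \<theta>) $ k) ^ 2"
        using norm_tcoord_ge[OF \<xi>, of "(t, \<theta>)" k] \<rho> by simp
      then have "(1 - norm (tcoord \<xi> (t, \<theta>) $ k) ^ 2) powr \<beta> \<le> (t $ k) powr \<beta>"
        using powr_mono2'[of \<beta> "t $ k"] \<beta> tk by blast
      moreover have "x / pi \<le> x" if "0 \<le> x" for x
        using that pi_gt3 by (simp add: divide_le_eq mult_le_cancel_left1)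
      ultimately show ?thesis by (meson order_trans powr_ge_zero)
    qed
    then have "(\<Prod>k\<in>UNIV. (\<beta> + 1) * (1 - norm (tcoord \<xi> (t, \<theta>) $ k) ^ 2) powr \<beta> / pi)
        \<le> (\<Prod>k\<in>UNIV. (\<beta> + 1) * (t $ k) powr \<beta>)"
      using \<beta> by (intro prod_mono conjI) (auto intro!: mult_left_mono simp flip: times_divide_eq_right)
    moreover have "0 \<le> (\<Prod>k\<in>UNIV. (\<beta> + 1) * (t $ k) powr \<beta>)"
      using \<beta> by (intro prod_nonneg) auto
    ultimately show ?thesis
      unfolding w_def Vweight_def by (intro ennreal_leI) auto
  qed
  have "Vbeta \<beta> S \<le> (\<integral>\<^sup>+q. ennreal (Vweight \<beta> (tcoord \<xi> q)) * indicator S (tcoord \<xi> q) * indicator (chart_dom \<rho>) q \<partial>lborel)"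
    unfolding Vbeta_def
  proof (rule nn_integral_torus_chart[OF measf \<xi> \<rho>(1)])
    show "z \<in> tcoord \<xi> ` chart_dom \<rho>" if "ennreal (Vweight \<beta> z) * indicator S z \<noteq> 0" for z
      using that S(3) by (auto simp: indicator_def split: if_splits)
  qed (use \<rho> in simp)
  also have "\<dots> = (\<integral>\<^sup>+t. \<integral>\<^sup>+\<theta>. ennreal (Vweight \<beta> (tcoord \<xi> (t, \<theta>))) * indicator S (tcoord \<xi> (t, \<theta>))
      * indicator (chart_dom \<rho>) (t, \<theta>) \<partial>lborel \<partial>lborel)"
    by (rule nn_integral_lborel_Pair(1)[OF measq])
  also have "\<dots> \<le> (\<integral>\<^sup>+t. w t * emeasure lborel (?A t) \<partial>lborel)"
  proof (intro nn_integral_mono)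
    fix t
    have A: "?A t \<in> sets lborel" using borel_fibre[OF S(1)] by simp
    have "(\<integral>\<^sup>+\<theta>. ennreal (Vweight \<beta> (tcoord \<xi> (t, \<theta>))) * indicator S (tcoord \<xi> (t, \<theta>))
      * indicator (chart_dom \<rho>) (t, \<theta>) \<partial>lborel) \<le> (\<integral>\<^sup>+\<theta>. w t * indicator (?A t) \<theta> \<partial>lborel)"
      using le_w by (intro nn_integral_mono) (auto simp: indicator_def)
    also have "\<dots> = w t * emeasure lborel (?A t)"
      using A by (rule nn_integral_cmult_indicator)
    finally show "(\<integral>\<^sup>+\<theta>. ennreal (Vweight \<beta> (tcoord \<xi> (t, \<theta>))) * indicator S (tcoord \<xi> (t, \<theta>))
      * indicator (chart_dom \<rho>) (t, \<theta>) \<partial>lborel) \<le> w t * emeasure lborel (?A t)" .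
  qed
  also have "\<dots> \<le> (\<integral>\<^sup>+t. B * (?w 1 (t $ 1) * (?w 2 (t $ 2) * ?w 3 (t $ 3))) \<partial>(lborel :: (real^3) measure))"
  proof (intro nn_integral_mono)
    fix t :: "real^3"
    have "w t * emeasure lborel (?A t) \<le> w t * (if \<forall>k. 0 \<le> t $ k \<and> t $ k \<le> \<tau> k then B else 0)"
      by (intro mult_left_mono fib) simp
    also have "\<dots> = B * (?w 1 (t $ 1) * (?w 2 (t $ 2) * ?w 3 (t $ 3)))"
    proof (cases "\<forall>k. 0 \<le> t $ k \<and> t $ k \<le> \<tau> k")
      case True
      then have ind: "indicator {0..\<tau> k} (t $ k) = (1 :: ennreal)" for k by simp
      have nn: "0 \<le> (\<beta> + 1) * (t $ k) powr \<beta>" for k using \<beta> by simp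
      have "w t = ennreal ((\<beta> + 1) * (t $ 1) powr \<beta>) * (ennreal ((\<beta> + 1) * (t $ 2) powr \<beta>) *
          ennreal ((\<beta> + 1) * (t $ 3) powr \<beta>))"
        unfolding w_def UNIV_3 by (simp only: ennreal_mult[symmetric] nn mult_nonneg_nonneg) (simp add: mult.assoc)
      with True show ?thesis by (simp only: ind if_True mult_1_right simp_thms) (simp only: mult.commute)
    next
      case False
      then show ?thesis by (auto simp: forall_3 indicator_def)
    qed
    finally show "w t * emeasure lborel (?A t) \<le> B * (?w 1 (t $ 1) * (?w 2 (t $ 2) * ?w 3 (t $ 3)))" .
  qed
  also have "\<dots> = B * (\<integral>\<^sup>+t. ?w 1 (t $ 1) * (?w 2 (t $ 2) * ?w 3 (t $ 3)) \<partial>(lborel :: (real^3) measure))"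
  proof (rule nn_integral_cmult)
    have [measurable]: "(\<lambda>z::real^3. z $ k) \<in> borel_measurable borel" for k
      by (intro borel_measurable_continuous_onI continuous_intros)
    show "(\<lambda>t :: real^3. ?w 1 (t $ 1) * (?w 2 (t $ 2) * ?w 3 (t $ 3))) \<in> borel_measurable lborel"
      by measurable
  qed
  also have "(\<integral>\<^sup>+t. ?w 1 (t $ 1) * (?w 2 (t $ 2) * ?w 3 (t $ 3)) \<partial>(lborel :: (real^3) measure))
     = (\<integral>\<^sup>+x. \<integral>\<^sup>+y. \<integral>\<^sup>+z. ?w 1 x * (?w 2 y * ?w 3 z) \<partial>lborel \<partial>lborel \<partial>lborel)"
  proof (subst nn_integral_lborel_vec3)
    have [measurable]: "(\<lambda>z::real^3. z $ k) \<in> borel_measurable borel" for k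
      by (intro borel_measurable_continuous_onI continuous_intros)
    show "(\<lambda>t :: real^3. ?w 1 (t $ 1) * (?w 2 (t $ 2) * ?w 3 (t $ 3))) \<in> borel_measurable borel"
      by measurable
  qed simp
  also have "\<dots> = (\<integral>\<^sup>+x. ?w 1 x \<partial>lborel) * ((\<integral>\<^sup>+y. ?w 2 y \<partial>lborel) * (\<integral>\<^sup>+z. ?w 3 z \<partial>lborel))"
    by (rule nn_integral_prod3) measurable
  also have "\<dots> = ennreal (\<Prod>k\<in>UNIV. \<tau> k powr (\<beta> + 1))"
    unfolding nn_integral_powr_interval[OF \<beta>(1) \<tau>] UNIV_3 by (simp add: ennreal_mult)
  finally show ?thesis .
qed

section \<open>Volume of fibres cut out by three functions\<close>

lemma Ck_on_line_deriv:
  assumes "Ck_on (Suc k) W f" "q + \<tau> *\<^sub>R v \<in> W"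
  shows "((\<lambda>\<tau>. f (q + \<tau> *\<^sub>R v)) has_vector_derivative frechet_derivative f (at (q + \<tau> *\<^sub>R v)) v) (at \<tau>)"
proof -
  note f = Ck_on_has_derivative[OF assms]
  have "((\<lambda>\<tau>. q + \<tau> *\<^sub>R v) has_derivative (\<lambda>s. s *\<^sub>R v)) (at \<tau>)"
    by (auto intro!: derivative_eq_intros)
  from has_derivative_compose[OF this f] show ?thesis
    by (simp add: has_vector_derivative_def linear_scale[OF has_derivative_linear[OF f]])
qed

lemma Ck_on_line_deriv_real:
  fixes f :: "'a::euclidean_space \<Rightarrow> real"
  assumes "Ck_on (Suc k) W f" "q + \<tau> *\<^sub>R v \<in> W"
  shows "((\<lambda>\<tau>. f (q + \<tau> *\<^sub>R v)) has_real_derivative frechet_derivative f (at (q + \<tau> *\<^sub>R v)) v) (at \<tau>)"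
  using Ck_on_line_deriv[OF assms] by (simp add: has_real_derivative_iff_has_vector_derivative)

lemma Ck_on_isCont_directional:
  assumes "Ck_on (Suc k) W f" "q \<in> W"
  shows "isCont (\<lambda>x. frechet_derivative f (at x) v) q"
proof -
  have "Ck_on k W (\<lambda>x. frechet_derivative f (at x) v)" "open W"
    using assms(1) by auto
  then have "continuous_on W (\<lambda>x. frechet_derivative f (at x) v)"
    using Ck_on_SucD by (induction k) (auto simp del: Ck_on.simps(2))
  then show ?thesis using \<open>open W\<close> assms(2) by (simp add: continuous_on_eq_continuous_at)
qed

lemma norm_le_sum_cart: "norm (Q :: 'a::real_normed_vector^'n::finite) \<le> (\<Sum>i\<in>UNIV. norm (Q $ i))"
  by (simp add: norm_vec_def L2_set_le_sum)

text \<open>The rows of the Jacobian are taken at different points, so that the mean value theorem applied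
  to each component turns nonvanishing of the determinant into injectivity.\<close>
lemma mixed_jacobian_nbhd:
  fixes p :: "3 \<Rightarrow> (real^3) \<times> (real^3) \<Rightarrow> real"
  assumes p: "\<And>i. Ck_on 1 W (p i)" and W: "0 \<in> W"
    and det: "det (\<chi> i j. frechet_derivative (p i) (at 0) (0, axis j 1)) \<noteq> 0"
  shows "\<exists>d>0. \<exists>c>0. \<forall>q :: 3 \<Rightarrow> (real^3) \<times> (real^3). (\<forall>i. norm (q i) < d) \<longrightarrow>
      c \<le> \<bar>det (\<chi> i j. frechet_derivative (p i) (at (q i)) (0, axis j 1))\<bar>"
proof -
  let ?D = "\<lambda>Q :: ((real^3) \<times> (real^3))^3. det (\<chi> i j. frechet_derivative (p i) (at (Q $ i)) (0, axis j 1))"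
  have c: "isCont (\<lambda>Q :: ((real^3) \<times> (real^3))^3. frechet_derivative (p i) (at (Q $ i)) v) 0" for i v
  proof -
    have "isCont (\<lambda>x. frechet_derivative (p i) (at x) v) ((0 :: ((real^3) \<times> (real^3))^3) $ i)"
      using Ck_on_isCont_directional[of 0 W "p i" 0] p[of i] W by simp
    from isCont_o2[where f = "\<lambda>Q. Q $ i", OF _ this] show ?thesis by simp
  qed
  have cD: "isCont ?D 0"
    unfolding det_3 by (simp, intro continuous_intros c)
  define c where "c = \<bar>?D 0\<bar> / 2"
  have "0 < c" using det by (simp add: c_def)
  obtain d where d: "d > 0" "\<And>Q. dist Q 0 < d \<Longrightarrow> dist (?D Q) (?D 0) < c"
    using continuous_at_eps_delta[THEN iffD1, rule_format, OF cD \<open>0 < c\<close>] by blast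
  \<comment> \<open>The three base points form one vector \<open>Q\<close>, whose norm is at most
    the sum of theirs; hence the radius d/3. Within distance \<open>c\<close> of its value 2c at the
    origin, the determinant keeps at least half of its absolute value.\<close>
  have "c \<le> \<bar>det (\<chi> i j. frechet_derivative (p i) (at (q i)) (0, axis j 1))\<bar>"
    if q: "\<forall>i. norm (q i) < d / 3" for q :: "3 \<Rightarrow> (real^3) \<times> (real^3)"
  proof -
    have "norm (\<chi> i. q i) \<le> norm (q 1) + norm (q 2) + norm (q 3)"
      using norm_le_sum_cart[of "\<chi> i. q i"] by (simp add: sum_3)
    also have "\<dots> < d" using q[rule_format, of 1] q[rule_format, of 2] q[rule_format, of 3] by linarith
    finally have "dist (?D (\<chi> i. q i)) (?D 0) < c" by (intro d(2)) simp
    then have "c \<le> \<bar>?D (\<chi> i. q i)\<bar>" unfolding c_def dist_real_def by linarith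
    then show "c \<le> \<bar>det (\<chi> i j. frechet_derivative (p i) (at (q i)) (0, axis j 1))\<bar>" by simp
  qed
  moreover have "0 < d / 3" using d by simp
  ultimately show ?thesis using \<open>0 < c\<close> by blast
qed

text \<open>The crude sum over six real coordinates; it is the origin of the factors 6 and 12 in the
  radii below.\<close>

lemma norm_Pair_cart3_less:
  fixes t \<theta> :: "real^3"
  assumes "\<And>k. \<bar>t $ k\<bar> < r" "\<And>k. \<bar>\<theta> $ k\<bar> < r"
  shows "norm (t, \<theta>) < 6 * r"
proof -
  have "norm x < 3 * r" if "\<And>k. \<bar>x $ k\<bar> < r" for x :: "real^3"
    using norm_le_sum_cart[of x] that[of 1] that[of 2] that[of 3] by (simp add: sum_3)
  from this[of t] this[of \<theta>] show ?thesis
    using assms norm_Pair_le[of t \<theta>] by fastforce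
qed

text \<open>For frozen \<open>t\<close> the map M = (p_1, p_2, p_3) of \<theta> is injective on
  \<open>E\<close> with Jacobian at least \<open>c\<close>, so c |E| \<le> |M(E)|, and M(E) lies in
  the box with sides u_i - l_i. The constants come from a neighbourhood of 0 in both variables,
  hence they do not depend on \<open>t\<close>.\<close>

lemma fibre_measure_bound:
  fixes p :: "3 \<Rightarrow> (real^3) \<times> (real^3) \<Rightarrow> real"
  assumes p: "\<And>i. Ck_on 1 W (p i)" and W: "0 \<in> W"
    and det: "det (\<chi> i j. frechet_derivative (p i) (at 0) (0, axis j 1)) \<noteq> 0"
  shows "\<exists>r>0. \<exists>K>0. \<forall>t E l u. (\<forall>k. \<bar>t $ k\<bar> < r) \<longrightarrow> E \<in> sets borel \<longrightarrow> (\<forall>i. l i \<le> u i) \<longrightarrow>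
     (\<forall>\<theta>\<in>E. (\<forall>k. \<bar>\<theta> $ k\<bar> < r) \<and> (\<forall>i. l i \<le> p i (t, \<theta>) \<and> p i (t, \<theta>) \<le> u i)) \<longrightarrow>
     emeasure lborel E \<le> ennreal (K * (\<Prod>i\<in>UNIV. u i - l i))"
proof -
  let ?D = "\<lambda>i q. frechet_derivative (p i) (at q)"
  obtain d c where d: "d > 0" "c > 0"
    and jac: "\<And>q :: 3 \<Rightarrow> (real^3) \<times> (real^3). (\<And>i. norm (q i) < d) \<Longrightarrow>
      c \<le> \<bar>det (\<chi> i j. ?D i (q i) (0, axis j 1))\<bar>"
    using mixed_jacobian_nbhd[of W p, OF p W det] by blast
  have "open W" using p Ck_on_open by blast
  then obtain e where e: "e > 0" "ball 0 e \<subseteq> W" using W openE by blast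
  define r where "r = min d e / 6"
  have r: "r > 0" using d e by (simp add: r_def)
  have near: "norm (t, \<theta>) < d" "(t, \<theta>) \<in> W" if "\<And>k. \<bar>t $ k\<bar> < r" "\<And>k. \<bar>\<theta> $ k\<bar> < r" for t \<theta> :: "real^3"
  proof -
    have "norm (t, \<theta>) < 6 * r" using norm_Pair_cart3_less that by blast
    then have "norm (t, \<theta>) < d" "norm (t, \<theta>) < e" by (auto simp: r_def)
    then show "norm (t, \<theta>) < d" "(t, \<theta>) \<in> W" using e by auto
  qed
  have derp: "(p i has_derivative ?D i q) (at q)" if "q \<in> W" for i q
    using Ck_on_has_derivative[of 0 W "p i" q] p[of i] that by simp
  have bound: "emeasure lborel E \<le> ennreal (1 / c * (\<Prod>i\<in>UNIV. u i - l i))"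
    if t: "\<forall>k. \<bar>t $ k\<bar> < r" and E: "E \<in> sets borel" and lu: "\<forall>i. l i \<le> u i"
      and pE: "\<forall>\<theta>\<in>E. (\<forall>k. \<bar>\<theta> $ k\<bar> < r) \<and> (\<forall>i. l i \<le> p i (t, \<theta>) \<and> p i (t, \<theta>) \<le> u i)"
    for t :: "real^3" and E l u
  proof -
    define M where "M \<theta> = (\<chi> i. p i (t, \<theta>))" for \<theta>
    define M' where "M' \<theta> h = (\<chi> i. ?D i (t, \<theta>) (0, h))" for \<theta> h
    have lin: "?D i q (0, h) = (\<Sum>j\<in>UNIV. ?D i q (0, axis j 1) * h $ j)" if "q \<in> W" for i q h
    proof -
      have L: "linear (\<lambda>h. ?D i q (0, h))"
        using has_derivative_linear[OF derp[OF that]]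
        by (intro linearI) (use linear_add[of "?D i q" "(0, _)" "(0, _)"] linear_scale[of "?D i q" _ "(0, _)"] in auto)
      have "h = (\<Sum>j\<in>UNIV. h $ j *\<^sub>R axis j 1)"
        using basis_expansion[of h] by (simp add: scalar_mult_eq_scaleR)
      then have "?D i q (0, h) = ?D i q (0, \<Sum>j\<in>UNIV. h $ j *\<^sub>R axis j 1)" by simp
      also have "\<dots> = (\<Sum>j\<in>UNIV. h $ j * ?D i q (0, axis j 1))"
        by (simp add: linear_sum[OF L] linear_scale[OF L])
      finally show ?thesis by (simp add: mult.commute)
    qed
    have inE: "(t, \<theta>) \<in> W" "\<And>k. \<bar>\<theta> $ k\<bar> < r" if "\<theta> \<in> E" for \<theta>
      using near pE t that by auto
    have der: "(M has_derivative M' \<theta>) (at \<theta>)" if "\<theta> \<in> E" for \<theta>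
      unfolding M_def M'_def
    proof (rule has_derivative_vec_lambda)
      fix i
      have "((\<lambda>\<theta>. (t, \<theta>)) has_derivative (\<lambda>h. (0, h))) (at \<theta>)"
        by (auto intro!: derivative_eq_intros)
      from has_derivative_compose[OF this derp[OF inE(1)[OF that]]]
      show "((\<lambda>\<theta>. p i (t, \<theta>)) has_derivative (\<lambda>h. ?D i (t, \<theta>) (0, h))) (at \<theta>)" .
    qed
    have mat: "matrix (M' \<theta>) = (\<chi> i j. ?D i (t, \<theta>) (0, axis j 1))" for \<theta>
      by (simp add: matrix_def M'_def)
    have detM: "c \<le> \<bar>det (matrix (M' \<theta>))\<bar>" if "\<theta> \<in> E" for \<theta>
      unfolding mat by (rule jac) (use near t inE(2)[OF that] in auto)
    \<comment> \<open>If M x = M y with h = y - x nonzero, the mean value theorem gives for each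
      component a point of the segment where its derivative along h vanishes. The matrix whose rows
      are taken at these three points kills h, against the lower bound on mixed
      determinants.\<close>
    have inj: "inj_on M E"
    proof (rule inj_onI, rule ccontr)
      fix x y assume xy: "x \<in> E" "y \<in> E" "M x = M y" "x \<noteq> y"
      define h where "h = y - x"
      have seg: "\<bar>(x + s *\<^sub>R h) $ k\<bar> < r" if "0 \<le> s" "s \<le> 1" for s k
      proof -
        have "x $ k \<in> {-r<..<r}" "y $ k \<in> {-r<..<r}"
          using inE(2)[OF xy(1), of k] inE(2)[OF xy(2), of k] by (auto simp: abs_less_iff)
        then have "(1 - s) *\<^sub>R (x $ k) + s *\<^sub>R (y $ k) \<in> {-r<..<r}"
          using that by (intro convexD[OF convex_real_interval(8)]) auto
        moreover have "(1 - s) *\<^sub>R (x $ k) + s *\<^sub>R (y $ k) = (x + s *\<^sub>R h) $ k"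
          by (simp add: h_def algebra_simps)
        ultimately show ?thesis by (simp add: abs_less_iff)
      qed
      have "\<exists>s. 0 < s \<and> s < 1 \<and> ?D i (t, x + s *\<^sub>R h) (0, h) = 0" for i
      proof -
        have "((\<lambda>\<tau>. p i ((t, x) + \<tau> *\<^sub>R (0, h))) has_real_derivative ?D i ((t, x) + \<tau> *\<^sub>R (0, h)) (0, h)) (at \<tau>)"
          if "0 \<le> \<tau>" "\<tau> \<le> 1" for \<tau>
          by (rule Ck_on_line_deriv_real[of 0 W]) (use p near t seg[OF that] in auto)
        then have "\<exists>s>0. s < 1 \<and> p i ((t, x) + 1 *\<^sub>R (0, h)) - p i ((t, x) + 0 *\<^sub>R (0, h))
            = (1 - 0) * ?D i ((t, x) + s *\<^sub>R (0, h)) (0, h)"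
          by (intro MVT2) auto
        moreover have "p i (t, x) = p i (t, y)" using xy(3) by (simp add: M_def vec_eq_iff)
        ultimately show ?thesis by (auto simp: h_def)
      qed
      then obtain s where s: "\<And>i. 0 < s i" "\<And>i. s i < 1" "\<And>i. ?D i (t, x + s i *\<^sub>R h) (0, h) = 0"
        by metis
      let ?q = "\<lambda>i. (t, x + s i *\<^sub>R h)"
      have q: "norm (?q i) < d" "?q i \<in> W" for i
        using near[of t "x + s i *\<^sub>R h"] t seg[of "s i"] s(1,2)[of i] by auto
      have "(\<chi> i j. ?D i (?q i) (0, axis j 1)) *v h = 0"
        unfolding vec_eq_iff matrix_vector_mult_def vec_lambda_beta zero_index
        using s(3) lin[OF q(2), symmetric] by (intro allI) (rule trans)
      moreover have "h \<noteq> 0" using xy(4) by (simp add: h_def)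
      ultimately have "det (\<chi> i j. ?D i (?q i) (0, axis j 1)) = 0"
        using invertible_det_nz invertible_left_inverse matrix_left_invertible_ker by blast
      then show False using jac[of ?q, OF q(1)] d(2) by simp
    qed
    have "bounded E"
    proof (rule bounded_subset[OF bounded_cbox])
      show "E \<subseteq> cbox (\<chi> k. -r) (\<chi> k. r)" using inE(2) by (auto simp: mem_box_cart abs_less_iff less_imp_le minus_less_iff)
    qed
    then have Elm: "E \<in> lmeasurable" using E by (intro bounded_set_imp_lmeasurable) auto
    then have Elb: "E \<in> sets lebesgue" by auto
    have MEsub: "M ` E \<subseteq> cbox (\<chi> i. l i) (\<chi> i. u i)"
      using pE by (auto simp: M_def mem_box_cart)
    have "M ` E \<in> sets lebesgue"
      by (rule differentiable_image_in_sets_lebesgue[OF Elb])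
        (use der in \<open>auto simp: differentiable_on_def differentiable_def intro: has_derivative_at_withinI\<close>)
    then have MElm: "M ` E \<in> lmeasurable"
      using bounded_set_imp_lmeasurable bounded_subset[OF bounded_cbox MEsub] by blast
    have hi1: "((\<lambda>x. \<bar>det (matrix (M' x))\<bar>) has_integral measure lebesgue (M ` E)) E"
      using has_measure_differentiable_image[OF Elb has_derivative_at_withinI[OF der] inj] MElm by blast
    have hi2: "((\<lambda>x. c * 1) has_integral c * measure lebesgue E) E"
      using Elm lmeasure_integral[OF Elm] lmeasurable_iff_integrable_on
      by (intro has_integral_mult_right) (simp add: has_integral_iff lmeasurable_iff_integrable_on)
    have "c * measure lebesgue E \<le> measure lebesgue (M ` E)"
      using has_integral_le[OF hi2 hi1] detM by simp
    also have "\<dots> \<le> measure lebesgue (cbox (\<chi> i. l i) (\<chi> i. u i))"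
      by (rule measure_mono_fmeasurable[OF MEsub]) (use \<open>M ` E \<in> sets lebesgue\<close> in auto)
    also have "\<dots> = (\<Prod>i\<in>UNIV. u i - l i)"
      using lu by (simp add: content_cbox_cart interval_ne_empty_cart)
    finally have "measure lebesgue E \<le> 1 / c * (\<Prod>i\<in>UNIV. u i - l i)"
      using d(2) by (simp add: pos_le_divide_eq mult.commute)
    then have "ennreal (measure lebesgue E) \<le> ennreal (1 / c * (\<Prod>i\<in>UNIV. u i - l i))"
      by (rule ennreal_leI)
    moreover have "emeasure lborel E = ennreal (measure lebesgue E)"
      using emeasure_eq_measure2[OF Elm] E by simp
    ultimately show ?thesis by simp
  qed
  have "0 < 1 / c" using d by simp
  show ?thesis
    by (rule exI[of _ r], rule conjI[OF r], rule exI[of _ "1 / c"], rule conjI[OF \<open>0 < 1 / c\<close>])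
      (intro allI impI, rule bound; assumption)
qed

section \<open>Contact with the unit circle at a torus point\<close>

text \<open>One-sided because the lower bounds on \<open>F\<close> hold only for displacements into
  the polydisc; the two-sided derivative is recovered from quotients on the right.\<close>

lemma real_deriv_ge_at_right:
  fixes f :: "real \<Rightarrow> real"
  assumes "(f has_real_derivative D) (at 0)" "f 0 = 0" "0 < e" "\<And>s. 0 < s \<Longrightarrow> s < e \<Longrightarrow> c * s \<le> f s"
  shows "c \<le> D"
proof -
  have "((\<lambda>s. f s / s) \<longlongrightarrow> D) (at_right 0)"
    using assms(1,2) by (auto simp: has_field_derivative_iff intro: filterlim_mono[OF _ order_refl at_le])
  moreover have "eventually (\<lambda>s. c \<le> f s / s) (at_right 0)"
    using eventually_at_right_less[of 0] eventually_at_right_real[OF assms(3)]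
    by eventually_elim (use assms(4) in \<open>auto simp: pos_le_divide_eq\<close>)
  ultimately show ?thesis by (rule tendsto_lowerbound) simp
qed

lemma has_real_derivative_along:
  fixes f :: "'a::real_normed_vector \<Rightarrow> real"
  assumes "(f has_derivative f') (at 0)"
  shows "((\<lambda>s. f (s *\<^sub>R v)) has_real_derivative f' v) (at 0)"
proof -
  have "((\<lambda>s. s *\<^sub>R v) has_derivative (\<lambda>s. s *\<^sub>R v)) (at 0)"
    by (auto intro!: derivative_eq_intros)
  moreover have "(f has_derivative f') (at (0 *\<^sub>R v))" using assms by simp
  ultimately have "((\<lambda>s. f (s *\<^sub>R v)) has_derivative (\<lambda>s. f' (s *\<^sub>R v))) (at 0)"
    by (rule has_derivative_compose)
  then show ?thesis
    by (simp add: has_field_derivative_def linear_scale[OF has_derivative_linear[OF assms]] mult_commute_abs)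
qed

text \<open>Divided by the first term on the left, this is the formula for 1 - |h|^2 with h = (w -
  p) / (1 - cnj p * w).\<close>

lemma moebius_norm_identity:
  fixes p w :: complex
  shows "(norm (1 - cnj p * w))\<^sup>2 - (norm (w - p))\<^sup>2 = (1 - (norm p)\<^sup>2) * (1 - (norm w)\<^sup>2)"
  unfolding cmod_power2 by (simp add: algebra_simps power2_eq_square)

text \<open>Following \<open>f\<close> by the disc automorphism that sends f(0) to 0 allows the
  Schwarz lemma, |h(r)| \<le> r; the Moebius identity translates this back to \<open>f\<close>. The
  distance to the circle thus decays at most linearly, which later excludes a vanishing normal
  derivative.\<close>

lemma Schwarz_Pick_boundary_rate:
  assumes holf: "f holomorphic_on ball 0 1" and f1: "\<And>z. norm z < 1 \<Longrightarrow> norm (f z) < 1"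
  shows "\<exists>c>0. \<forall>r. 0 \<le> r \<and> r < 1 \<longrightarrow> c * (1 - r) \<le> 1 - (norm (f (of_real r)))\<^sup>2"
proof -
  define p where "p = f 0"
  have p: "norm p < 1" using f1[of 0] by (simp add: p_def)
  have den: "1 - norm p \<le> norm (1 - cnj p * w)" if "norm w < 1" for w
  proof -
    have "norm (cnj p * w) \<le> norm p" using that mult_left_le[of "norm w" "norm p"] by (simp add: norm_mult)
    then show ?thesis using norm_triangle_ineq2[of 1 "cnj p * w"] by simp
  qed
  have nz: "1 - cnj p * f z \<noteq> 0" if "norm z < 1" for z
    using den[OF f1[OF that]] p by auto
  define h where "h z = (f z - p) / (1 - cnj p * f z)" for z
  have holh: "h holomorphic_on ball 0 1"
    unfolding h_def by (intro holomorphic_intros holf) (use nz in auto)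
  have p2: "0 < 1 - (norm p)\<^sup>2" "1 - (norm p)\<^sup>2 \<le> 1"
    using p by (auto simp: abs_square_less_1)
  have h1: "norm (h z) < 1" if "norm z < 1" for z
  proof -
    have "0 < (1 - (norm p)\<^sup>2) * (1 - (norm (f z))\<^sup>2)"
      using p2 f1[OF that] by (intro mult_pos_pos) (auto simp: abs_square_less_1)
    then have "(norm (f z - p))\<^sup>2 < (norm (1 - cnj p * f z))\<^sup>2"
      using moebius_norm_identity[of p "f z"] by simp
    then have "norm (f z - p) < norm (1 - cnj p * f z)" by (rule power_less_imp_less_base) simp
    then show ?thesis using nz[OF that] by (simp add: h_def norm_divide)
  qed
  \<comment> \<open>The constant is the square of the lower bound \<open>den\<close> for the Moebius
    denominator; the factor 1 - |p|^2 \<le> 1 on the other side is dropped.\<close>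
  have "(1 - norm p)\<^sup>2 * (1 - r) \<le> 1 - (norm (f (of_real r)))\<^sup>2" if r: "0 \<le> r" "r < 1" for r
  proof -
    let ?w = "f (of_real r)"
    have nr: "norm (of_real r :: complex) < 1" using r by simp
    have w: "norm ?w < 1" by (rule f1[OF nr])
    have "norm (h (of_real r)) \<le> r"
      using Schwarz_Lemma(1)[OF holh _ h1 nr] r by (simp add: h_def p_def)
    then have "(norm (h (of_real r)))\<^sup>2 \<le> r\<^sup>2" by (simp add: power_mono)
    also have "\<dots> \<le> r" using r by (simp add: power2_eq_square mult_left_le)
    finally have hr: "1 - r \<le> 1 - (norm (h (of_real r)))\<^sup>2" by simp
    have "(1 - norm p)\<^sup>2 * (1 - r) \<le> (norm (1 - cnj p * ?w))\<^sup>2 * (1 - (norm (h (of_real r)))\<^sup>2)"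
      using den[OF w] p r hr by (intro mult_mono power_mono) auto
    also have "\<dots> = (norm (1 - cnj p * ?w))\<^sup>2 - (norm (?w - p))\<^sup>2"
      using nz[OF nr] by (simp add: h_def norm_divide power_divide field_simps)
    also have "\<dots> = (1 - (norm p)\<^sup>2) * (1 - (norm ?w)\<^sup>2)" by (rule moebius_norm_identity)
    also have "\<dots> \<le> 1 * (1 - (norm ?w)\<^sup>2)"
      using p2 w by (intro mult_right_mono) (auto simp: abs_square_le_1)
    finally show ?thesis by simp
  qed
  moreover have "0 < (1 - norm p)\<^sup>2" using p by simp
  ultimately show ?thesis by blast
qed

text \<open>Serves to extend identities and bounds from the open polydisc, where the extension
  agrees with the holomorphic function, to boundary points.\<close>

lemma tendsto_radial:
  fixes z :: "'a::real_normed_vector"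
  assumes "continuous_on U h" "open U" "z \<in> U"
  shows "((\<lambda>s. h ((1 - s) *\<^sub>R z)) \<longlongrightarrow> h z) (at_right 0)"
proof -
  have "((\<lambda>s. (1 - s) *\<^sub>R z) \<longlongrightarrow> z) (at_right 0)"
    by (auto intro!: tendsto_eq_intros)
  moreover have "isCont h z" using assms by (simp add: continuous_on_eq_continuous_at)
  ultimately show ?thesis by (rule isCont_tendsto_compose[rotated])
qed

lemma scale_in_polydisc:
  assumes "z \<in> closed_polydisc" "0 < s" "s \<le> 1"
  shows "(1 - s) *\<^sub>R z \<in> polydisc"
  unfolding polydisc_def
proof (clarsimp)
  fix k
  have "(1 - s) * norm (z $ k) \<le> (1 - s) * 1"
    using assms by (intro mult_left_mono) (auto simp: closed_polydisc_def)
  then show "\<bar>1 - s\<bar> * norm (z $ k) < 1" using assms by simp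
qed

lemma quadform_scale: "quadform A (c *\<^sub>R v) = c\<^sup>2 * quadform A v"
  by (simp add: quadform_def matrix_vector_mult_scaleR power2_eq_square)

section \<open>First and second order behaviour at the contact point\<close>

locale torus_contact =
  fixes \<phi> g :: "c3 \<Rightarrow> complex" and \<xi> :: c3
  assumes holo: "holo_on polydisc \<phi>" and lt1: "\<And>z. z \<in> polydisc \<Longrightarrow> norm (\<phi> z) < 1"
    and ext: "Ck_extension 2 \<phi> g" and \<xi>: "\<xi> \<in> torus3" and unim: "norm (\<phi> \<xi>) = 1"
begin

definition G :: "(real^3) \<times> (real^3) \<Rightarrow> complex" where
  "G q = cnj (\<phi> \<xi>) * g (tcoord \<xi> q)"

definition F :: "(real^3) \<times> (real^3) \<Rightarrow> real" where
  "F q = 1 - G q \<bullet> G q"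

text \<open>The number under \<open>Re\<close> turns out to be real and nonnegative, so nothing is
  lost; up to unimodular factors in each component this is the complex gradient, see
  \<open>grad_cgrad\<close>.\<close>

definition grad :: "real^3" where
  "grad = (\<chi> k. Re (cnj (\<phi> \<xi>) * \<xi> $ k * frechet_derivative g (at \<xi>) (axis k 1)))"

lemma F_eq: "F q = 1 - (norm (G q))\<^sup>2"
  by (simp add: F_def power2_norm_eq_inner)

lemma g_eq: "z \<in> closed_polydisc \<Longrightarrow> g z = \<phi> z"
  using ext by (simp add: Ck_extension_def)

lemma \<xi>_closed: "\<xi> \<in> closed_polydisc"
  using \<xi> by (simp add: torus3_def closed_polydisc_def)

lemma ex_Ck_g: "\<exists>U. closed_polydisc \<subseteq> U \<and> Ck_on 2 U g"
  using ext unfolding Ck_extension_def by blast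

lemma g_has_derivative:
  assumes "z \<in> closed_polydisc"
  shows "(g has_derivative frechet_derivative g (at z)) (at z)"
proof -
  obtain U where "closed_polydisc \<subseteq> U" "Ck_on (Suc 1) U g" using ex_Ck_g by (metis Suc_1)
  then show ?thesis using Ck_on_has_derivative assms by blast
qed

lemma tcoord_0: "tcoord \<xi> 0 = \<xi>"
  by (simp add: tcoord_def vec_eq_iff)

lemma ex_Ck_G: "\<exists>W. 0 \<in> W \<and> Ck_on 2 W G \<and> Ck_on 2 W F"
proof -
  obtain U where U: "closed_polydisc \<subseteq> U" "Ck_on 2 U g" using ex_Ck_g by blast
  let ?W = "tcoord \<xi> -` U"
  have "continuous_on UNIV (tcoord \<xi>)" using Ck_on_tcoord[of 0] by simp
  then have W: "open ?W" using Ck_on_open[OF U(2)] by (metis open_vimage)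
  have "Ck_on 2 ?W (\<lambda>q. g (tcoord \<xi> q))"
    by (rule Ck_on_compose[OF U(2) Ck_on_mono[OF Ck_on_tcoord W]]) auto
  then have G: "Ck_on 2 ?W G"
    unfolding G_def by (rule Ck_on_linear_compose[OF bounded_linear_mult_right])
  have "Ck_on 2 ?W (\<lambda>q. 1 + - (G q \<bullet> G q))"
    by (intro Ck_on_add Ck_on_const W Ck_on_linear_compose[OF bounded_linear_minus[OF bounded_linear_ident]]
      Ck_on_bilinear[OF bounded_bilinear_inner] G)
  then have "Ck_on 2 ?W F" by (rule Ck_on_cong[rotated]) (simp add: F_def)
  moreover have "0 \<in> ?W" using tcoord_0 \<xi>_closed U(1) by auto
  ultimately show ?thesis using G by blast
qed

lemma G_0: "G 0 = 1"
  using complex_norm_square[of "\<phi> \<xi>"] unim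
  by (simp add: G_def tcoord_0 g_eq \<xi>_closed mult.commute)

lemma F_0: "F 0 = 0"
  by (simp add: F_eq G_0)

lemma norm_\<phi>_le:
  assumes "z \<in> closed_polydisc"
  shows "norm (\<phi> z) \<le> 1"
proof -
  obtain U where U: "closed_polydisc \<subseteq> U" "Ck_on 2 U g" using ex_Ck_g by blast
  then have "Ck_on 0 U g" using Ck_on_SucD by (metis numeral_2_eq_2)
  then have cont: "continuous_on U g" "open U" by auto
  have "((\<lambda>s. norm (g ((1 - s) *\<^sub>R z))) \<longlongrightarrow> norm (g z)) (at_right 0)"
    by (intro tendsto_norm tendsto_radial[OF cont]) (use U assms in auto)
  moreover have "eventually (\<lambda>s. norm (g ((1 - s) *\<^sub>R z)) \<le> 1) (at_right 0)"
    using eventually_at_right_real[OF zero_less_one]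
  proof eventually_elim
    case (elim s)
    then have "(1 - s) *\<^sub>R z \<in> polydisc" using scale_in_polydisc[OF assms] by simp
    moreover from this have "(1 - s) *\<^sub>R z \<in> closed_polydisc"
      by (auto simp: polydisc_def closed_polydisc_def less_imp_le)
    ultimately show ?case using lt1 g_eq by (simp add: less_imp_le)
  qed
  ultimately have "norm (g z) \<le> 1" by (rule tendsto_upperbound) simp
  then show ?thesis using g_eq assms by simp
qed

lemma norm_G_le:
  assumes "tcoord \<xi> q \<in> closed_polydisc"
  shows "norm (G q) \<le> 1"
  using norm_\<phi>_le[OF assms] g_eq[OF assms] unim by (simp add: G_def norm_mult)

lemma F_nonneg:
  assumes "\<And>k. 0 \<le> fst q $ k \<and> fst q $ k \<le> 1/2 \<and> \<bar>snd q $ k\<bar> \<le> 1/2"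
  shows "0 \<le> F q"
proof -
  have "norm (tcoord \<xi> q $ k) \<le> 1" for k
  proof -
    have "(norm (tcoord \<xi> q $ k))\<^sup>2 \<le> 1"
      using norm_tcoord_ge[OF \<xi>, of q k] assms[of k] by linarith
    then show ?thesis by (simp add: abs_square_le_1)
  qed
  then have "norm (G q) \<le> 1" by (intro norm_G_le) (simp add: closed_polydisc_def)
  then show ?thesis by (simp add: F_eq abs_square_le_1)
qed

text \<open>Complex linearity holds at the points (1 - s) \<xi>, where \<open>g\<close> coincides
  with \<phi> on an open set, and passes to \<xi> by continuity of the directional
  derivatives.\<close>

lemma frechet_g_complex_linear: "frechet_derivative g (at \<xi>) (c *s v) = c * frechet_derivative g (at \<xi>) v"
proof -
  obtain U where U: "closed_polydisc \<subseteq> U" "Ck_on (Suc 1) U g" using ex_Ck_g by (metis Suc_1)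
  have "Ck_on 1 U (\<lambda>z. frechet_derivative g (at z) w)" for w using U(2) by (rule Ck_on_directional)
  then have cont: "continuous_on U (\<lambda>z. frechet_derivative g (at z) w)" "open U" for w
    using Ck_on_SucD[of 0 U] Ck_on_open by fastforce+
  have 1: "((\<lambda>s. frechet_derivative g (at ((1 - s) *\<^sub>R \<xi>)) w) \<longlongrightarrow> frechet_derivative g (at \<xi>) w) (at_right 0)" for w
    by (rule tendsto_radial[OF cont]) (use U \<xi>_closed in auto)
  have "eventually (\<lambda>s. frechet_derivative g (at ((1 - s) *\<^sub>R \<xi>)) (c *s v) = c * frechet_derivative g (at ((1 - s) *\<^sub>R \<xi>)) v) (at_right 0)"
    using eventually_at_right_real[OF zero_less_one]
  proof eventually_elim
    case (elim s)
    then have z: "(1 - s) *\<^sub>R \<xi> \<in> polydisc" using scale_in_polydisc[OF \<xi>_closed] by simp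
    have "frechet_derivative g (at ((1 - s) *\<^sub>R \<xi>)) = frechet_derivative \<phi> (at ((1 - s) *\<^sub>R \<xi>))"
      by (rule frechet_derivative_cong_open[OF open_polydisc z])
        (auto intro!: g_eq simp: polydisc_def closed_polydisc_def less_imp_le)
    then show ?case
      using holo z unfolding holo_on_def by (metis frechet_derivative_at)
  qed
  then have "((\<lambda>s. c * frechet_derivative g (at ((1 - s) *\<^sub>R \<xi>)) v) \<longlongrightarrow> frechet_derivative g (at \<xi>) (c *s v)) (at_right 0)"
    using 1[of "c *s v"] by (rule Lim_transform_eventually[rotated])
  moreover have "((\<lambda>s. c * frechet_derivative g (at ((1 - s) *\<^sub>R \<xi>)) v) \<longlongrightarrow> c * frechet_derivative g (at \<xi>) v) (at_right 0)"
    by (intro tendsto_mult_left 1)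
  ultimately show ?thesis by (rule tendsto_unique[rotated]) simp
qed

definition \<alpha> :: "3 \<Rightarrow> complex" where
  "\<alpha> k = cnj (\<phi> \<xi>) * \<xi> $ k * frechet_derivative g (at \<xi>) (axis k 1)"

lemma G_has_derivative_\<alpha>:
  "(G has_derivative (\<lambda>q. \<Sum>k\<in>UNIV. (\<i> * of_real (snd q $ k) - of_real (fst q $ k)) * \<alpha> k)) (at 0)"
proof -
  note dg = g_has_derivative[OF \<xi>_closed]
  have "frechet_derivative g (at \<xi>) (\<chi> k. w k) = (\<Sum>k\<in>UNIV. w k * frechet_derivative g (at \<xi>) (axis k 1))" for w
  proof -
    have "(\<chi> k. w k) = (\<Sum>k\<in>UNIV. w k *s axis k 1)"
      by (simp add: vec_eq_iff axis_def if_distrib cong: if_cong)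
    then show ?thesis
      by (simp add: linear_sum[OF has_derivative_linear[OF dg]] frechet_g_complex_linear)
  qed
  note sum = this
  have "(tcoord \<xi> has_derivative (\<lambda>q. \<chi> k. \<xi> $ k * (\<i> * of_real (snd q $ k) - of_real (fst q $ k)))) (at 0)"
    using tcoord_has_derivative[of \<xi> 0] by simp
  moreover have "(g has_derivative frechet_derivative g (at \<xi>)) (at (tcoord \<xi> 0))"
    using dg by (simp add: tcoord_0)
  ultimately have "((\<lambda>q. g (tcoord \<xi> q)) has_derivative (\<lambda>q. frechet_derivative g (at \<xi>)
      (\<chi> k. \<xi> $ k * (\<i> * of_real (snd q $ k) - of_real (fst q $ k))))) (at 0)"
    by (rule has_derivative_compose)
  then have "((\<lambda>q. cnj (\<phi> \<xi>) * g (tcoord \<xi> q)) has_derivative (\<lambda>q. cnj (\<phi> \<xi>) * frechet_derivative g (at \<xi>)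
      (\<chi> k. \<xi> $ k * (\<i> * of_real (snd q $ k) - of_real (fst q $ k))))) (at 0)"
    by (rule has_derivative_mult_right)
  then show ?thesis
    unfolding sum sum_distrib_left G_def[abs_def] \<alpha>_def by (simp add: mult_ac)
qed

lemma F_has_derivative_G:
  assumes "(G has_derivative G') (at 0)"
  shows "(F has_derivative (\<lambda>q. - 2 * Re (G' q))) (at 0)"
proof -
  have "((\<lambda>q. 1 - G q \<bullet> G q) has_derivative (\<lambda>q. 0 - (G 0 \<bullet> G' q + G' q \<bullet> G 0))) (at 0)"
    by (intro has_derivative_diff has_derivative_const has_derivative_inner assms)
  then show ?thesis
    unfolding F_def[abs_def] by (simp add: G_0 inner_complex_def)
qed

lemma F_along_nonneg:
  assumes "0 < s" "s < 1/2" "\<And>k. 0 \<le> fst q $ k \<and> fst q $ k \<le> 1 \<and> \<bar>snd q $ k\<bar> \<le> 1"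
  shows "0 \<le> F (s *\<^sub>R q)"
proof (rule F_nonneg)
  fix k
  have "s * fst q $ k \<le> s * 1" "s * \<bar>snd q $ k\<bar> \<le> s * 1"
    using assms by (intro mult_left_mono; simp)+
  then have "s * fst q $ k \<le> 1/2" "s * \<bar>snd q $ k\<bar> \<le> 1/2" using assms(2) by linarith+
  then show "0 \<le> fst (s *\<^sub>R q) $ k \<and> fst (s *\<^sub>R q) $ k \<le> 1/2 \<and> \<bar>snd (s *\<^sub>R q) $ k\<bar> \<le> 1/2"
    using assms by (auto simp: abs_mult)
qed

text \<open>\<open>F\<close> vanishes at 0 and is nonnegative for small \<open>t \<ge> 0\<close>, so
  its derivative is nonnegative in every direction with \<open>t \<ge> 0\<close>. Both signs of a
  rotation are admissible, which forces Im \<alpha>_k = 0; the inward direction gives Re \<alpha>_k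
  \<ge> 0.\<close>

lemma \<alpha>_real: "Im (\<alpha> k) = 0" and \<alpha>_nonneg: "0 \<le> Re (\<alpha> k)"
proof -
  let ?G' = "\<lambda>q. \<Sum>k\<in>UNIV. (\<i> * of_real (snd q $ k) - of_real (fst q $ k)) * \<alpha> k"
  have D: "0 \<le> - 2 * Re (?G' q)" if "\<And>k. 0 \<le> fst q $ k \<and> fst q $ k \<le> 1 \<and> \<bar>snd q $ k\<bar> \<le> 1" for q
    by (rule real_deriv_ge_at_right[OF has_real_derivative_along[OF F_has_derivative_G[OF G_has_derivative_\<alpha>]], of _ "1/2"])
       (use F_0 F_along_nonneg that in auto)
  have 1: "?G' (0, axis k 1) = \<i> * \<alpha> k" "?G' (0, axis k (-1)) = - \<i> * \<alpha> k" "?G' (axis k 1, 0) = - \<alpha> k"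
    by (simp_all add: axis_def if_distrib if_distribR sum.delta cong: if_cong)
  have "0 \<le> - 2 * Re (?G' (0, axis k 1))" "0 \<le> - 2 * Re (?G' (0, axis k (-1)))" "0 \<le> - 2 * Re (?G' (axis k 1, 0))"
    by (intro D; simp add: axis_def)+
  then show "Im (\<alpha> k) = 0" "0 \<le> Re (\<alpha> k)"
    unfolding 1 by auto
qed

lemma of_real_grad: "of_real (grad $ k) = \<alpha> k"
  using \<alpha>_real[of k] by (simp add: grad_def \<alpha>_def complex_eq_iff)

lemma grad_nonneg: "0 \<le> grad $ k"
  using \<alpha>_nonneg[of k] by (simp add: grad_def \<alpha>_def)

lemma G_has_derivative:
  "(G has_derivative (\<lambda>q. Complex (- (grad \<bullet> fst q)) (grad \<bullet> snd q))) (at 0)"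
proof -
  have "(\<Sum>k\<in>UNIV. (\<i> * of_real (snd q $ k) - of_real (fst q $ k)) * \<alpha> k)
      = Complex (- (grad \<bullet> fst q)) (grad \<bullet> snd q)" for q
    by (simp add: complex_eq_iff inner_vec_def of_real_grad[symmetric] sum_negf[symmetric] mult.commute)
  then show ?thesis using G_has_derivative_\<alpha> by simp
qed

lemma F_has_derivative: "(F has_derivative (\<lambda>q. 2 * (grad \<bullet> fst q))) (at 0)"
  using F_has_derivative_G[OF G_has_derivative] by simp

lemma frechet_F_0: "frechet_derivative F (at 0) q = 2 * (grad \<bullet> fst q)"
  using frechet_derivative_at[OF F_has_derivative] by metis

lemma frechet_ImG_0: "frechet_derivative (\<lambda>q. Im (G q)) (at 0) q = grad \<bullet> snd q"
proof -
  have "((\<lambda>q. Im (G q)) has_derivative (\<lambda>q. grad \<bullet> snd q)) (at 0)"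
    using has_derivative_Im[OF G_has_derivative] by simp
  from frechet_derivative_at[OF this] show ?thesis by metis
qed

lemma grad_cgrad: "of_real (grad $ k) = cnj (\<phi> \<xi>) * \<xi> $ k * cgrad g \<xi> $ k"
proof -
  have "axis k \<i> = \<i> *s (axis k 1 :: c3)" by (simp add: vec_eq_iff axis_def)
  then have "cgrad g \<xi> $ k = frechet_derivative g (at \<xi>) (axis k 1)"
    by (simp add: cgrad_def frechet_g_complex_linear algebra_simps)
  then show ?thesis by (simp add: of_real_grad \<alpha>_def)
qed

lemma grad_nonzero: "grad \<noteq> 0"
proof
  assume g0: "grad = 0"
  define f where "f u = \<phi> (u *s \<xi>)" for u
  have pd: "u *s \<xi> \<in> polydisc" if "norm u < 1" for u
    using that \<xi> by (simp add: polydisc_def torus3_def norm_mult)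
  have "f field_differentiable (at u)" if u: "norm u < 1" for u
  proof -
    obtain L where L: "(\<phi> has_derivative L) (at (u *s \<xi>))" "\<And>c v. L (c *s v) = c * L v"
      using holo pd[OF u] unfolding holo_on_def by blast
    have "((\<lambda>u. u *s \<xi>) has_derivative (\<lambda>\<mu>. \<mu> *s \<xi>)) (at u)"
      unfolding vector_scalar_mult_def by (intro has_derivative_vec_lambda) (auto intro!: derivative_eq_intros)
    from has_derivative_compose[OF this L(1)] have "(f has_field_derivative L \<xi>) (at u)"
      unfolding has_field_derivative_def f_def by (simp add: L(2) mult_commute_abs)
    then show ?thesis unfolding field_differentiable_def by blast
  qed
  then have "f holomorphic_on ball 0 1"
    by (simp add: holomorphic_on_def field_differentiable_at_within)
  then obtain c where c: "c > 0" "\<And>r. 0 \<le> r \<Longrightarrow> r < 1 \<Longrightarrow> c * (1 - r) \<le> 1 - (norm (f (of_real r)))\<^sup>2"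
    using Schwarz_Pick_boundary_rate[of f] lt1 pd unfolding f_def by blast
  \<comment> \<open>This direction moves \<xi> along its radius,
    \<open>tcoord \<xi> (s *\<^sub>R ?v)\<close> being (1 - s) \<xi>, so \<open>F\<close> there is
    the quantity controlled by the Schwarz-Pick rate of the one-variable function
    \<open>f\<close>.\<close>
  let ?v = "(\<chi> k. 1, 0) :: (real^3) \<times> (real^3)"
  have "c * s \<le> F (s *\<^sub>R ?v)" if s: "0 < s" "s < 1" for s
  proof -
    have "tcoord \<xi> (s *\<^sub>R ?v) = of_real (1 - s) *s \<xi>"
      by (simp add: vec_eq_iff tcoord_def algebra_simps)
    moreover have "of_real (1 - s) *s \<xi> \<in> polydisc" using s by (intro pd) (simp del: of_real_diff)
    then have "of_real (1 - s) *s \<xi> \<in> closed_polydisc"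
      by (auto simp: polydisc_def closed_polydisc_def less_imp_le)
    ultimately have "norm (G (s *\<^sub>R ?v)) = norm (f (of_real (1 - s)))"
      using unim g_eq by (simp add: G_def f_def norm_mult)
    then show ?thesis using c(2)[of "1 - s"] s by (simp add: F_eq)
  qed
  then have "c \<le> 2 * (grad \<bullet> fst ?v)"
    by (intro real_deriv_ge_at_right[OF has_real_derivative_along[OF F_has_derivative], of _ 1]) (auto simp: F_0 zero_prod_def[symmetric])
  then show False using c(1) g0 by simp
qed

lemma psi_eq_G: "psi \<phi> \<xi> \<theta> = G (0, \<theta>)"
proof -
  have "rot \<xi> \<theta> = tcoord \<xi> (0, \<theta>)" by (simp add: rot_def tcoord_def)
  moreover have "tcoord \<xi> (0, \<theta>) \<in> closed_polydisc"
    using \<xi> by (simp add: tcoord_def closed_polydisc_def torus3_def norm_mult)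
  ultimately show ?thesis by (simp add: psi_def G_def g_eq)
qed

text \<open>The hypothesis on \<psi> is only an asymptotic expansion, so the second derivative is
  reached indirectly: F(\<tau> v) / \<tau>^2 tends to 2 Q(v), whereas a nonpositive second
  derivative would give F(\<tau> v) \<le> Q(v) \<tau>^2 for small \<tau> > 0.\<close>

lemma second_derivative_pos:
  assumes A: "second_order_form \<phi> \<xi> A" and v: "grad \<bullet> v = 0" "0 < quadform A v"
  shows "0 < frechet_derivative (\<lambda>q. frechet_derivative F (at q) (0, v)) (at 0) (0, v)"
proof (rule ccontr)
  define f where "f \<tau> = F (\<tau> *\<^sub>R (0, v))" for \<tau>
  define f' where "f' \<tau> = frechet_derivative F (at (\<tau> *\<^sub>R (0, v))) (0, v)" for \<tau>
  define D where "D = frechet_derivative (\<lambda>q. frechet_derivative F (at q) (0, v)) (at 0) (0, v)"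
  assume "\<not> 0 < frechet_derivative (\<lambda>q. frechet_derivative F (at q) (0, v)) (at 0) (0, v)"
  then have D: "D \<le> 0" by (simp add: D_def)
  let ?Q = "quadform A v"
  have v0: "v \<noteq> 0" using v(2) by (auto simp: quadform_def)
  obtain W where W: "0 \<in> W" "Ck_on 2 W F" using ex_Ck_G by blast
  then have F2: "Ck_on (Suc 1) W F" "open W" by (auto simp: numeral_2_eq_2)
  have f'0: "f' 0 = 0" by (simp add: f'_def frechet_F_0 zero_prod_def[symmetric])
  have f0: "f 0 = 0" by (simp add: f_def F_0 zero_prod_def[symmetric])
  have "continuous_on UNIV (\<lambda>\<tau>. \<tau> *\<^sub>R (0, v) :: (real^3) \<times> (real^3))" by (intro continuous_intros)
  then have "open ((\<lambda>\<tau>. \<tau> *\<^sub>R (0, v) :: (real^3) \<times> (real^3)) -` W)" using F2(2) open_vimage by blast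
  moreover have "0 \<in> (\<lambda>\<tau>. \<tau> *\<^sub>R (0, v) :: (real^3) \<times> (real^3)) -` W" using W by (simp add: zero_prod_def[symmetric])
  ultimately obtain e where e0: "e > 0" "ball 0 e \<subseteq> (\<lambda>\<tau>. \<tau> *\<^sub>R (0, v) :: (real^3) \<times> (real^3)) -` W"
    using openE by blast
  then have e: "e > 0" "\<And>\<tau>. \<bar>\<tau>\<bar> < e \<Longrightarrow> \<tau> *\<^sub>R (0, v) \<in> W" by (auto simp: subset_iff)
  have df: "(f has_real_derivative f' \<tau>) (at \<tau>)" if "\<bar>\<tau>\<bar> < e" for \<tau>
    using Ck_on_line_deriv_real[OF F2(1), of 0 \<tau> "(0, v)"] e(2)[OF that] by (simp add: f_def[abs_def] f'_def)
  have df': "(f' has_real_derivative D) (at 0)"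
    using Ck_on_line_deriv_real[OF Ck_on_directional[OF F2(1), unfolded One_nat_def], of 0 0 "(0, v)" "(0, v)"] W(1)
    by (simp add: f'_def[abs_def] D_def zero_prod_def[symmetric])
  \<comment> \<open>F = (1 - Re G)(1 + Re G) - (Im G)^2. The first factor is asymptotic to Q(v)
    \<tau>^2, the second tends to 2, and Im G = o(\<tau>) because \<open>v\<close> is orthogonal to
    \<open>grad\<close>.\<close>
  have lim_f: "((\<lambda>\<tau>. f \<tau> / \<tau>\<^sup>2) \<longlongrightarrow> 2 * ?Q) (at_right 0)"
  proof -
    have "((\<lambda>\<theta>. (Re (psi \<phi> \<xi> \<theta>) - (1 - quadform A \<theta>)) / (norm \<theta>)\<^sup>2) \<longlongrightarrow> 0) (at 0)"
      using A unfolding second_order_form_def by (intro smalloD_tendsto) simp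
    moreover have "filterlim (\<lambda>\<tau>. \<tau> *\<^sub>R v) (at 0) (at_right 0)"
      unfolding filterlim_at using v0
      by (auto intro!: tendsto_eq_intros simp: eventually_at_filter)
    ultimately have "((\<lambda>\<tau>. (Re (psi \<phi> \<xi> (\<tau> *\<^sub>R v)) - (1 - quadform A (\<tau> *\<^sub>R v))) / (norm (\<tau> *\<^sub>R v))\<^sup>2) \<longlongrightarrow> 0) (at_right 0)"
      by (rule filterlim_compose)
    then have "((\<lambda>\<tau>. ?Q - (norm v)\<^sup>2 * ((Re (psi \<phi> \<xi> (\<tau> *\<^sub>R v)) - (1 - quadform A (\<tau> *\<^sub>R v))) / (norm (\<tau> *\<^sub>R v))\<^sup>2)) \<longlongrightarrow> ?Q - (norm v)\<^sup>2 * 0) (at_right 0)"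
      by (intro tendsto_intros)
    moreover have "eventually (\<lambda>\<tau>. ?Q - (norm v)\<^sup>2 * ((Re (psi \<phi> \<xi> (\<tau> *\<^sub>R v)) - (1 - quadform A (\<tau> *\<^sub>R v))) / (norm (\<tau> *\<^sub>R v))\<^sup>2)
       = (1 - Re (G (0, \<tau> *\<^sub>R v))) / \<tau>\<^sup>2) (at_right 0)"
      using eventually_at_right_less[of 0]
      by eventually_elim (use v0 in \<open>simp add: psi_eq_G quadform_scale power_mult_distrib field_simps\<close>)
    ultimately have l1: "((\<lambda>\<tau>. (1 - Re (G (0, \<tau> *\<^sub>R v))) / \<tau>\<^sup>2) \<longlongrightarrow> ?Q) (at_right 0)"
      using tendsto_cong by fastforce
    have dre: "((\<lambda>\<tau>. Re (G (\<tau> *\<^sub>R (0, v)))) has_real_derivative - (grad \<bullet> 0)) (at 0)"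
      using has_real_derivative_along[OF has_derivative_Re[OF G_has_derivative], of "(0, v)"] by simp
    then have "isCont (\<lambda>\<tau>. Re (G (\<tau> *\<^sub>R (0, v)))) 0" by (rule DERIV_isCont)
    then have "((\<lambda>\<tau>. Re (G (0, \<tau> *\<^sub>R v))) \<longlongrightarrow> 1) (at 0)"
      by (simp add: isCont_def G_0 zero_prod_def[symmetric])
    then have l2: "((\<lambda>\<tau>. Re (G (0, \<tau> *\<^sub>R v))) \<longlongrightarrow> 1) (at_right 0)"
      by (rule filterlim_mono[OF _ order_refl at_le]) simp
    have "((\<lambda>\<tau>. Im (G (\<tau> *\<^sub>R (0, v)))) has_real_derivative 0) (at 0)"
      using has_real_derivative_along[OF has_derivative_Im[OF G_has_derivative], of "(0, v)"] v(1) by simp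
    then have "((\<lambda>\<tau>. Im (G (0, \<tau> *\<^sub>R v)) / \<tau>) \<longlongrightarrow> 0) (at 0)"
      by (simp add: has_field_derivative_iff G_0 zero_prod_def[symmetric])
    then have l3: "((\<lambda>\<tau>. Im (G (0, \<tau> *\<^sub>R v)) / \<tau>) \<longlongrightarrow> 0) (at_right 0)"
      by (rule filterlim_mono[OF _ order_refl at_le]) simp
    have "((\<lambda>\<tau>. (1 - Re (G (0, \<tau> *\<^sub>R v))) / \<tau>\<^sup>2 * (1 + Re (G (0, \<tau> *\<^sub>R v))) - (Im (G (0, \<tau> *\<^sub>R v)) / \<tau>)\<^sup>2)
        \<longlongrightarrow> ?Q * (1 + 1) - 0\<^sup>2) (at_right 0)"
      by (intro tendsto_intros l1 l2 l3)
    moreover have "f \<tau> / \<tau>\<^sup>2 = (1 - Re (G (0, \<tau> *\<^sub>R v))) / \<tau>\<^sup>2 * (1 + Re (G (0, \<tau> *\<^sub>R v))) - (Im (G (0, \<tau> *\<^sub>R v)) / \<tau>)\<^sup>2" for \<tau>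
      by (simp add: f_def F_def inner_complex_def power_divide power2_eq_square diff_divide_distrib[symmetric]) (simp add: algebra_simps)
    ultimately show ?thesis by (simp add: mult.commute)
  qed
  have "((\<lambda>\<tau>. f' \<tau> / \<tau>) \<longlongrightarrow> D) (at 0)"
    using df' f'0 by (simp add: has_field_derivative_iff)
  then have "((\<lambda>\<tau>. f' \<tau> / \<tau>) \<longlongrightarrow> D) (at_right 0)"
    by (rule filterlim_mono[OF _ order_refl at_le]) simp
  \<comment> \<open>Any threshold strictly between 0 and 2 Q(v) would serve: it exceeds the limit
    \<open>D\<close> and still contradicts \<open>lim_f\<close> after one application of the mean
    value theorem.\<close>
  then have "eventually (\<lambda>\<tau>. f' \<tau> / \<tau> < ?Q) (at_right 0)"
    by (rule order_tendstoD(2)) (use D v(2) in simp)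
  then obtain b where b: "b > 0" "\<And>\<tau>. 0 < \<tau> \<Longrightarrow> \<tau> < b \<Longrightarrow> f' \<tau> / \<tau> < ?Q"
    unfolding eventually_at_right_field by auto
  have "eventually (\<lambda>\<tau>. f \<tau> / \<tau>\<^sup>2 \<le> ?Q) (at_right 0)"
    unfolding eventually_at_right_field
  proof (intro exI[of _ "min b e"] conjI allI impI)
    fix \<tau> assume \<tau>: "0 < \<tau>" "\<tau> < min b e"
    have "\<exists>z>0. z < \<tau> \<and> f \<tau> - f 0 = (\<tau> - 0) * f' z"
      using \<tau> df by (intro MVT2) auto
    then obtain z where z: "0 < z" "z < \<tau>" "f \<tau> = \<tau> * f' z" using f0 by auto
    have "f' z < ?Q * z" using b(2)[of z] z \<tau> by (simp add: pos_divide_less_eq)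
    also have "\<dots> \<le> ?Q * \<tau>" using z v(2) by simp
    finally have "\<tau> * f' z \<le> \<tau> * (?Q * \<tau>)" using \<tau> by (intro mult_left_mono) auto
    then have "f \<tau> \<le> ?Q * \<tau>\<^sup>2" using z(3) by (simp add: power2_eq_square mult_ac)
    then show "f \<tau> / \<tau>\<^sup>2 \<le> ?Q" using \<tau> by (simp add: pos_divide_le_eq)
  qed (use b e in auto)
  then have "2 * ?Q \<le> ?Q" using lim_f by (intro tendsto_upperbound) auto
  then show False using v(2) by simp
qed

end

section \<open>The sublevel estimates\<close>

text \<open>The quadratic majorant f(0) + f'(0) \<tau> + M \<tau>^2 / 2 is nonnegative wherever
  \<open>f\<close> is; at its minimiser \<tau> = -f'(0) / M this is the claim. Hypothesis
  \<open>small\<close> keeps the minimiser inside the interval.\<close>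

lemma glaeser_inequality:
  fixes f :: "real \<Rightarrow> real"
  assumes "0 < s0" "0 < M"
    and f: "\<And>\<tau>. \<bar>\<tau>\<bar> \<le> s0 \<Longrightarrow> (f has_real_derivative f' \<tau>) (at \<tau>)"
    and f': "\<And>\<tau>. \<bar>\<tau>\<bar> \<le> s0 \<Longrightarrow> (f' has_real_derivative f'' \<tau>) (at \<tau>)"
    and f'': "\<And>\<tau>. \<bar>\<tau>\<bar> \<le> s0 \<Longrightarrow> f'' \<tau> \<le> M"
    and nonneg: "\<And>\<tau>. \<bar>\<tau>\<bar> \<le> s0 \<Longrightarrow> 0 \<le> f \<tau>"
    and small: "\<bar>f' 0\<bar> \<le> M * s0"
  shows "(f' 0)\<^sup>2 \<le> 2 * M * f 0"
proof (cases "f' 0 = 0")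
  case True
  then show ?thesis using assms by simp
next
  case False
  define \<tau> where "\<tau> = - f' 0 / M"
  have \<tau>: "\<bar>\<tau>\<bar> \<le> s0" "\<tau> \<noteq> 0"
    using small False \<open>0 < M\<close> by (auto simp: \<tau>_def abs_divide pos_divide_le_eq mult.commute)
  let ?d = "\<lambda>m::nat. if m = 0 then f else if m = 1 then f' else f''"
  have "\<exists>t. (if \<tau> < 0 then \<tau> < t \<and> t < 0 else 0 < t \<and> t < \<tau>) \<and>
     f \<tau> = (\<Sum>m<2. (?d m 0 / fact m) * (\<tau> - 0)^m) + (?d 2 t / fact 2) * (\<tau> - 0)^2"
    by (rule Taylor[of 2 ?d f "-s0" s0]) (use \<tau> f f' assms(1) in \<open>auto simp: less_2_cases_iff abs_le_iff\<close>)
  then obtain t where t0: "if \<tau> < 0 then \<tau> < t \<and> t < 0 else 0 < t \<and> t < \<tau>"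
    "f \<tau> = (\<Sum>m<2. (?d m 0 / fact m) * (\<tau> - 0)^m) + (?d 2 t / fact 2) * (\<tau> - 0)^2" by blast
  have t: "\<bar>t\<bar> \<le> s0" "f \<tau> = f 0 + f' 0 * \<tau> + f'' t / 2 * \<tau>\<^sup>2"
  proof -
    show "\<bar>t\<bar> \<le> s0" using t0(1) \<tau>(1) by (simp split: if_splits)
    show "f \<tau> = f 0 + f' 0 * \<tau> + f'' t / 2 * \<tau>\<^sup>2" using t0(2) by (simp add: numeral_2_eq_2)
  qed
  have "f'' t / 2 * \<tau>\<^sup>2 \<le> M / 2 * \<tau>\<^sup>2"
    using f''[OF t(1)] by (intro mult_right_mono) auto
  then have "0 \<le> f 0 + f' 0 * \<tau> + M / 2 * \<tau>\<^sup>2"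
    using nonneg[OF \<tau>(1)] t(2) by linarith
  also have "\<dots> = f 0 - (f' 0)\<^sup>2 / (2 * M)"
    using \<open>0 < M\<close> by (simp add: \<tau>_def field_simps power2_eq_square)
  finally show ?thesis using \<open>0 < M\<close> by (simp add: pos_divide_le_eq mult.commute)
qed

lemma chart_dom_mono: "r \<le> r' \<Longrightarrow> chart_dom r \<subseteq> chart_dom r'"
  unfolding chart_dom_def by (rule Collect_mono) (blast intro: less_le_trans)

lemma norm_chart_dom: "q \<in> chart_dom r \<Longrightarrow> norm q < 6 * r"
  using norm_Pair_cart3_less[of "fst q" r "snd q"] by (simp add: chart_dom_def abs_of_pos)

text \<open>The maximum ranges over dimensions at most 3 and includes that of the zero subspace, so
  it is over a finite nonempty set.\<close>

lemma pos_index_attained: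
  "\<exists>V. subspace V \<and> dim V = pos_index A \<and> (\<forall>x\<in>V. x \<noteq> 0 \<longrightarrow> quadform A x > 0)"
proof -
  let ?X = "{dim V | V. subspace V \<and> (\<forall>x\<in>V. x \<noteq> 0 \<longrightarrow> quadform A x > 0)}"
  have "?X \<subseteq> {..3}" using dim_subset_UNIV_cart[where 'n = 3] by force
  then have "finite ?X" by (rule finite_subset) simp
  moreover have "dim {0 :: real^3} \<in> ?X" by (auto intro!: exI[of _ "{0}"])
  ultimately have "Max ?X \<in> ?X" by (intro Max_in) auto
  then show ?thesis unfolding pos_index_def by auto
qed

text \<open>A positive subspace of dimension at least 2 and the plane orthogonal to \<open>a\<close>
  meet nontrivially in a space of dimension 3.\<close>

lemma quadform_pos_on_hyperplane:
  assumes "2 \<le> pos_index A" "a \<noteq> 0"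
  shows "\<exists>v. a \<bullet> v = 0 \<and> 0 < quadform A v"
proof -
  obtain V where V: "subspace V" "2 \<le> dim V" "\<And>x. x \<in> V \<Longrightarrow> x \<noteq> 0 \<Longrightarrow> quadform A x > 0"
    using pos_index_attained[of A] assms(1) by auto
  let ?H = "{x. a \<bullet> x = 0}"
  have "dim {x + y |x y. x \<in> V \<and> y \<in> ?H} + dim (V \<inter> ?H) = dim V + dim ?H"
    by (rule dim_sums_Int[OF V(1) subspace_hyperplane])
  moreover have "dim {x + y |x y. x \<in> V \<and> y \<in> ?H} \<le> 3"
    using dim_subset_UNIV_cart[where 'n = 3] by force
  moreover have "dim ?H = 2" using dim_hyperplane[OF assms(2)] by simp
  ultimately have "dim (V \<inter> ?H) \<noteq> 0" using V(2) by linarith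
  then have "\<not> V \<inter> ?H \<subseteq> {0}" by (simp only: dim_eq_0 not_False_eq_True)
  then obtain v where "v \<in> V" "v \<in> ?H" "v \<noteq> 0" by blast
  then show ?thesis using V(3)[of v] by (intro exI[of _ v]) simp
qed

lemma quadform_pos_of_index_3:
  assumes "pos_index A = 3" "v \<noteq> 0"
  shows "0 < quadform A v"
proof -
  obtain V where V: "subspace V" "dim V = 3" "\<And>x. x \<in> V \<Longrightarrow> x \<noteq> 0 \<Longrightarrow> quadform A x > 0"
    using pos_index_attained[of A] assms(1) by auto
  have "span V = UNIV" by (rule dim_eq_full[THEN iffD1]) (simp add: V(2))
  then have "V = UNIV" using V(1) by (metis span_eq_iff)
  then show ?thesis using V(3) assms(2) by simp
qed

definition fibre_grad :: "((real^3) \<times> (real^3) \<Rightarrow> real) \<Rightarrow> real^3" where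
  "fibre_grad p = (\<chi> j. frechet_derivative p (at 0) (0, axis j 1))"

lemma fibre_grad_inner:
  assumes "Ck_on 1 W p" "0 \<in> W"
  shows "fibre_grad p \<bullet> h = frechet_derivative p (at 0) (0, h)"
proof -
  have D: "linear (frechet_derivative p (at 0))"
    using Ck_on_has_derivative[of 0 W p 0] assms by (auto intro: has_derivative_linear)
  have L: "linear (\<lambda>h. frechet_derivative p (at 0) (0, h))"
    by (intro linearI) (use linear_add[OF D, of "(0, _)" "(0, _)"] linear_scale[OF D, of _ "(0, _)"] in auto)
  have "h = (\<Sum>j\<in>UNIV. h $ j *\<^sub>R axis j 1)"
    using basis_expansion[of h] by (simp add: scalar_mult_eq_scaleR)
  then have "frechet_derivative p (at 0) (0, h) = frechet_derivative p (at 0) (0, \<Sum>j\<in>UNIV. h $ j *\<^sub>R axis j 1)" by simp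
  also have "\<dots> = (\<Sum>j\<in>UNIV. h $ j * frechet_derivative p (at 0) (0, axis j 1))"
    by (simp add: linear_sum[OF L] linear_scale[OF L])
  finally show ?thesis by (simp add: inner_vec_def fibre_grad_def mult.commute)
qed

text \<open>The triple product of the fibre gradients is the Jacobian determinant at the origin.
  Intervals are given by centre and half-length, which produces the factor 8; for nonempty
  \<open>E\<close> the membership in \<open>chart_dom r\<close> already makes \<open>t\<close>
  small.\<close>

lemma three_function_bound:
  assumes p: "Ck_on 1 W1 p1" "Ck_on 1 W2 p2" "Ck_on 1 W3 p3" "0 \<in> W1" "0 \<in> W2" "0 \<in> W3"
    and ind: "cross3 (fibre_grad p1) (fibre_grad p2) \<bullet> fibre_grad p3 \<noteq> 0"
  shows "\<exists>r>0. \<exists>K>0. \<forall>t E c1 c2 c3 d1 d2 d3. E \<in> sets borel \<longrightarrow> 0 \<le> d1 \<longrightarrow> 0 \<le> d2 \<longrightarrow> 0 \<le> d3 \<longrightarrow>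
     (\<forall>\<theta>\<in>E. (t, \<theta>) \<in> chart_dom r \<and> \<bar>p1 (t, \<theta>) - c1\<bar> \<le> d1 \<and> \<bar>p2 (t, \<theta>) - c2\<bar> \<le> d2 \<and> \<bar>p3 (t, \<theta>) - c3\<bar> \<le> d3) \<longrightarrow>
     emeasure lborel E \<le> ennreal (K * (d1 * d2 * d3))"
proof -
  let ?W = "W1 \<inter> W2 \<inter> W3"
  define p where "p i = (if i = 1 then p1 else if i = 2 then p2 else p3)" for i :: 3
  have n: "(2 :: 3) \<noteq> 1" "(3 :: 3) \<noteq> 1" "(3 :: 3) \<noteq> 2" by simp_all
  have pp: "p 1 = p1" "p 2 = p2" "p 3 = p3" using n by (auto simp: p_def)
  have W: "open ?W" using p(1-3) Ck_on_open by blast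
  have m: "Ck_on 1 ?W p1" "Ck_on 1 ?W p2" "Ck_on 1 ?W p3"
    by (rule Ck_on_mono[OF p(1) W], blast) (rule Ck_on_mono[OF p(2) W], blast, rule Ck_on_mono[OF p(3) W], blast)
  have "Ck_on 1 ?W (p i)" for i
    using exhaust_3[of i] by (elim disjE) (simp_all only: pp m)
  moreover have "0 \<in> ?W" using p by simp
  moreover have "det (\<chi> i j. frechet_derivative (p i) (at 0) (0, axis j 1)) = cross3 (fibre_grad p1) (fibre_grad p2) \<bullet> fibre_grad p3"
    unfolding det_3 by (simp add: pp cross3_def inner_vec_def sum_3 fibre_grad_def algebra_simps)
  then have "det (\<chi> i j. frechet_derivative (p i) (at 0) (0, axis j 1)) \<noteq> 0" using ind by simp
  ultimately obtain r K where r: "r > 0" "K > 0" and b: "\<And>t E l u. (\<forall>k. \<bar>t $ k\<bar> < r) \<Longrightarrow> E \<in> sets borel \<Longrightarrow> (\<forall>i. l i \<le> u i) \<Longrightarrow>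
     (\<forall>\<theta>\<in>E. (\<forall>k. \<bar>\<theta> $ k\<bar> < r) \<and> (\<forall>i. l i \<le> p i (t, \<theta>) \<and> p i (t, \<theta>) \<le> u i)) \<Longrightarrow>
     emeasure lborel E \<le> ennreal (K * (\<Prod>i\<in>UNIV. u i - l i))"
    using fibre_measure_bound[of ?W p] by blast
  have "emeasure lborel E \<le> ennreal (8 * K * (d1 * d2 * d3))"
    if E: "E \<in> sets borel" and d123: "0 \<le> d1" "0 \<le> d2" "0 \<le> d3"
     and h: "\<forall>\<theta>\<in>E. (t, \<theta>) \<in> chart_dom r \<and> \<bar>p1 (t, \<theta>) - c1\<bar> \<le> d1 \<and> \<bar>p2 (t, \<theta>) - c2\<bar> \<le> d2 \<and> \<bar>p3 (t, \<theta>) - c3\<bar> \<le> d3"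
    for t E c1 c2 c3 d1 d2 d3
  proof (cases "E = {}")
    case False
    define c where "c i = (if i = 1 then c1 else if i = 2 then c2 else c3)" for i :: 3
    define d where "d i = (if i = 1 then d1 else if i = 2 then d2 else d3)" for i :: 3
    have cd: "c 1 = c1" "c 2 = c2" "c 3 = c3" "d 1 = d1" "d 2 = d2" "d 3 = d3"
      using n by (auto simp: c_def d_def)
    obtain \<theta> where "(t, \<theta>) \<in> chart_dom r" using False h by blast
    then have t: "\<forall>k. \<bar>t $ k\<bar> < r" by (simp add: chart_dom_def abs_of_pos)
    have "emeasure lborel E \<le> ennreal (K * (\<Prod>i\<in>UNIV. (c i + d i) - (c i - d i)))"
    proof (rule b[OF t E, where l = "\<lambda>i. c i - d i" and u = "\<lambda>i. c i + d i"])
      show "\<forall>i. c i - d i \<le> c i + d i" by (simp add: forall_3 cd d123)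
      show "\<forall>\<theta>\<in>E. (\<forall>k. \<bar>\<theta> $ k\<bar> < r) \<and> (\<forall>i. c i - d i \<le> p i (t, \<theta>) \<and> p i (t, \<theta>) \<le> c i + d i)"
      proof (intro ballI conjI allI)
        fix \<theta> assume "\<theta> \<in> E"
        note h\<theta> = h[rule_format, OF this]
        show "\<bar>\<theta> $ k\<bar> < r" for k using h\<theta> by (simp add: chart_dom_def)
        have "\<forall>i. \<bar>p i (t, \<theta>) - c i\<bar> \<le> d i" using h\<theta> by (simp add: forall_3 pp cd)
        then have "\<bar>p i (t, \<theta>) - c i\<bar> \<le> d i" for i by blast
        then show "c i - d i \<le> p i (t, \<theta>)" "p i (t, \<theta>) \<le> c i + d i" for i
          unfolding abs_le_iff by (smt (verit))+
      qed
    qed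
    also have "(\<Prod>i\<in>UNIV. (c i + d i) - (c i - d i)) = (\<Prod>i\<in>UNIV. 2 * d i)"
      by (intro prod.cong) auto
    also have "\<dots> = 2 * d 1 * (2 * d 2 * (2 * d 3))"
      unfolding UNIV_3 by simp
    also have "K * \<dots> = 8 * K * (d1 * d2 * d3)"
      unfolding cd by (simp only: mult_ac)
    finally show ?thesis .
  qed simp
  moreover have "0 < 8 * K" using r by simp
  ultimately show ?thesis using r(1) by blast
qed

text \<open>Applied with exponent \<open>\<beta> + 1\<close>, this replaces \<beta>-dependent
  constants by one that serves all \<beta> at once.\<close>

lemma powr_le_max_1: "0 < x \<Longrightarrow> 0 \<le> a \<Longrightarrow> a \<le> 1 \<Longrightarrow> x powr a \<le> max 1 x" for x a :: real
proof (cases "x \<le> 1")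
  case True
  assume "0 < x" "0 \<le> a"
  then have "x powr a \<le> 1" using True by (intro powr_le1) auto
  then show ?thesis by simp
next
  case False
  assume "a \<le> 1"
  then have "x powr a \<le> x powr 1" using False by (intro powr_mono) auto
  then show ?thesis using False by simp
qed

section \<open>Growth of the defect and control of its directional derivative\<close>

context torus_contact
begin

lemma F_ge_fst:
  assumes "0 < grad $ i"
  shows "\<exists>r>0. \<forall>q\<in>chart_dom r. grad $ i * fst q $ i \<le> F q"
proof -
  obtain W where W: "0 \<in> W" "Ck_on 2 W F" using ex_Ck_G by blast
  then have F2: "Ck_on (Suc 1) W F" "open W" by (auto simp: numeral_2_eq_2)
  define v where "v = (axis i 1 :: real^3, 0 :: real^3)"
  have "((\<lambda>q. frechet_derivative F (at q) v) \<longlongrightarrow> 2 * grad $ i) (at 0)"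
    using Ck_on_isCont_directional[OF F2(1) W(1), of v] by (simp add: isCont_def frechet_F_0 v_def inner_axis)
  then have "eventually (\<lambda>q. grad $ i < frechet_derivative F (at q) v) (at 0)"
    by (rule order_tendstoD(1)) (use assms in simp)
  moreover have "grad $ i < frechet_derivative F (at 0) v"
    using assms by (simp add: frechet_F_0 v_def inner_axis)
  ultimately have "eventually (\<lambda>q. grad $ i < frechet_derivative F (at q) v) (nhds 0)"
    by (simp add: eventually_nhds_conv_at)
  moreover have "eventually (\<lambda>q. q \<in> W) (nhds 0)" using F2(2) W(1) by (rule eventually_nhds_in_open)
  ultimately have "eventually (\<lambda>q. q \<in> W \<and> grad $ i < frechet_derivative F (at q) v) (nhds 0)"
    by (rule eventually_conj[rotated])
  then obtain d where d: "d > 0" "\<And>q. norm q < d \<Longrightarrow> q \<in> W \<and> grad $ i < frechet_derivative F (at q) v"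
    unfolding eventually_nhds_metric by auto
  define r where "r = min d 1 / 6"
  have r: "0 < r" "6 * r \<le> d" "r \<le> 1/2" using d(1) by (auto simp: r_def)
  have "grad $ i * fst q $ i \<le> F q" if q: "q \<in> chart_dom r" for q
  proof -
    let ?t = "fst q $ i"
    \<comment> \<open>The base point on the face t_i = 0, where \<open>F\<close> is still
      nonnegative. From there to \<open>q\<close> only t_i increases, and \<open>F\<close> grows at
      rate above \<open>grad $ i\<close>, half of the derivative at the origin.\<close>
    define b where "b = q - ?t *\<^sub>R v"
    have t: "0 < ?t" "?t < r" using q by (auto simp: chart_dom_def)
    have fstk: "fst (b + \<tau> *\<^sub>R v) $ k = (if k = i then \<tau> else fst q $ k)" for \<tau> k
      by (simp add: b_def v_def axis_def)
    have sndk: "snd (b + \<tau> *\<^sub>R v) $ k = snd q $ k" for \<tau> k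
      by (simp add: b_def v_def)
    have nd: "norm (b + \<tau> *\<^sub>R v) < d" if "0 \<le> \<tau>" "\<tau> \<le> ?t" for \<tau>
    proof -
      have "norm (fst (b + \<tau> *\<^sub>R v), snd (b + \<tau> *\<^sub>R v)) < 6 * r"
      proof (rule norm_Pair_cart3_less)
        fix k
        have "0 < fst q $ k" "fst q $ k < r" "\<bar>snd q $ k\<bar> < r" using q by (auto simp: chart_dom_def)
        then show "\<bar>fst (b + \<tau> *\<^sub>R v) $ k\<bar> < r" "\<bar>snd (b + \<tau> *\<^sub>R v) $ k\<bar> < r"
          using that t unfolding fstk sndk by auto
      qed
      then show ?thesis using r(2) unfolding prod.collapse by linarith
    qed
    have "0 \<le> F (b + 0 *\<^sub>R v)"
    proof (rule F_nonneg)
      fix k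
      have "0 < fst q $ k" "fst q $ k < r" "\<bar>snd q $ k\<bar> < r" using q by (auto simp: chart_dom_def)
      then show "0 \<le> fst (b + 0 *\<^sub>R v) $ k \<and> fst (b + 0 *\<^sub>R v) $ k \<le> 1/2 \<and> \<bar>snd (b + 0 *\<^sub>R v) $ k\<bar> \<le> 1/2"
        using r(3) unfolding fstk sndk by auto
    qed
    have "\<exists>z>0. z < ?t \<and> F (b + ?t *\<^sub>R v) - F (b + 0 *\<^sub>R v) = (?t - 0) * frechet_derivative F (at (b + z *\<^sub>R v)) v"
      by (rule MVT2) (use t nd d(2) Ck_on_line_deriv_real[OF F2(1)] in auto)
    then obtain z where z: "0 < z" "z < ?t" "F q - F (b + 0 *\<^sub>R v) = ?t * frechet_derivative F (at (b + z *\<^sub>R v)) v"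
      by (auto simp: b_def)
    have "?t * grad $ i \<le> ?t * frechet_derivative F (at (b + z *\<^sub>R v)) v"
      using t d(2)[OF nd[of z]] z by (intro mult_left_mono) auto
    then have "?t * grad $ i \<le> F q" using z(3) \<open>0 \<le> F (b + 0 *\<^sub>R v)\<close> by linarith
    then show ?thesis by (simp add: mult.commute)
  qed
  then show ?thesis using r(1) by blast
qed

lemma directional_derivative_bound:
  "\<exists>r>0. \<exists>M>0. \<forall>q\<in>chart_dom r. (frechet_derivative F (at q) (0, v))\<^sup>2 \<le> M * F q"
proof -
  obtain W where W: "0 \<in> W" "Ck_on 2 W F" using ex_Ck_G by blast
  then have F2: "Ck_on (Suc 1) W F" "open W" by (auto simp: numeral_2_eq_2)
  define D1 where "D1 q = frechet_derivative F (at q) (0, v)" for q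
  define D2 where "D2 q = frechet_derivative D1 (at q) (0, v)" for q
  have CD1: "Ck_on (Suc 0) W D1" using Ck_on_directional[OF F2(1)] by (simp add: D1_def[abs_def])
  define B where "B = max (\<bar>D1 0\<bar>) (\<bar>D2 0\<bar>) + 1"
  have ev: "eventually (\<lambda>q. \<bar>f q\<bar> < B) (nhds 0)" if "isCont f 0" "\<bar>f 0\<bar> < B" for f :: "(real^3) \<times> (real^3) \<Rightarrow> real"
  proof -
    have "((\<lambda>q. \<bar>f q\<bar>) \<longlongrightarrow> \<bar>f 0\<bar>) (at 0)" using that(1) by (intro tendsto_rabs) (simp add: isCont_def)
    from order_tendstoD(2)[OF this that(2)] that(2) show ?thesis by (simp add: eventually_nhds_conv_at)
  qed
  have "eventually (\<lambda>q. \<bar>D1 q\<bar> < B) (nhds 0)"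
    by (rule ev) (use Ck_on_isCont_directional[OF F2(1) W(1)] in \<open>auto simp: D1_def[abs_def] B_def\<close>)
  moreover have "eventually (\<lambda>q. \<bar>D2 q\<bar> < B) (nhds 0)"
    by (rule ev) (use Ck_on_isCont_directional[OF CD1 W(1)] in \<open>auto simp: D2_def[abs_def] B_def\<close>)
  moreover have "eventually (\<lambda>q. q \<in> W) (nhds 0)" using F2(2) W(1) by (rule eventually_nhds_in_open)
  ultimately have "eventually (\<lambda>q. q \<in> W \<and> \<bar>D1 q\<bar> < B \<and> \<bar>D2 q\<bar> < B) (nhds 0)"
    by eventually_elim simp
  then obtain d0 where d0: "d0 > 0" "\<And>q. norm q < d0 \<Longrightarrow> q \<in> W \<and> \<bar>D1 q\<bar> < B \<and> \<bar>D2 q\<bar> < B"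
    unfolding eventually_nhds_metric by auto
  define d where "d = min d0 (1/2)"
  have d: "0 < d" "d \<le> 1/2" "\<And>q. norm q < d \<Longrightarrow> q \<in> W \<and> \<bar>D1 q\<bar> < B \<and> \<bar>D2 q\<bar> < B"
    using d0 by (auto simp: d_def)
  \<comment> \<open>Chart points then have norm below d/2, and \<open>s0\<close> keeps the
    displacement along \<open>v\<close> within another d/2, so the whole segment stays where the
    bounds hold.\<close>
  define r where "r = d / 12"
  define s0 where "s0 = d / 2 / (norm v + 1)"
  have nv: "0 < norm v + 1" using norm_ge_zero[of v] by linarith
  then have s0: "0 < s0" using d(1) by (simp add: s0_def)
  have s0v: "s0 * norm v \<le> d / 2"
    using d(1) nv by (simp add: s0_def pos_divide_le_eq)
  have B: "0 < B" by (simp add: B_def)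
  \<comment> \<open>Besides bounding the second derivative, \<open>M\<close> must satisfy B \<le> M
    * s0, the smallness condition of \<open>glaeser_inequality\<close> on the first
    derivative.\<close>
  define M where "M = max B (B / s0)"
  have M: "0 < M" "B \<le> M" "B \<le> M * s0"
  proof -
    have "B / s0 \<le> M" by (simp add: M_def)
    then show "B \<le> M * s0" using s0 by (simp add: pos_divide_le_eq)
  qed (use B in \<open>auto simp: M_def\<close>)
  have "(D1 q)\<^sup>2 \<le> 2 * M * F q" if q: "q \<in> chart_dom r" for q
  proof -
    have nq: "norm q < d / 2" using norm_chart_dom[OF q] by (simp add: r_def)
    have tv: "\<bar>\<tau>\<bar> * norm v \<le> d / 2" if "\<bar>\<tau>\<bar> \<le> s0" for \<tau>
      using mult_right_mono[OF that, of "norm v"] s0v by simp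
    have nd: "norm (q + \<tau> *\<^sub>R (0, v)) < d" if "\<bar>\<tau>\<bar> \<le> s0" for \<tau>
    proof -
      have "norm (\<tau> *\<^sub>R (0 :: real^3, v)) \<le> d / 2" using tv[OF that] by (simp add: norm_Pair)
      then show ?thesis using norm_triangle_ineq[of q "\<tau> *\<^sub>R (0, v)"] nq by linarith
    qed
    have "(D1 (q + 0 *\<^sub>R (0, v)))\<^sup>2 \<le> 2 * M * F (q + 0 *\<^sub>R (0, v))"
    proof (rule glaeser_inequality[OF s0 M(1), of "\<lambda>\<tau>. F (q + \<tau> *\<^sub>R (0, v))" "\<lambda>\<tau>. D1 (q + \<tau> *\<^sub>R (0, v))" "\<lambda>\<tau>. D2 (q + \<tau> *\<^sub>R (0, v))"])
      fix \<tau> assume \<tau>: "\<bar>\<tau>\<bar> \<le> s0"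
      note in_d = d(3)[OF nd[OF \<tau>]]
      show "((\<lambda>\<tau>. F (q + \<tau> *\<^sub>R (0, v))) has_real_derivative D1 (q + \<tau> *\<^sub>R (0, v))) (at \<tau>)"
        unfolding D1_def by (rule Ck_on_line_deriv_real[OF F2(1)]) (use in_d in simp)
      show "((\<lambda>\<tau>. D1 (q + \<tau> *\<^sub>R (0, v))) has_real_derivative D2 (q + \<tau> *\<^sub>R (0, v))) (at \<tau>)"
        unfolding D2_def by (rule Ck_on_line_deriv_real[OF CD1]) (use in_d in simp)
      show "D2 (q + \<tau> *\<^sub>R (0, v)) \<le> M" using in_d M by linarith
      show "0 \<le> F (q + \<tau> *\<^sub>R (0, v))"
      proof (rule F_nonneg)
        fix k
        have "\<bar>\<tau> * v $ k\<bar> \<le> \<bar>\<tau>\<bar> * norm v"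
          unfolding abs_mult by (intro mult_left_mono component_le_norm_cart) simp
        then have "\<bar>\<tau> * v $ k\<bar> \<le> 1/4" using tv[OF \<tau>] d(2) by linarith
        moreover have "0 < fst q $ k" "fst q $ k < r" "\<bar>snd q $ k\<bar> < r" "r \<le> 1/4"
          using q d(2) by (auto simp: chart_dom_def r_def)
        moreover from this have "\<bar>snd q $ k + \<tau> * v $ k\<bar> \<le> 1/2"
          using \<open>\<bar>\<tau> * v $ k\<bar> \<le> 1/4\<close> abs_triangle_ineq[of "snd q $ k" "\<tau> * v $ k"] by linarith
        ultimately show "0 \<le> fst (q + \<tau> *\<^sub>R (0, v)) $ k \<and> fst (q + \<tau> *\<^sub>R (0, v)) $ k \<le> 1 / 2 \<and> \<bar>snd (q + \<tau> *\<^sub>R (0, v)) $ k\<bar> \<le> 1 / 2"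
          by simp
      qed
    next
      show "\<bar>D1 (q + 0 *\<^sub>R (0, v))\<bar> \<le> M * s0"
        using d(3)[OF nd[of 0]] s0 M(3) by simp
    qed
    then show ?thesis by (simp add: zero_prod_def[symmetric])
  qed
  moreover have "0 < r" "0 < 2 * M" using d(1) M(1) by (auto simp: r_def)
  ultimately show ?thesis unfolding D1_def by blast
qed

text \<open>Multiplication by the unimodular number \<open>cnj (\<phi> \<xi>)\<close> preserves
  distances. As \<eta> lies on the circle, 1 - |G| \<le> \<delta>, and F = (1 - |G|)(1 + |G|) is at
  most twice that.\<close>

lemma near_unimodular:
  assumes "tcoord \<xi> q \<in> polydisc" "norm (\<phi> (tcoord \<xi> q) - \<eta>) < \<delta>" "norm \<eta> = 1"
  shows "\<bar>Im (G q) - Im (cnj (\<phi> \<xi>) * \<eta>)\<bar> \<le> \<delta>" and "F q \<le> 2 * \<delta>"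
proof -
  have cl: "tcoord \<xi> q \<in> closed_polydisc"
    using assms(1) by (auto simp: polydisc_def closed_polydisc_def less_imp_le)
  have G: "G q = cnj (\<phi> \<xi>) * \<phi> (tcoord \<xi> q)" by (simp add: G_def g_eq[OF cl])
  have "norm (G q - cnj (\<phi> \<xi>) * \<eta>) = norm (\<phi> (tcoord \<xi> q) - \<eta>)"
    unfolding G right_diff_distrib[symmetric] using unim by (simp add: norm_mult)
  then show "\<bar>Im (G q) - Im (cnj (\<phi> \<xi>) * \<eta>)\<bar> \<le> \<delta>"
    using abs_Im_le_cmod[of "G q - cnj (\<phi> \<xi>) * \<eta>"] assms(2) by simp
  have n: "norm (G q) \<le> 1" by (rule norm_G_le[OF cl])
  have "norm (G q) = norm (\<phi> (tcoord \<xi> q))" unfolding G using unim by (simp add: norm_mult)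
  then have "1 - norm (G q) \<le> \<delta>"
    using norm_triangle_ineq2[of \<eta> "\<phi> (tcoord \<xi> q)"] assms(2,3) by (simp add: norm_minus_commute)
  moreover have "F q = (1 - norm (G q)) * (1 + norm (G q))"
    by (simp add: F_eq power2_eq_square algebra_simps)
  then have "F q \<le> (1 - norm (G q)) * 2" using n by (simp only:) (intro mult_left_mono, auto)
  ultimately show "F q \<le> 2 * \<delta>" using mult_right_mono[of "1 - norm (G q)" \<delta> 2] by (simp add: mult.commute)
qed

lemma ex_Ck_on_1:
  "\<exists>W. 0 \<in> W \<and> Ck_on 1 W (\<lambda>q. Im (G q)) \<and> Ck_on 1 W (\<lambda>q. frechet_derivative F (at q) (0, v))"
proof -
  obtain W where W: "0 \<in> W" "Ck_on (Suc 1) W G" "Ck_on (Suc 1) W F"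
    using ex_Ck_G by (metis Suc_1)
  then show ?thesis
    using Ck_on_linear_compose[OF bounded_linear_Im Ck_on_SucD[OF W(2)]] Ck_on_directional[OF W(3)] by blast
qed

lemma fibre_grad_ImG: "fibre_grad (\<lambda>q. Im (G q)) = grad"
  by (simp add: fibre_grad_def frechet_ImG_0 inner_axis vec_eq_iff)

lemma fibre_grad_dF_inner:
  assumes "second_order_form \<phi> \<xi> A" "grad \<bullet> v = 0" "0 < quadform A v"
  shows "0 < fibre_grad (\<lambda>q. frechet_derivative F (at q) (0, v)) \<bullet> v"
proof -
  obtain W where "0 \<in> W" "Ck_on 1 W (\<lambda>q. frechet_derivative F (at q) (0, v))"
    using ex_Ck_on_1[of v] by blast
  from fibre_grad_inner[OF this(2,1)] show ?thesis using second_derivative_pos[OF assms] by simp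
qed

lemma continuous_on_\<phi>: "continuous_on polydisc \<phi>"
proof (rule continuous_at_imp_continuous_on, rule ballI)
  fix z assume "z \<in> polydisc"
  then obtain L where "(\<phi> has_derivative L) (at z)" using holo unfolding holo_on_def by blast
  then show "isCont \<phi> z" by (rule has_derivative_continuous)
qed

lemma open_sublevel: "open {z \<in> polydisc \<inter> U. norm (\<phi> z - \<eta>) < \<delta>}" if "open U"
proof -
  have "open (polydisc \<inter> \<phi> -` ball \<eta> \<delta>)"
    by (rule continuous_open_preimage[OF continuous_on_\<phi> open_polydisc open_ball])
  then have "open (U \<inter> (polydisc \<inter> \<phi> -` ball \<eta> \<delta>))" using that by (rule open_Int[rotated])
  moreover have "{z \<in> polydisc \<inter> U. norm (\<phi> z - \<eta>) < \<delta>} = U \<inter> (polydisc \<inter> \<phi> -` ball \<eta> \<delta>)"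
    by (auto simp: dist_norm norm_minus_commute)
  ultimately show ?thesis by simp
qed

end

text \<open>Outside the box prescribed by \<tau> the fibres of \<open>S\<close> are empty, so one
  bound on all fibres and a pointwise bound on \<open>t\<close> over \<open>S\<close>
  suffice.\<close>

lemma Vbeta_le_two_scales:
  assumes \<xi>: "\<xi> \<in> torus3" and \<rho>: "0 < \<rho>" "\<rho> \<le> 1/2" and \<beta>: "-1 < \<beta>" "\<beta> \<le> 0"
    and S: "open S" "S \<subseteq> polydisc" "S \<subseteq> tcoord \<xi> ` chart_dom \<rho>"
    and \<tau>: "\<And>k. 0 < \<tau> k"
    and t_le: "\<And>t \<theta> k. (t, \<theta>) \<in> chart_dom \<rho> \<Longrightarrow> tcoord \<xi> (t, \<theta>) \<in> S \<Longrightarrow> t $ k \<le> \<tau> k"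
    and fib: "\<And>t. emeasure lborel {\<theta>. (t, \<theta>) \<in> chart_dom \<rho> \<and> tcoord \<xi> (t, \<theta>) \<in> S} \<le> B"
  shows "Vbeta \<beta> S \<le> B * ennreal (\<Prod>k\<in>UNIV. \<tau> k powr (\<beta> + 1))"
proof (rule Vbeta_le_fibre_bound[OF \<xi> \<rho> \<beta> S \<tau>])
  fix t
  let ?A = "{\<theta>. (t, \<theta>) \<in> chart_dom \<rho> \<and> tcoord \<xi> (t, \<theta>) \<in> S}"
  show "emeasure lborel ?A \<le> (if \<forall>k. 0 \<le> t $ k \<and> t $ k \<le> \<tau> k then B else 0)"
  proof (cases "?A = {}")
    case True
    show ?thesis unfolding True by simp
  next
    case False
    then obtain \<theta> where "(t, \<theta>) \<in> chart_dom \<rho>" "tcoord \<xi> (t, \<theta>) \<in> S" by blast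
    then have "\<forall>k. 0 \<le> t $ k \<and> t $ k \<le> \<tau> k"
      using t_le by (auto simp: chart_dom_def less_imp_le)
    then show ?thesis using fib[of t] by simp
  qed
qed

lemma prod_UNIV_3_if:
  fixes i :: 3
  shows "(\<Prod>k\<in>UNIV. (if k = i then x else 1 :: real) powr a) = x powr a"
proof -
  have "(if k = i then x else 1) powr a = (if k = i then x powr a else 1)" for k by simp
  then show ?thesis by simp
qed

lemma prod_UNIV_3_if_if:
  fixes i j :: 3
  assumes "i \<noteq> j"
  shows "(\<Prod>k\<in>UNIV. (if k = i then x else if k = j then y else 1 :: real) powr a) = x powr a * y powr a"
proof -
  have "(if k = i then x else if k = j then y else 1) powr a
      = (if k = i then x powr a else 1) * (if k = j then y powr a else 1)" for k
    using assms by simp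
  then show ?thesis by (simp add: prod.distrib)
qed

lemma scale_powr_le:
  fixes \<delta> c a :: real
  assumes "0 < \<delta>" "0 < c" "0 \<le> a" "a \<le> 1"
  shows "(2 * \<delta> / c) powr a \<le> max 1 (2 / c) * \<delta> powr a"
proof -
  have "(2 * \<delta> / c) powr a = (2 / c) powr a * \<delta> powr a"
    using powr_mult[of "2 / c" \<delta> a] by simp
  also have "\<dots> \<le> max 1 (2 / c) * \<delta> powr a"
    using powr_le_max_1[of "2 / c" a] assms by (intro mult_right_mono) auto
  finally show ?thesis .
qed

text \<open>The expansion v x (a x w) = (v . w) a - (v . a) w reduces to a nonzero multiple of
  \<open>a\<close>, so a x w cannot vanish.\<close>

lemma cross3_inner_cross3_nonzero:
  assumes "a \<noteq> 0" "a \<bullet> v = 0" "w \<bullet> v \<noteq> 0"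
  shows "cross3 a w \<bullet> cross3 a w \<noteq> 0"
proof
  assume "cross3 a w \<bullet> cross3 a w = 0"
  then have "cross3 v (cross3 a w) = 0" by simp
  then have "(v \<bullet> w) *\<^sub>R a - (v \<bullet> a) *\<^sub>R w = 0" by (simp only: Lagrange)
  then show False using assms by (simp add: inner_commute)
qed

context torus_contact
begin

lemma directional_derivative_bound_sqrt:
  "\<exists>r>0. \<exists>L>0. \<forall>q\<in>chart_dom r. \<forall>\<delta>>0. F q \<le> 2 * \<delta> \<longrightarrow> \<bar>frechet_derivative F (at q) (0, v)\<bar> \<le> L * sqrt \<delta>"
proof -
  obtain r M where r: "0 < r" "0 < M" "\<And>q. q \<in> chart_dom r \<Longrightarrow> (frechet_derivative F (at q) (0, v))\<^sup>2 \<le> M * F q"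
    using directional_derivative_bound by blast
  have "\<bar>frechet_derivative F (at q) (0, v)\<bar> \<le> sqrt (M * 2) * sqrt \<delta>" if "q \<in> chart_dom r" "F q \<le> 2 * \<delta>" for q \<delta>
  proof -
    have "M * F q \<le> M * (2 * \<delta>)" using that(2) r(2) by (intro mult_left_mono) auto
    then have "(frechet_derivative F (at q) (0, v))\<^sup>2 \<le> M * 2 * \<delta>" using r(3)[OF that(1)] by linarith
    then have "\<bar>frechet_derivative F (at q) (0, v)\<bar> \<le> sqrt (M * 2 * \<delta>)" by (intro real_le_rsqrt) simp
    then show ?thesis by (simp add: real_sqrt_mult)
  qed
  moreover have "0 < sqrt (M * 2)" using r(2) by simp
  ultimately show ?thesis using r(1) by blast
qed

text \<open>Im G and the derivative of \<open>F\<close> along \<open>v\<close> confine \<theta> in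
  two independent directions, at scales \<delta> and sqrt \<delta>. The remaining direction is
  unconstrained; a linear coordinate that is merely bounded completes the system.\<close>

lemma fibre_bound_single:
  assumes form: "second_order_form \<phi> \<xi> A" "grad \<bullet> v = 0" "0 < quadform A v"
  shows "\<exists>r>0. \<exists>K>0. \<forall>t E c \<delta>. E \<in> sets borel \<longrightarrow> 0 < \<delta> \<longrightarrow>
    (\<forall>\<theta>\<in>E. (t, \<theta>) \<in> chart_dom r \<and> \<bar>Im (G (t, \<theta>)) - c\<bar> \<le> \<delta> \<and> F (t, \<theta>) \<le> 2 * \<delta>) \<longrightarrow>
    emeasure lborel E \<le> ennreal (K * (\<delta> * sqrt \<delta>))"
proof -
  let ?d = "\<lambda>q. frechet_derivative F (at q) (0, v)"
  \<comment> \<open>With the cross product of the other two gradients as third gradient, the triple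
    product is |z|^2.\<close>
  define z where "z = cross3 grad (fibre_grad ?d)"
  obtain W where W: "0 \<in> W" "Ck_on 1 W (\<lambda>q. Im (G q))" "Ck_on 1 W ?d" using ex_Ck_on_1 by blast
  have lz: "bounded_linear (\<lambda>q :: (real^3) \<times> (real^3). z \<bullet> snd q)"
    by (intro bounded_linear_compose[OF bounded_linear_inner_right] bounded_linear_snd)
  have "frechet_derivative (\<lambda>q :: (real^3) \<times> (real^3). z \<bullet> snd q) (at 0) = (\<lambda>q. z \<bullet> snd q)"
    using frechet_derivative_at[OF bounded_linear_imp_has_derivative[OF lz]] by metis
  then have gz: "fibre_grad (\<lambda>q. z \<bullet> snd q) = z"
    by (simp add: fibre_grad_def inner_axis vec_eq_iff)
  have z: "z \<bullet> z \<noteq> 0"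
    unfolding z_def using fibre_grad_dF_inner[OF form]
    by (intro cross3_inner_cross3_nonzero[OF grad_nonzero form(2)]) simp
  obtain r1 K1 where K1: "0 < r1" "0 < K1" and b: "\<And>t E c1 c2 c3 d1 d2 d3. E \<in> sets borel \<Longrightarrow> 0 \<le> d1 \<Longrightarrow> 0 \<le> d2 \<Longrightarrow> 0 \<le> d3 \<Longrightarrow>
     (\<forall>\<theta>\<in>E. (t, \<theta>) \<in> chart_dom r1 \<and> \<bar>Im (G (t, \<theta>)) - c1\<bar> \<le> d1 \<and> \<bar>?d (t, \<theta>) - c2\<bar> \<le> d2 \<and> \<bar>z \<bullet> snd (t, \<theta>) - c3\<bar> \<le> d3) \<Longrightarrow>
     emeasure lborel E \<le> ennreal (K1 * (d1 * d2 * d3))"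
    using three_function_bound[OF W(2,3) Ck_on_bounded_linear[OF lz open_UNIV] W(1,1) UNIV_I]
      z[unfolded z_def] unfolding fibre_grad_ImG gz z_def[symmetric] by metis
  obtain r2 L where L: "0 < r2" "0 < L" "\<And>q \<delta>. q \<in> chart_dom r2 \<Longrightarrow> 0 < \<delta> \<Longrightarrow> F q \<le> 2 * \<delta> \<Longrightarrow> \<bar>?d q\<bar> \<le> L * sqrt \<delta>"
    using directional_derivative_bound_sqrt by blast
  define r where "r = min (min r1 r2) 1"
  have r: "0 < r" "r \<le> r1" "r \<le> r2" "r \<le> 1" using K1 L by (auto simp: r_def)
  have "emeasure lborel E \<le> ennreal (K1 * (L * (norm z * 6)) * (\<delta> * sqrt \<delta>))"
    if E: "E \<in> sets borel" and \<delta>: "0 < \<delta>"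
      and h: "\<forall>\<theta>\<in>E. (t, \<theta>) \<in> chart_dom r \<and> \<bar>Im (G (t, \<theta>)) - c\<bar> \<le> \<delta> \<and> F (t, \<theta>) \<le> 2 * \<delta>"
    for t E c \<delta>
  proof -
    \<comment> \<open>In \<open>chart_dom r\<close> with r \<le> 1 one has |\<theta>| < 6, hence |z
      . \<theta>| \<le> 6 |z|.\<close>
    have "emeasure lborel E \<le> ennreal (K1 * (\<delta> * (L * sqrt \<delta>) * (norm z * 6)))"
    proof (rule b[OF E, of _ _ _ t c 0 0])
      show "\<forall>\<theta>\<in>E. (t, \<theta>) \<in> chart_dom r1 \<and> \<bar>Im (G (t, \<theta>)) - c\<bar> \<le> \<delta> \<and> \<bar>?d (t, \<theta>) - 0\<bar> \<le> L * sqrt \<delta>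
          \<and> \<bar>z \<bullet> snd (t, \<theta>) - 0\<bar> \<le> norm z * 6"
      proof (intro ballI conjI)
        fix \<theta> assume "\<theta> \<in> E"
        note h\<theta> = h[rule_format, OF this]
        show "(t, \<theta>) \<in> chart_dom r1" using h\<theta> chart_dom_mono[OF r(2)] by blast
        show "\<bar>Im (G (t, \<theta>)) - c\<bar> \<le> \<delta>" using h\<theta> by simp
        show "\<bar>?d (t, \<theta>) - 0\<bar> \<le> L * sqrt \<delta>"
          using L(3)[of "(t, \<theta>)" \<delta>] h\<theta> chart_dom_mono[OF r(3)] \<delta> by auto
        have "norm \<theta> \<le> norm (t, \<theta>)" by (simp add: norm_Pair real_le_rsqrt)
        also have "\<dots> \<le> 6" using norm_chart_dom[of "(t, \<theta>)" r] h\<theta> r(4) by simp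
        finally have "norm z * norm \<theta> \<le> norm z * 6" by (intro mult_left_mono) auto
        then show "\<bar>z \<bullet> snd (t, \<theta>) - 0\<bar> \<le> norm z * 6"
          using Cauchy_Schwarz_ineq2[of z \<theta>] by simp
      qed
    qed (use \<delta> L in auto)
    then show ?thesis by (simp add: mult_ac)
  qed
  moreover have "0 < K1 * (L * (norm z * 6))" using K1 L z by auto
  ultimately show ?thesis using r(1) by blast
qed

lemma Vbeta_sublevel_single:
  assumes form: "second_order_form \<phi> \<xi> A" and ind: "2 \<le> pos_index A"
  shows "\<exists>U C. open U \<and> \<xi> \<in> U \<and> C > 0 \<and>
     (\<forall>\<beta> \<in> {-1<..0}. \<forall>\<eta>::complex. \<forall>\<delta>::real. norm \<eta> = 1 \<and> \<delta> > 0 \<longrightarrow>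
        Vbeta \<beta> {z \<in> polydisc \<inter> U. norm (\<phi> z - \<eta>) < \<delta>} \<le> ennreal (C * \<delta> powr (2 + \<beta> + 1/2)))"
proof -
  obtain v where v: "grad \<bullet> v = 0" "0 < quadform A v"
    using quadform_pos_on_hyperplane[OF ind grad_nonzero] by blast
  obtain r1 K where K: "0 < r1" "0 < K" and b: "\<And>t E c \<delta>. E \<in> sets borel \<Longrightarrow> 0 < \<delta> \<Longrightarrow>
    (\<forall>\<theta>\<in>E. (t, \<theta>) \<in> chart_dom r1 \<and> \<bar>Im (G (t, \<theta>)) - c\<bar> \<le> \<delta> \<and> F (t, \<theta>) \<le> 2 * \<delta>) \<Longrightarrow>
    emeasure lborel E \<le> ennreal (K * (\<delta> * sqrt \<delta>))"
    using fibre_bound_single[OF form v] by metis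
  obtain i where i: "0 < grad $ i"
    using grad_nonzero grad_nonneg by (metis less_eq_real_def vec_eq_iff zero_index)
  obtain r2 where r2: "0 < r2" "\<And>q. q \<in> chart_dom r2 \<Longrightarrow> grad $ i * fst q $ i \<le> F q"
    using F_ge_fst[OF i] by blast
  define r where "r = min (min r1 r2) (1/2)"
  have r: "0 < r" "r \<le> r1" "r \<le> r2" "r \<le> 1/2" using K r2 by (auto simp: r_def)
  then obtain U where U: "open U" "\<xi> \<in> U" "polydisc \<inter> U \<subseteq> tcoord \<xi> ` chart_dom r"
    using tcoord_nbhd[OF \<xi>, of r] by auto
  define C where "C = K * max 1 (2 / grad $ i)"
  have "Vbeta \<beta> {z \<in> polydisc \<inter> U. norm (\<phi> z - \<eta>) < \<delta>} \<le> ennreal (C * \<delta> powr (2 + \<beta> + 1/2))"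
    if \<beta>: "-1 < \<beta>" "\<beta> \<le> 0" and \<eta>: "norm \<eta> = 1" and \<delta>: "0 < \<delta>" for \<beta> \<eta> \<delta>
  proof -
    let ?S = "{z \<in> polydisc \<inter> U. norm (\<phi> z - \<eta>) < \<delta>}"
    have S: "open ?S" "?S \<subseteq> polydisc" "?S \<subseteq> tcoord \<xi> ` chart_dom r"
      using open_sublevel[OF U(1)] U(3) by auto
    \<comment> \<open>Only t_i is confined at scale \<delta>; the other coordinates carry the
      trivial bound 1, which contributes the factor 1 for every \<beta>.\<close>
    let ?\<tau> = "\<lambda>k. if k = i then 2 * \<delta> / grad $ i else 1"
    have "Vbeta \<beta> ?S \<le> ennreal (K * (\<delta> * sqrt \<delta>)) * ennreal (\<Prod>k\<in>UNIV. ?\<tau> k powr (\<beta> + 1))"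
    proof (rule Vbeta_le_two_scales[OF \<xi> r(1,4) \<beta> S])
      show "0 < ?\<tau> k" for k using \<delta> i by simp
      show "t $ k \<le> ?\<tau> k" if "(t, \<theta>) \<in> chart_dom r" "tcoord \<xi> (t, \<theta>) \<in> ?S" for t \<theta> k
      proof (cases "k = i")
        case True
        have "grad $ i * t $ i \<le> F (t, \<theta>)"
          using r2(2)[of "(t, \<theta>)"] that(1) chart_dom_mono[OF r(3)] by auto
        also have "\<dots> \<le> 2 * \<delta>" using near_unimodular(2)[of "(t, \<theta>)" \<eta> \<delta>] that(2) \<eta> by simp
        finally show ?thesis using True i by (simp add: pos_le_divide_eq mult.commute)
      next
        case False
        have "t $ k < r" using that(1) by (simp add: chart_dom_def)
        then show ?thesis using False r(4) by simp
      qed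
      show "emeasure lborel {\<theta>. (t, \<theta>) \<in> chart_dom r \<and> tcoord \<xi> (t, \<theta>) \<in> ?S} \<le> ennreal (K * (\<delta> * sqrt \<delta>))" for t
      proof (rule b[OF borel_fibre[OF S(1)] \<delta>])
        show "\<forall>\<theta>\<in>{\<theta>. (t, \<theta>) \<in> chart_dom r \<and> tcoord \<xi> (t, \<theta>) \<in> ?S}. (t, \<theta>) \<in> chart_dom r1
           \<and> \<bar>Im (G (t, \<theta>)) - Im (cnj (\<phi> \<xi>) * \<eta>)\<bar> \<le> \<delta> \<and> F (t, \<theta>) \<le> 2 * \<delta>"
          using near_unimodular[of "(t, _)" \<eta> \<delta>] \<eta> chart_dom_mono[OF r(2)] by blast
      qed
    qed
    also have "(\<Prod>k\<in>UNIV. ?\<tau> k powr (\<beta> + 1)) = (2 * \<delta> / grad $ i) powr (\<beta> + 1)"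
      by (rule prod_UNIV_3_if)
    also have "ennreal (K * (\<delta> * sqrt \<delta>)) * ennreal ((2 * \<delta> / grad $ i) powr (\<beta> + 1))
       = ennreal (K * (\<delta> * sqrt \<delta>) * (2 * \<delta> / grad $ i) powr (\<beta> + 1))"
      using K \<delta> by (intro ennreal_mult[symmetric]) auto
    also have "\<dots> \<le> ennreal (C * \<delta> powr (2 + \<beta> + 1/2))"
    proof (rule ennreal_leI)
      have "K * (\<delta> * sqrt \<delta>) * (2 * \<delta> / grad $ i) powr (\<beta> + 1)
          \<le> K * (\<delta> * sqrt \<delta>) * (max 1 (2 / grad $ i) * \<delta> powr (\<beta> + 1))"
        using K \<delta> scale_powr_le[OF \<delta> i, of "\<beta> + 1"] \<beta> by (intro mult_left_mono) auto
      also have "\<dots> = C * (\<delta> powr 1 * \<delta> powr (1/2) * \<delta> powr (\<beta> + 1))"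
        using \<delta> by (simp add: C_def powr_half_sqrt mult_ac)
      \<comment> \<open>The exponent splits as 1 from Im G, 1/2 from the directional derivative of
        \<open>F\<close>, and \<beta> + 1 from the confined variable t_i.\<close>
      also have "\<delta> powr 1 * \<delta> powr (1/2) * \<delta> powr (\<beta> + 1) = \<delta> powr (2 + \<beta> + 1/2)"
        unfolding powr_add[symmetric] by (simp add: algebra_simps)
      finally show "K * (\<delta> * sqrt \<delta>) * (2 * \<delta> / grad $ i) powr (\<beta> + 1) \<le> C * \<delta> powr (2 + \<beta> + 1/2)" .
    qed
    finally show ?thesis .
  qed
  moreover have "0 < C" unfolding C_def using K i by (intro mult_pos_pos) auto
  ultimately show ?thesis using U(1,2)
    by (intro exI[of _ U] exI[of _ C]) auto
qed

end

text \<open>Here v = a_1 x a_2 is forced up to scale, so Q_1(v) > 0 has to come from definiteness on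
  all of R^3. The triple product is v . w with w the fibre gradient of the derivative of
  \<open>F\<close> along \<open>v\<close>, which is positive. The roles are asymmetric: the first
  function supplies the square root.\<close>

lemma fibre_bound_pair:
  assumes "torus_contact \<phi>1 g1 \<xi>" "torus_contact \<phi>2 g2 \<xi>"
    and form: "second_order_form \<phi>1 \<xi> A" "pos_index A = 3"
    and ind: "cross3 (torus_contact.grad \<phi>1 g1 \<xi>) (torus_contact.grad \<phi>2 g2 \<xi>) \<noteq> 0"
  shows "\<exists>r>0. \<exists>K>0. \<forall>t E c1 c2 \<delta>1 \<delta>2. E \<in> sets borel \<longrightarrow> 0 < \<delta>1 \<longrightarrow> 0 < \<delta>2 \<longrightarrow>
    (\<forall>\<theta>\<in>E. (t, \<theta>) \<in> chart_dom r \<and> \<bar>Im (torus_contact.G \<phi>1 g1 \<xi> (t, \<theta>)) - c1\<bar> \<le> \<delta>1 \<and>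
       \<bar>Im (torus_contact.G \<phi>2 g2 \<xi> (t, \<theta>)) - c2\<bar> \<le> \<delta>2 \<and> torus_contact.F \<phi>1 g1 \<xi> (t, \<theta>) \<le> 2 * \<delta>1) \<longrightarrow>
    emeasure lborel E \<le> ennreal (K * (\<delta>1 * \<delta>2 * sqrt \<delta>1))"
proof -
  interpret P1: torus_contact \<phi>1 g1 \<xi> by fact
  interpret P2: torus_contact \<phi>2 g2 \<xi> by fact
  define v where "v = cross3 P1.grad P2.grad"
  have v: "P1.grad \<bullet> v = 0" "v \<noteq> 0" using ind by (simp_all add: v_def dot_cross_self)
  have Q: "0 < quadform A v" by (rule quadform_pos_of_index_3[OF form(2) v(2)])
  let ?d = "\<lambda>q. frechet_derivative P1.F (at q) (0, v)"
  obtain W1 where W1: "0 \<in> W1" "Ck_on 1 W1 (\<lambda>q. Im (P1.G q))" "Ck_on 1 W1 ?d" using P1.ex_Ck_on_1 by blast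
  obtain W2 where W2: "0 \<in> W2" "Ck_on 1 W2 (\<lambda>q. Im (P2.G q))" using P2.ex_Ck_on_1 by blast
  have nz: "cross3 (fibre_grad (\<lambda>q. Im (P1.G q))) (fibre_grad (\<lambda>q. Im (P2.G q))) \<bullet> fibre_grad ?d \<noteq> 0"
    using P1.fibre_grad_dF_inner[OF form(1) v(1) Q]
    by (simp add: P1.fibre_grad_ImG P2.fibre_grad_ImG v_def[symmetric] inner_commute)
  obtain r1 K1 where K1: "0 < r1" "0 < K1" and b: "\<And>t E c1 c2 c3 d1 d2 d3. E \<in> sets borel \<Longrightarrow> 0 \<le> d1 \<Longrightarrow> 0 \<le> d2 \<Longrightarrow> 0 \<le> d3 \<Longrightarrow>
     (\<forall>\<theta>\<in>E. (t, \<theta>) \<in> chart_dom r1 \<and> \<bar>Im (P1.G (t, \<theta>)) - c1\<bar> \<le> d1 \<and> \<bar>Im (P2.G (t, \<theta>)) - c2\<bar> \<le> d2 \<and> \<bar>?d (t, \<theta>) - c3\<bar> \<le> d3) \<Longrightarrow>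
     emeasure lborel E \<le> ennreal (K1 * (d1 * d2 * d3))"
    using three_function_bound[OF W1(2) W2(2) W1(3) W1(1) W2(1) W1(1) nz] by metis
  obtain r2 L where L: "0 < r2" "0 < L" "\<And>q \<delta>. q \<in> chart_dom r2 \<Longrightarrow> 0 < \<delta> \<Longrightarrow> P1.F q \<le> 2 * \<delta> \<Longrightarrow> \<bar>?d q\<bar> \<le> L * sqrt \<delta>"
    using P1.directional_derivative_bound_sqrt by blast
  define r where "r = min r1 r2"
  have r: "0 < r" "r \<le> r1" "r \<le> r2" using K1 L by (auto simp: r_def)
  have "emeasure lborel E \<le> ennreal (K1 * L * (\<delta>1 * \<delta>2 * sqrt \<delta>1))"
    if E: "E \<in> sets borel" and \<delta>: "0 < \<delta>1" "0 < \<delta>2"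
      and h: "\<forall>\<theta>\<in>E. (t, \<theta>) \<in> chart_dom r \<and> \<bar>Im (P1.G (t, \<theta>)) - c1\<bar> \<le> \<delta>1 \<and> \<bar>Im (P2.G (t, \<theta>)) - c2\<bar> \<le> \<delta>2
        \<and> P1.F (t, \<theta>) \<le> 2 * \<delta>1"
    for t E c1 c2 \<delta>1 \<delta>2
  proof -
    have "emeasure lborel E \<le> ennreal (K1 * (\<delta>1 * \<delta>2 * (L * sqrt \<delta>1)))"
    proof (rule b[OF E, of _ _ _ t c1 c2 0])
      show "\<forall>\<theta>\<in>E. (t, \<theta>) \<in> chart_dom r1 \<and> \<bar>Im (P1.G (t, \<theta>)) - c1\<bar> \<le> \<delta>1 \<and> \<bar>Im (P2.G (t, \<theta>)) - c2\<bar> \<le> \<delta>2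
          \<and> \<bar>?d (t, \<theta>) - 0\<bar> \<le> L * sqrt \<delta>1"
      proof (intro ballI conjI)
        fix \<theta> assume "\<theta> \<in> E"
        note h\<theta> = h[rule_format, OF this]
        show "(t, \<theta>) \<in> chart_dom r1" using h\<theta> chart_dom_mono[OF r(2)] by blast
        show "\<bar>?d (t, \<theta>) - 0\<bar> \<le> L * sqrt \<delta>1"
          using L(3)[of "(t, \<theta>)" \<delta>1] h\<theta> chart_dom_mono[OF r(3)] \<delta> by auto
        show "\<bar>Im (P1.G (t, \<theta>)) - c1\<bar> \<le> \<delta>1" "\<bar>Im (P2.G (t, \<theta>)) - c2\<bar> \<le> \<delta>2" using h\<theta> by auto
      qed
    qed (use \<delta> L in auto)
    then show ?thesis by (simp add: mult_ac)
  qed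
  moreover have "0 < K1 * L" using K1 L by simp
  ultimately show ?thesis using r(1) by blast
qed

text \<open>The real gradients arise from the complex ones by the common factors \<xi>_k and
  unimodular scalars, so real dependence would yield complex dependence.\<close>

lemma cross3_grad_nonzero:
  assumes "torus_contact \<phi>1 g1 \<xi>" "torus_contact \<phi>2 g2 \<xi>"
    and indep: "\<And>c1 c2 :: complex. c1 *s cgrad g1 \<xi> + c2 *s cgrad g2 \<xi> = 0 \<Longrightarrow> c1 = 0 \<and> c2 = 0"
  shows "cross3 (torus_contact.grad \<phi>1 g1 \<xi>) (torus_contact.grad \<phi>2 g2 \<xi>) \<noteq> 0"
proof
  interpret P1: torus_contact \<phi>1 g1 \<xi> by fact
  interpret P2: torus_contact \<phi>2 g2 \<xi> by fact
  let ?a = P1.grad and ?b = P2.grad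
  assume "cross3 ?a ?b = 0"
  then have "?b $ j * ?a $ k = ?a $ j * ?b $ k" for j k
    using exhaust_3[of j] exhaust_3[of k]
    by (auto simp: cross3_def vec_eq_iff forall_3 mult.commute)
  then have proportional: "complex_of_real (?b $ j) * of_real (?a $ k) = of_real (?a $ j) * of_real (?b $ k)" for j k
    by (metis of_real_mult)
  have "?b $ j = 0" for j
  proof -
    \<comment> \<open>Multiplied by \<xi>_k, component k of this relation becomes b_j a_k - a_j b_k
      = 0. Independence then kills its first coefficient, whence b_j = 0.\<close>
    have "(of_real (?b $ j) * cnj (\<phi>1 \<xi>)) *s cgrad g1 \<xi> + (- of_real (?a $ j) * cnj (\<phi>2 \<xi>)) *s cgrad g2 \<xi> = 0"
      unfolding vec_eq_iff
    proof
      fix k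
      have "\<xi> $ k \<noteq> 0" using P1.\<xi> by (auto simp: torus3_def dest: spec[of _ k])
      moreover have "\<xi> $ k * (of_real (?b $ j) * cnj (\<phi>1 \<xi>) * cgrad g1 \<xi> $ k - of_real (?a $ j) * cnj (\<phi>2 \<xi>) * cgrad g2 \<xi> $ k) = 0"
        using proportional[of j k] unfolding P1.grad_cgrad[of k] P2.grad_cgrad[of k] by (simp add: algebra_simps)
      ultimately show "((of_real (?b $ j) * cnj (\<phi>1 \<xi>)) *s cgrad g1 \<xi> + (- of_real (?a $ j) * cnj (\<phi>2 \<xi>)) *s cgrad g2 \<xi>) $ k = 0 $ k"
        by simp
    qed
    then have "of_real (?b $ j) * cnj (\<phi>1 \<xi>) = 0" using indep by blast
    then show ?thesis using P1.unim by auto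
  qed
  then show False using P2.grad_nonzero by (simp add: vec_eq_iff)
qed

lemma Vbeta_sublevel_pair:
  assumes T: "torus_contact \<phi>1 g1 \<xi>" "torus_contact \<phi>2 g2 \<xi>"
    and indep: "\<And>c1 c2 :: complex. c1 *s cgrad g1 \<xi> + c2 *s cgrad g2 \<xi> = 0 \<Longrightarrow> c1 = 0 \<and> c2 = 0"
    and form1: "second_order_form \<phi>1 \<xi> A1" "pos_index A1 = 3"
    and form2: "second_order_form \<phi>2 \<xi> A2" "pos_index A2 = 3"
  shows "\<exists>U C. open U \<and> \<xi> \<in> U \<and> C > 0 \<and>
     (\<forall>\<beta> \<in> {-1<..0}. \<forall>\<eta>1 \<eta>2::complex. \<forall>\<delta>1 \<delta>2::real.
        norm \<eta>1 = 1 \<and> norm \<eta>2 = 1 \<and> \<delta>1 > 0 \<and> \<delta>2 > 0 \<longrightarrow>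
        Vbeta \<beta> {z \<in> polydisc \<inter> U. norm (\<phi>1 z - \<eta>1) < \<delta>1 \<and> norm (\<phi>2 z - \<eta>2) < \<delta>2}
          \<le> ennreal (C * \<delta>1 powr (2 + \<beta>) * \<delta>2 powr (2 + \<beta>) * (min \<delta>1 \<delta>2) powr (1/2)))"
proof -
  interpret P1: torus_contact \<phi>1 g1 \<xi> by fact
  interpret P2: torus_contact \<phi>2 g2 \<xi> by fact
  let ?a = P1.grad and ?b = P2.grad
  have cr: "cross3 ?a ?b \<noteq> 0" by (rule cross3_grad_nonzero[OF T indep])
  then have cr': "cross3 ?b ?a \<noteq> 0" using cross_skew[of ?a ?b] by auto
  obtain r1 K1 where K1: "0 < r1" "0 < K1" and b1: "\<And>t E c1 c2 \<delta>1 \<delta>2. E \<in> sets borel \<Longrightarrow> 0 < \<delta>1 \<Longrightarrow> 0 < \<delta>2 \<Longrightarrow>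
    (\<forall>\<theta>\<in>E. (t, \<theta>) \<in> chart_dom r1 \<and> \<bar>Im (P1.G (t, \<theta>)) - c1\<bar> \<le> \<delta>1 \<and>
       \<bar>Im (P2.G (t, \<theta>)) - c2\<bar> \<le> \<delta>2 \<and> P1.F (t, \<theta>) \<le> 2 * \<delta>1) \<Longrightarrow>
    emeasure lborel E \<le> ennreal (K1 * (\<delta>1 * \<delta>2 * sqrt \<delta>1))"
    using fibre_bound_pair[OF T form1 cr] by metis
  obtain r2 K2 where K2: "0 < r2" "0 < K2" and b2: "\<And>t E c1 c2 \<delta>1 \<delta>2. E \<in> sets borel \<Longrightarrow> 0 < \<delta>1 \<Longrightarrow> 0 < \<delta>2 \<Longrightarrow>
    (\<forall>\<theta>\<in>E. (t, \<theta>) \<in> chart_dom r2 \<and> \<bar>Im (P2.G (t, \<theta>)) - c1\<bar> \<le> \<delta>1 \<and>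
       \<bar>Im (P1.G (t, \<theta>)) - c2\<bar> \<le> \<delta>2 \<and> P2.F (t, \<theta>) \<le> 2 * \<delta>1) \<Longrightarrow>
    emeasure lborel E \<le> ennreal (K2 * (\<delta>1 * \<delta>2 * sqrt \<delta>1))"
    using fibre_bound_pair[OF T(2,1) form2 cr'] by metis
  \<comment> \<open>Distinct indices let the two conditions confine two different variables, t_i at
    scale \<delta>1 and t_j at scale \<delta>2. If no such pair existed, nonnegativity would give
    a_i b_j = 0 for all distinct i, j, and the cross product would vanish.\<close>
  have "\<exists>i j. i \<noteq> j \<and> 0 < ?a $ i \<and> 0 < ?b $ j"
  proof (rule ccontr)
    assume "\<not> ?thesis"
    then have "?a $ i = 0 \<or> ?b $ j = 0" if "i \<noteq> j" for i j
      using that P1.grad_nonneg[of i] P2.grad_nonneg[of j] by force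
    then have z: "?a $ i * ?b $ j = 0" if "i \<noteq> j" for i j using that by auto
    have "cross3 ?a ?b = 0"
      using z[of 1 2] z[of 2 1] z[of 1 3] z[of 3 1] z[of 2 3] z[of 3 2]
      unfolding cross3_def vec_eq_iff forall_3 by auto
    then show False using cr by simp
  qed
  then obtain i j where ij: "i \<noteq> j" "0 < ?a $ i" "0 < ?b $ j" by blast
  obtain r3 where r3: "0 < r3" "\<And>q. q \<in> chart_dom r3 \<Longrightarrow> ?a $ i * fst q $ i \<le> P1.F q"
    using P1.F_ge_fst[OF ij(2)] by blast
  obtain r4 where r4: "0 < r4" "\<And>q. q \<in> chart_dom r4 \<Longrightarrow> ?b $ j * fst q $ j \<le> P2.F q"
    using P2.F_ge_fst[OF ij(3)] by blast
  define r where "r = Min {r1, r2, r3, r4, 1/2}"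
  have r: "0 < r" "r \<le> r1" "r \<le> r2" "r \<le> r3" "r \<le> r4" "r \<le> 1/2"
    using K1 K2 r3 r4 by (auto simp: r_def)
  then obtain U where U: "open U" "\<xi> \<in> U" "polydisc \<inter> U \<subseteq> tcoord \<xi> ` chart_dom r"
    using tcoord_nbhd[OF P1.\<xi>, of r] by auto
  let ?m = "max 1 (2 / ?a $ i) * max 1 (2 / ?b $ j)"
  define C where "C = (K1 + K2) * ?m"
  have m: "0 < ?m" by (intro mult_pos_pos) auto
  have "Vbeta \<beta> {z \<in> polydisc \<inter> U. norm (\<phi>1 z - \<eta>1) < \<delta>1 \<and> norm (\<phi>2 z - \<eta>2) < \<delta>2}
          \<le> ennreal (C * \<delta>1 powr (2 + \<beta>) * \<delta>2 powr (2 + \<beta>) * (min \<delta>1 \<delta>2) powr (1/2))"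
    if \<beta>: "-1 < \<beta>" "\<beta> \<le> 0" and \<eta>: "norm \<eta>1 = 1" "norm \<eta>2 = 1" and \<delta>: "0 < \<delta>1" "0 < \<delta>2" for \<beta> \<eta>1 \<eta>2 \<delta>1 \<delta>2
  proof -
    let ?S = "{z \<in> polydisc \<inter> U. norm (\<phi>1 z - \<eta>1) < \<delta>1 \<and> norm (\<phi>2 z - \<eta>2) < \<delta>2}"
    \<comment> \<open>The sum K1 + K2 dominates the constants of both orderings of \<delta>1 and
      \<delta>2.\<close>
    let ?B = "(K1 + K2) * (\<delta>1 * \<delta>2 * sqrt (min \<delta>1 \<delta>2))"
    have "?S = {z \<in> polydisc \<inter> U. norm (\<phi>1 z - \<eta>1) < \<delta>1} \<inter> {z \<in> polydisc \<inter> U. norm (\<phi>2 z - \<eta>2) < \<delta>2}"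
      by auto
    then have S: "open ?S" "?S \<subseteq> polydisc" "?S \<subseteq> tcoord \<xi> ` chart_dom r"
      using open_Int[OF P1.open_sublevel[OF U(1)] P2.open_sublevel[OF U(1)]] U(3) by auto
    have n1: "\<bar>Im (P1.G q) - Im (cnj (\<phi>1 \<xi>) * \<eta>1)\<bar> \<le> \<delta>1" "P1.F q \<le> 2 * \<delta>1"
     and n2: "\<bar>Im (P2.G q) - Im (cnj (\<phi>2 \<xi>) * \<eta>2)\<bar> \<le> \<delta>2" "P2.F q \<le> 2 * \<delta>2" if "tcoord \<xi> q \<in> ?S" for q
      using P1.near_unimodular[of q \<eta>1 \<delta>1] P2.near_unimodular[of q \<eta>2 \<delta>2] that \<eta> by auto
    let ?\<tau> = "\<lambda>k. if k = i then 2 * \<delta>1 / ?a $ i else if k = j then 2 * \<delta>2 / ?b $ j else 1"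
    have "Vbeta \<beta> ?S \<le> ennreal ?B * ennreal (\<Prod>k\<in>UNIV. ?\<tau> k powr (\<beta> + 1))"
    proof (rule Vbeta_le_two_scales[OF P1.\<xi> r(1,6) \<beta> S])
      show "0 < ?\<tau> k" for k using \<delta> ij by simp
      show "t $ k \<le> ?\<tau> k" if "(t, \<theta>) \<in> chart_dom r" "tcoord \<xi> (t, \<theta>) \<in> ?S" for t \<theta> k
      proof -
        have "?a $ i * t $ i \<le> 2 * \<delta>1"
          using r3(2)[of "(t, \<theta>)"] n1(2)[OF that(2)] that(1) chart_dom_mono[OF r(4)] by auto
        then have 1: "t $ i \<le> 2 * \<delta>1 / ?a $ i" using ij by (simp add: pos_le_divide_eq mult.commute)
        have "?b $ j * t $ j \<le> 2 * \<delta>2"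
          using r4(2)[of "(t, \<theta>)"] n2(2)[OF that(2)] that(1) chart_dom_mono[OF r(5)] by auto
        then have 2: "t $ j \<le> 2 * \<delta>2 / ?b $ j" using ij by (simp add: pos_le_divide_eq mult.commute)
        have "t $ k < r" using that(1) by (simp add: chart_dom_def)
        then show ?thesis using 1 2 r(6) by auto
      qed
      show "emeasure lborel {\<theta>. (t, \<theta>) \<in> chart_dom r \<and> tcoord \<xi> (t, \<theta>) \<in> ?S} \<le> ennreal ?B" for t
      proof -
        let ?E = "{\<theta>. (t, \<theta>) \<in> chart_dom r \<and> tcoord \<xi> (t, \<theta>) \<in> ?S}"
        have E: "?E \<in> sets borel" by (rule borel_fibre[OF S(1)])
        show ?thesis
        \<comment> \<open>The function with the smaller \<delta> takes the first role in the fibre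
          bound, which puts the minimum under the square root.\<close>
        proof (cases "\<delta>1 \<le> \<delta>2")
          case True
          have "emeasure lborel ?E \<le> ennreal (K1 * (\<delta>1 * \<delta>2 * sqrt \<delta>1))"
          proof (rule b1[OF E \<delta>])
            show "\<forall>\<theta>\<in>?E. (t, \<theta>) \<in> chart_dom r1 \<and> \<bar>Im (P1.G (t, \<theta>)) - Im (cnj (\<phi>1 \<xi>) * \<eta>1)\<bar> \<le> \<delta>1 \<and>
              \<bar>Im (P2.G (t, \<theta>)) - Im (cnj (\<phi>2 \<xi>) * \<eta>2)\<bar> \<le> \<delta>2 \<and> P1.F (t, \<theta>) \<le> 2 * \<delta>1"
              using n1 n2 chart_dom_mono[OF r(2)] by blast
          qed
          also have "\<dots> \<le> ennreal ?B"
            using True K1 K2 \<delta> by (intro ennreal_leI mult_mono) auto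
          finally show ?thesis .
        next
          case False
          have "emeasure lborel ?E \<le> ennreal (K2 * (\<delta>2 * \<delta>1 * sqrt \<delta>2))"
          proof (rule b2[OF E \<delta>(2,1)])
            show "\<forall>\<theta>\<in>?E. (t, \<theta>) \<in> chart_dom r2 \<and> \<bar>Im (P2.G (t, \<theta>)) - Im (cnj (\<phi>2 \<xi>) * \<eta>2)\<bar> \<le> \<delta>2 \<and>
              \<bar>Im (P1.G (t, \<theta>)) - Im (cnj (\<phi>1 \<xi>) * \<eta>1)\<bar> \<le> \<delta>1 \<and> P2.F (t, \<theta>) \<le> 2 * \<delta>2"
              using n1 n2 chart_dom_mono[OF r(3)] by blast
          qed
          also have "\<dots> \<le> ennreal ?B"
            using False K1 K2 \<delta> unfolding mult.commute[of \<delta>2 \<delta>1] by (intro ennreal_leI mult_mono) auto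
          finally show ?thesis .
        qed
      qed
    qed
    also have "(\<Prod>k\<in>UNIV. ?\<tau> k powr (\<beta> + 1)) = (2 * \<delta>1 / ?a $ i) powr (\<beta> + 1) * (2 * \<delta>2 / ?b $ j) powr (\<beta> + 1)"
      by (rule prod_UNIV_3_if_if[OF ij(1)])
    also have "ennreal ?B * ennreal \<dots> = ennreal (?B * ((2 * \<delta>1 / ?a $ i) powr (\<beta> + 1) * (2 * \<delta>2 / ?b $ j) powr (\<beta> + 1)))"
      using K1 K2 \<delta> by (intro ennreal_mult[symmetric]) auto
    also have "\<dots> \<le> ennreal (C * \<delta>1 powr (2 + \<beta>) * \<delta>2 powr (2 + \<beta>) * (min \<delta>1 \<delta>2) powr (1/2))"
    proof (rule ennreal_leI)
      have "?B * ((2 * \<delta>1 / ?a $ i) powr (\<beta> + 1) * (2 * \<delta>2 / ?b $ j) powr (\<beta> + 1))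
         \<le> ?B * ((max 1 (2 / ?a $ i) * \<delta>1 powr (\<beta> + 1)) * (max 1 (2 / ?b $ j) * \<delta>2 powr (\<beta> + 1)))"
        using K1 K2 \<delta> \<beta> ij by (intro mult_left_mono mult_mono scale_powr_le mult_nonneg_nonneg) auto
      also have "\<dots> = C * (\<delta>1 powr 1 * \<delta>1 powr (\<beta> + 1)) * (\<delta>2 powr 1 * \<delta>2 powr (\<beta> + 1)) * (min \<delta>1 \<delta>2) powr (1/2)"
        using \<delta> by (simp add: C_def powr_half_sqrt mult_ac)
      also have "\<dots> = C * \<delta>1 powr (2 + \<beta>) * \<delta>2 powr (2 + \<beta>) * (min \<delta>1 \<delta>2) powr (1/2)"
        unfolding powr_add[symmetric] by (simp add: algebra_simps)
      finally show "?B * ((2 * \<delta>1 / ?a $ i) powr (\<beta> + 1) * (2 * \<delta>2 / ?b $ j) powr (\<beta> + 1))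
        \<le> C * \<delta>1 powr (2 + \<beta>) * \<delta>2 powr (2 + \<beta>) * (min \<delta>1 \<delta>2) powr (1/2)" .
    qed
    finally show ?thesis .
  qed
  moreover have "0 < C" unfolding C_def using K1 K2 m by (intro mult_pos_pos) auto
  ultimately show ?thesis using U(1,2)
    by (intro exI[of _ U] exI[of _ C]) auto
qed

lemma Ck_extension_SucD: "Ck_extension (Suc k) \<phi> g \<Longrightarrow> Ck_extension k \<phi> g"
  unfolding Ck_extension_def using Ck_on_SucD by blast

theorem mainTheorem16:
  shows
  "(\<forall>(\<phi>::c3 \<Rightarrow> complex) g \<xi>.
      holo_on polydisc \<phi> \<and> (\<forall>z\<in>polydisc. norm (\<phi> z) < 1) \<and>
      Ck_extension 3 \<phi> g \<and>
      \<xi> \<in> torus3 \<and> norm (\<phi> \<xi>) = 1 \<and> truly_2dim_order2 \<phi> \<xi> \<longrightarrow>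
      (\<exists>U C. open U \<and> \<xi> \<in> U \<and> C > 0 \<and>
         (\<forall>\<beta> \<in> {-1<..0}. \<forall>\<eta>::complex. \<forall>\<delta>::real. norm \<eta> = 1 \<and> \<delta> > 0 \<longrightarrow>
            Vbeta \<beta> {z \<in> polydisc \<inter> U. norm (\<phi> z - \<eta>) < \<delta>}
              \<le> ennreal (C * \<delta> powr (2 + \<beta> + 1/2)))))
   \<and>
   (\<forall>(\<phi>1::c3 \<Rightarrow> complex) \<phi>2 g1 g2 \<xi>.
      holo_on polydisc \<phi>1 \<and> holo_on polydisc \<phi>2 \<and>
      (\<forall>z\<in>polydisc. norm (\<phi>1 z) < 1 \<and> norm (\<phi>2 z) < 1) \<and>
      Ck_extension 2 \<phi>1 g1 \<and> Ck_extension 2 \<phi>2 g2 \<and>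
      \<xi> \<in> torus3 \<and> norm (\<phi>1 \<xi>) = 1 \<and> norm (\<phi>2 \<xi>) = 1 \<and>
      truly_3dim_order2 \<phi>1 \<phi>2 g1 g2 \<xi> \<longrightarrow>
      (\<exists>U C. open U \<and> \<xi> \<in> U \<and> C > 0 \<and>
         (\<forall>\<beta> \<in> {-1<..0}. \<forall>\<eta>1 \<eta>2::complex. \<forall>\<delta>1 \<delta>2::real.
            norm \<eta>1 = 1 \<and> norm \<eta>2 = 1 \<and> \<delta>1 \<in> {0<..2} \<and> \<delta>2 \<in> {0<..2} \<longrightarrow>
            Vbeta \<beta> {z \<in> polydisc \<inter> U. norm (\<phi>1 z - \<eta>1) < \<delta>1 \<and> norm (\<phi>2 z - \<eta>2) < \<delta>2}
              \<le> ennreal (C * \<delta>1 powr (2 + \<beta>) * \<delta>2 powr (2 + \<beta>) * (min \<delta>1 \<delta>2) powr (1/2)))))"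
proof (intro conjI allI impI; elim conjE)
  fix \<phi> g :: "c3 \<Rightarrow> complex" and \<xi> :: c3
  assume h: "holo_on polydisc \<phi>" "\<forall>z\<in>polydisc. norm (\<phi> z) < 1" "Ck_extension 3 \<phi> g"
    "\<xi> \<in> torus3" "norm (\<phi> \<xi>) = 1" "truly_2dim_order2 \<phi> \<xi>"
  have "Ck_extension (Suc 2) \<phi> g" using h(3) by (simp only: eval_nat_numeral BitM.simps)
  then have "Ck_extension 2 \<phi> g" by (rule Ck_extension_SucD)
  then interpret torus_contact \<phi> g \<xi>
    using h by unfold_locales auto
  obtain A where "second_order_form \<phi> \<xi> A" "2 \<le> pos_index A"
    using h(6) by (auto simp: truly_2dim_order2_def signature_def)
  then show "\<exists>U C. open U \<and> \<xi> \<in> U \<and> C > 0 \<and>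
         (\<forall>\<beta> \<in> {-1<..0}. \<forall>\<eta>::complex. \<forall>\<delta>::real. norm \<eta> = 1 \<and> \<delta> > 0 \<longrightarrow>
            Vbeta \<beta> {z \<in> polydisc \<inter> U. norm (\<phi> z - \<eta>) < \<delta>}
              \<le> ennreal (C * \<delta> powr (2 + \<beta> + 1/2)))"
    by (rule Vbeta_sublevel_single)
next
  fix \<phi>1 \<phi>2 g1 g2 :: "c3 \<Rightarrow> complex" and \<xi> :: c3
  assume h: "holo_on polydisc \<phi>1" "holo_on polydisc \<phi>2" "\<forall>z\<in>polydisc. norm (\<phi>1 z) < 1 \<and> norm (\<phi>2 z) < 1"
    "Ck_extension 2 \<phi>1 g1" "Ck_extension 2 \<phi>2 g2" "\<xi> \<in> torus3" "norm (\<phi>1 \<xi>) = 1" "norm (\<phi>2 \<xi>) = 1"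
    "truly_3dim_order2 \<phi>1 \<phi>2 g1 g2 \<xi>"
  have T: "torus_contact \<phi>1 g1 \<xi>" "torus_contact \<phi>2 g2 \<xi>"
    using h by (auto intro!: torus_contact.intro)
  obtain A1 A2 where A: "second_order_form \<phi>1 \<xi> A1" "pos_index A1 = 3" "second_order_form \<phi>2 \<xi> A2" "pos_index A2 = 3"
    using h(9) by (auto simp: truly_3dim_order2_def signature_def)
  have indep: "c1 = 0 \<and> c2 = 0" if "c1 *s cgrad g1 \<xi> + c2 *s cgrad g2 \<xi> = 0" for c1 c2 :: complex
    using h(9) that unfolding truly_3dim_order2_def by blast
  show "\<exists>U C. open U \<and> \<xi> \<in> U \<and> C > 0 \<and>
         (\<forall>\<beta> \<in> {-1<..0}. \<forall>\<eta>1 \<eta>2::complex. \<forall>\<delta>1 \<delta>2::real.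
            norm \<eta>1 = 1 \<and> norm \<eta>2 = 1 \<and> \<delta>1 \<in> {0<..2} \<and> \<delta>2 \<in> {0<..2} \<longrightarrow>
            Vbeta \<beta> {z \<in> polydisc \<inter> U. norm (\<phi>1 z - \<eta>1) < \<delta>1 \<and> norm (\<phi>2 z - \<eta>2) < \<delta>2}
              \<le> ennreal (C * \<delta>1 powr (2 + \<beta>) * \<delta>2 powr (2 + \<beta>) * (min \<delta>1 \<delta>2) powr (1/2)))"
    using Vbeta_sublevel_pair[OF T indep A] by (meson greaterThanAtMost_iff)
qed

end
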